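(* Let $\Phi_0$ be a strictly plurisubharmonic quadratic form on $\mathbf{C}^n$ and let $q$ be a complex-valued quadratic form on $\mathbf{C}^n$ such that $$2\,\mathrm{Re}\,q(x)<\Phi_{\mathrm{herm}}(x):=\tfrac12\big(\Phi_0(x)+\Phi_0(ix)\big),\quad x\ne0,$$ and $$\det\big(\partial_x\partial_{\bar x}(\Phi_0-q)\big)\neq0.$$ Let $a\in C^\infty(\Lambda_{\Phi_0})$ be the Weyl symbol of the Toeplitz operator $\mathrm{Top}(e^{2q})$. Assume that $a\in L^\infty(\Lambda_{\Phi_0})$. Then the Toeplitz operator $$\mathrm{Top}(e^{2q}):H_{\Phi_0}(\mathbf{C}^n)\to H_{\Phi_0}(\mathbf{C}^n)$$ is bounded.
   Context: A strictly plurisubharmonic quadratic form on $\mathbf{C}^n$ is a real-valued quadratic form $\Phi_0$ on $\mathbf{C}^n\simeq\mathbf{R}^{2n}$ whose Levi matrix $\Phi''_{0,x\bar x}=(\partial_{x_j}\partial_{\bar x_k}\Phi_0)$ is positive definite. A complex-valued quadratic form $q$ on $\mathbf{C}^n$ is a complex-valued homogeneous polynomial of degree 2 in the real coordinates of $\mathbf{C}^n\simeq\mathbf{R}^{2n}$ (i.e. in $x,\bar x$; not necessarily holomorphic), and $\partial_x\partial_{\bar x}(\Phi_0-q)$ is the constant $n\times n$ matrix $(\partial_{x_j}\partial_{\bar x_k}(\Phi_0-q))$. $L(dx)$ is Lebesgue measure on $\mathbf{C}^n$. The Bargmann space is $H_{\Phi_0}(\mathbf{C}^n)=L^2(\mathbf{C}^n,e^{-2\Phi_0}L(dx))\cap\mathrm{Hol}(\mathbf{C}^n)$,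 a closed subspace of $L^2(\mathbf{C}^n,e^{-2\Phi_0}L(dx))$, and $\Pi_{\Phi_0}:L^2(\mathbf{C}^n,e^{-2\Phi_0}L(dx))\to H_{\Phi_0}(\mathbf{C}^n)$ is the orthogonal projection. The Toeplitz operator is $\mathrm{Top}(e^{2q})u=\Pi_{\Phi_0}(e^{2q}u)$, with domain $\{u\in H_{\Phi_0}(\mathbf{C}^n):e^{2q}u\in L^2(\mathbf{C}^n,e^{-2\Phi_0}L(dx))\}$; under the condition $2\,\mathrm{Re}\,q<\Phi_{\mathrm{herm}}$ on $\mathbf{C}^n\setminus\{0\}$ it is densely defined. Bounded means that there is $C>0$ with $\|\mathrm{Top}(e^{2q})u\|\le C\|u\|$ for all $u$ in the domain (so that the operator extends uniquely to a bounded operator on $H_{\Phi_0}(\mathbf{C}^n)$). Let $\Lambda_{\Phi_0}=\{(x,\frac2i\frac{\partial\Phi_0}{\partial x}(x)):x\in\mathbf{C}^n\}\subset\mathbf{C}^{2n}$. The Weyl symbol of $\mathrm{Top}(e^{2q})$ is the function $a$ on $\Lambda_{\Phi_0}$ given by $$a\Big(x,\frac2i\frac{\partial\Phi_0}{\partial x}(x)\Big)=\Big(\exp\Big(\frac14(\Phi''_{0,x\bar x})^{-1}\partial_x\cdot\partial_{\bar x}\Big)e^{2q}\Big)(x),\quad x\in\mathbf{C}^n,$$ where the exponential is the (forward) heat operator; explicitly the right-hand side equals $C_{\Phi_0}\int_{\mathbf{C}^n}e^{-4\Phi_{\mathrm{herm}}(x-y)}e^{2q(y)}\,L(dy)$,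 with $C_{\Phi_0}>0$ the constant such that $C_{\Phi_0}\int_{\mathbf{C}^n}e^{-4\Phi_{\mathrm{herm}}(y)}L(dy)=1$; the integral converges absolutely under the condition $2\,\mathrm{Re}\,q(x)<\Phi_{\mathrm{herm}}(x)=\tfrac12(\Phi_0(x)+\Phi_0(ix))$ for all $x\in\mathbf{C}^n\setminus\{0\}$. *)

theory Defs
  imports "HOL-Analysis.Analysis"
begin

section \<open>Quadratic forms and Wirtinger derivatives on \<open>\<complex>\<^sup>n\<close>\<close>

text \<open>
  \<open>\<complex>\<^sup>n\<close> is \<^typ>\<open>complex ^ 'n\<close>, whose \<^term>\<open>Basis\<close> consists of the \<open>2n\<close> real coordinate
  directions and whose measure \<^term>\<open>lborel\<close> is Lebesgue measure on \<open>\<real>\<^sup>2\<^sup>n\<close>.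
\<close>

definition quadratic_form :: "('a::euclidean_space \<Rightarrow> 'b::real_vector) \<Rightarrow> bool" where
  "quadratic_form f \<longleftrightarrow>
     (\<exists>c. \<forall>x. f x = (\<Sum>i\<in>Basis. \<Sum>j\<in>Basis. ((x \<bullet> i) * (x \<bullet> j)) *\<^sub>R c i j))"

definition directional_deriv ::
    "'a::real_vector \<Rightarrow> ('a \<Rightarrow> 'b::real_normed_vector) \<Rightarrow> 'a \<Rightarrow> 'b" where
  "directional_deriv v f x = vector_derivative (\<lambda>t::real. f (x + t *\<^sub>R v)) (at 0)"

text \<open>\<open>\<partial>\<^bsub>x_j\<^esub> = (\<partial>\<^bsub>Re x_j\<^esub> - i \<partial>\<^bsub>Im x_j\<^esub>) / 2\<close> and \<open>\<partial>\<^bsub>conj x_j\<^esub> = (\<partial>\<^bsub>Re x_j\<^esub> + i \<partial>\<^bsub>Im x_j\<^esub>) / 2\<close>.\<close>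

definition wirtinger :: "'n \<Rightarrow> (complex ^ 'n \<Rightarrow> complex) \<Rightarrow> complex ^ 'n \<Rightarrow> complex" where
  "wirtinger j f x =
     (directional_deriv (axis j 1) f x - \<i> * directional_deriv (axis j \<i>) f x) / 2"

definition wirtinger_bar :: "'n \<Rightarrow> (complex ^ 'n \<Rightarrow> complex) \<Rightarrow> complex ^ 'n \<Rightarrow> complex" where
  "wirtinger_bar j f x =
     (directional_deriv (axis j 1) f x + \<i> * directional_deriv (axis j \<i>) f x) / 2"

text \<open>For a quadratic form \<open>f\<close> the matrix \<open>levi_matrix f x\<close> does not depend on the point \<open>x\<close>.\<close>

definition levi_matrix :: "(complex ^ 'n \<Rightarrow> complex) \<Rightarrow> complex ^ 'n \<Rightarrow> complex ^ 'n ^ 'n" where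
  "levi_matrix f x = (\<chi> j k. wirtinger j (wirtinger_bar k f) x)"

definition pos_def_matrix :: "complex ^ 'n ^ 'n \<Rightarrow> bool" where
  "pos_def_matrix A \<longleftrightarrow>
     (\<forall>j k. A $ k $ j = cnj (A $ j $ k)) \<and>
     (\<forall>v. v \<noteq> 0 \<longrightarrow> 0 < Re (\<Sum>j\<in>UNIV. \<Sum>k\<in>UNIV. A $ j $ k * v $ j * cnj (v $ k)))"

definition strictly_psh_quadratic_form :: "(complex ^ 'n \<Rightarrow> real) \<Rightarrow> bool" where
  "strictly_psh_quadratic_form \<Phi> \<longleftrightarrow>
     quadratic_form \<Phi> \<and>
     (\<forall>x. pos_def_matrix (levi_matrix (\<lambda>y. complex_of_real (\<Phi> y)) x))"

definition herm_part :: "(complex ^ 'n \<Rightarrow> real) \<Rightarrow> complex ^ 'n \<Rightarrow> real" where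
  "herm_part \<Phi> x = (\<Phi> x + \<Phi> (\<i> *s x)) / 2"


section \<open>The Bargmann space and Toeplitz operators\<close>

text \<open>
  Elements of \<open>L\<^sup>2\<close> and \<open>L\<^sup>\<infinity>\<close> are represented by functions rather than by classes modulo
  equality almost everywhere.
\<close>

definition L2_space :: "'a measure \<Rightarrow> ('a \<Rightarrow> complex) set" where
  "L2_space M = {f \<in> borel_measurable M. integrable M (\<lambda>x. (norm (f x))\<^sup>2)}"

definition L2_inner :: "'a measure \<Rightarrow> ('a \<Rightarrow> complex) \<Rightarrow> ('a \<Rightarrow> complex) \<Rightarrow> complex" where
  "L2_inner M f g = (\<integral>x. f x * cnj (g x) \<partial>M)"

definition L2_norm :: "'a measure \<Rightarrow> ('a \<Rightarrow> complex) \<Rightarrow> real" where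
  "L2_norm M f = sqrt (\<integral>x. (norm (f x))\<^sup>2 \<partial>M)"

definition Linfty_space :: "'a measure \<Rightarrow> ('a \<Rightarrow> complex) set" where
  "Linfty_space M = {f \<in> borel_measurable M. \<exists>C. AE x in M. norm (f x) \<le> C}"

definition weighted_measure :: "(complex ^ 'n \<Rightarrow> real) \<Rightarrow> (complex ^ 'n) measure" where
  "weighted_measure \<Phi> = density lborel (\<lambda>x. ennreal (exp (- 2 * \<Phi> x)))"

definition entire_Cn :: "(complex ^ 'n \<Rightarrow> complex) \<Rightarrow> bool" where
  "entire_Cn f \<longleftrightarrow>
     (\<forall>x. \<exists>f'. (f has_derivative f') (at x) \<and> (\<forall>c v. f' (c *s v) = c * f' v))"

definition bargmann_space :: "(complex ^ 'n \<Rightarrow> real) \<Rightarrow> (complex ^ 'n \<Rightarrow> complex) set" where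
  "bargmann_space \<Phi> = {u \<in> L2_space (weighted_measure \<Phi>). entire_Cn u}"

text \<open>
  The orthogonal projection of \<open>f\<close> is the unique holomorphic \<open>g\<close> in the Bargmann space with
  \<open>f - g\<close> orthogonal to that space; two holomorphic functions which agree almost everywhere are
  equal, so \<open>g\<close> is determined as a function.
\<close>

definition bargmann_proj ::
    "(complex ^ 'n \<Rightarrow> real) \<Rightarrow> (complex ^ 'n \<Rightarrow> complex) \<Rightarrow> complex ^ 'n \<Rightarrow> complex" where
  "bargmann_proj \<Phi> f =
     (THE g. g \<in> bargmann_space \<Phi> \<and>
        (\<forall>h \<in> bargmann_space \<Phi>. L2_inner (weighted_measure \<Phi>) (\<lambda>x. f x - g x) h = 0))"

definition toeplitz_domain ::
    "(complex ^ 'n \<Rightarrow> real) \<Rightarrow> (complex ^ 'n \<Rightarrow> complex) \<Rightarrow> (complex ^ 'n \<Rightarrow> complex) set" where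
  "toeplitz_domain \<Phi> p =
     {u \<in> bargmann_space \<Phi>. (\<lambda>x. p x * u x) \<in> L2_space (weighted_measure \<Phi>)}"

definition toeplitz ::
    "(complex ^ 'n \<Rightarrow> real) \<Rightarrow> (complex ^ 'n \<Rightarrow> complex) \<Rightarrow>
     (complex ^ 'n \<Rightarrow> complex) \<Rightarrow> complex ^ 'n \<Rightarrow> complex" where
  "toeplitz \<Phi> p u = bargmann_proj \<Phi> (\<lambda>x. p x * u x)"

definition toeplitz_bounded ::
    "(complex ^ 'n \<Rightarrow> real) \<Rightarrow> (complex ^ 'n \<Rightarrow> complex) \<Rightarrow> bool" where
  "toeplitz_bounded \<Phi> p \<longleftrightarrow>
     (\<exists>C>0. \<forall>u \<in> toeplitz_domain \<Phi> p.
        L2_norm (weighted_measure \<Phi>) (toeplitz \<Phi> p u) \<le> C * L2_norm (weighted_measure \<Phi>) u)"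


section \<open>The Weyl symbol\<close>

definition Lambda_point ::
    "(complex ^ 'n \<Rightarrow> real) \<Rightarrow> complex ^ 'n \<Rightarrow> (complex ^ 'n) \<times> (complex ^ 'n)" where
  "Lambda_point \<Phi> x =
     (x, (2 / \<i>) *s (\<chi> j. wirtinger j (\<lambda>y. complex_of_real (\<Phi> y)) x))"

definition Lambda_set ::
    "(complex ^ 'n \<Rightarrow> real) \<Rightarrow> ((complex ^ 'n) \<times> (complex ^ 'n)) set" where
  "Lambda_set \<Phi> = range (Lambda_point \<Phi>)"

text \<open>
  Lebesgue measure carried over to \<open>\<Lambda>\<close> by its global coordinate \<open>x\<close>. Since \<open>\<Lambda>\<close> is a real
  linear graph over \<open>\<complex>\<^sup>n\<close>, this differs from its Euclidean surface measure by a positive constant, so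
  \<open>L\<^sup>\<infinity>(\<Lambda>)\<close> is the same for both.
\<close>

definition Lambda_measure ::
    "(complex ^ 'n \<Rightarrow> real) \<Rightarrow> ((complex ^ 'n) \<times> (complex ^ 'n)) measure" where
  "Lambda_measure \<Phi> = distr lborel (restrict_space borel (Lambda_set \<Phi>)) (Lambda_point \<Phi>)"

text \<open>
  \<open>exp ((1/4) (\<Phi>''\<^bsub>x conj x\<^esub>)\<^sup>-\<^sup>1 \<partial>\<^bsub>x\<^esub> \<cdot> \<partial>\<^bsub>conj x\<^esub>)\<close>, the forward heat operator, as convolution with its
  Gaussian kernel, normalised to have integral \<open>1\<close>.
\<close>

definition heat_operator ::
    "(complex ^ 'n \<Rightarrow> real) \<Rightarrow> (complex ^ 'n \<Rightarrow> complex) \<Rightarrow> complex ^ 'n \<Rightarrow> complex" where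
  "heat_operator \<Phi> p x =
     complex_of_real (1 / (\<integral>y. exp (- 4 * herm_part \<Phi> y) \<partial>lborel)) *
     (\<integral>y. complex_of_real (exp (- 4 * herm_part \<Phi> (x - y))) * p y \<partial>lborel)"

text \<open>
  A symbol is a function on \<open>\<Lambda>\<close>; the values of \<open>a\<close> off \<open>\<Lambda>\<close> are unconstrained and irrelevant.
\<close>

definition is_weyl_symbol ::
    "(complex ^ 'n \<Rightarrow> real) \<Rightarrow> (complex ^ 'n \<Rightarrow> complex) \<Rightarrow>
     ((complex ^ 'n) \<times> (complex ^ 'n) \<Rightarrow> complex) \<Rightarrow> bool" where
  "is_weyl_symbol \<Phi> p a \<longleftrightarrow> (\<forall>x. a (Lambda_point \<Phi> x) = heat_operator \<Phi> p x)"

end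

theory Submission
  imports Defs "HOL-Probability.Distributions" "HOL-Complex_Analysis.Cauchy_Integral_Formula"
begin

text \<open>
  Write \<open>\<Phi>\<^sub>0 = N + Re g\<close> with \<open>N = \<Phi>\<^sub>h\<^sub>e\<^sub>r\<^sub>m\<close> the quadratic form of a hermitian form \<open>\<psi>\<close> and \<open>g\<close>
  holomorphic. Averaging over rotations \<open>z \<mapsto> e\<^sup>i\<^sup>\<theta> z\<close> shows that the Bargmann projection has kernel
  \<open>exp (g x + cnj (g y) + 2 \<psi> x y) / c\<^sub>0\<close>, so \<open>Top(e\<^sup>2\<^sup>q)\<close> has kernel
  \<open>exp (g x + cnj (g w)) G (x, w) / c\<^sub>0\<^sup>2\<close> where \<open>G\<close> is a Gaussian integral depending on linear
  parameters \<open>(x, w)\<close>. Hence \<open>G = G 0 \<cdot> exp E\<close> with a quadratic form \<open>E\<close>. The matrix elements \<open>G (x, w)\<close>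
  between coherent states are integrals of the Weyl symbol against Gaussians, so a bounded symbol gives
  \<open>|G (x, w)| \<le> M exp (N x + N w)\<close>, that is, \<open>B = N x + N w - Re E \<ge> 0\<close> unless \<open>G 0 = 0\<close>. Looking at the critical
  point of the Gaussian integral shows that \<open>B\<close> is positive definite on both coordinate axes, and then
  the operator with kernel \<open>exp (-B)\<close> is bounded on \<open>L\<^sup>2\<close> by Schur's test.
\<close>

section \<open>Lebesgue measure and integral operators\<close>

text \<open>Nonnegativity of \<open>B\<close> alone would not bound the operator: if
  \<open>B\<close> vanished at some \<open>(0, w)\<close> with \<open>w\<close> nonzero, the kernel
  \<open>exp (- B)\<close> would not be integrable in its second variable. But a null vector of a
  semidefinite form is orthogonal to everything, and the hermitian terms of \<open>B\<close> do not
  couple the two variables, so the real part of the cross term of \<open>E\<close> would vanish too.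
  Coercivity of the Gaussian exponent and nondegeneracy of \<open>\<psi>\<close> exclude this.
  Neither determinants nor branches of square roots enter: the dependence of the Gaussian integral
  on its linear term follows from a differential equation in a scaling parameter, with the exponent
  read off at a formal critical point in the complexification. The reproducing formula and the heat
  computation rest on the mean value property, after a translation has cancelled the antiholomorphic
  factor, so no contour is moved. Norm estimates are made after moving the weight
  \<open>exp (- \<Phi>)\<close> onto the functions; this leaves ordinary \<open>L^2\<close> norms
  and removes the holomorphic part \<open>g\<close> from all moduli.\<close>

lemma integrable_exp_neg_norm_sqr:
  assumes "e > 0"
  shows "integrable lborel (\<lambda>x::'a::euclidean_space. exp (- e * (norm x)\<^sup>2))"
proof -
  have "integrable lborel (\<lambda>x::real. exp (- x\<^sup>2))"
    using has_bochner_integral_even_function[OF gaussian_moment_0]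
    by (simp add: has_bochner_integral_iff)
  from lborel_integrable_real_affine[OF this, of "sqrt e" 0]
  have 1: "integrable lborel (\<lambda>x::real. exp (- e * x\<^sup>2))"
    using assms by (simp add: power_mult_distrib)
  show ?thesis
  proof (rule integrableI_bounded)
    have "exp (- e * (norm x)\<^sup>2) = (\<Prod>b\<in>Basis. exp (- e * (x \<bullet> b)\<^sup>2))" for x :: 'a
      by (simp add: exp_sum[symmetric] sum_distrib_left[symmetric] power2_norm_eq_inner
          power2_eq_square[of "_ \<bullet> _"] euclidean_inner[of x x, symmetric] sum_negf)
    then have "(\<integral>\<^sup>+x. ennreal (norm (exp (- e * (norm (x::'a))\<^sup>2))) \<partial>lborel) =
        (\<integral>\<^sup>+x. (\<Prod>b\<in>Basis. ennreal (exp (- e * ((x::'a) \<bullet> b)\<^sup>2))) \<partial>lborel)"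
      by (simp add: prod_ennreal abs_prod)
    also have "\<dots> = (\<Prod>b\<in>(Basis::'a set). \<integral>\<^sup>+t. ennreal (exp (- e * t\<^sup>2)) \<partial>lborel)"
      by (rule nn_integral_lborel_prod) auto
    also have "\<dots> < \<infinity>"
      using 1 by (simp add: less_top[symmetric] ennreal_prod_eq_top integrable_iff_bounded power_eq_top_ennreal)
    finally show "(\<integral>\<^sup>+x. ennreal (norm (exp (- e * (norm (x::'a))\<^sup>2))) \<partial>lborel) < \<infinity>" .
  qed auto
qed

lemma integrable_exp_neg_norm_sqr_linear:
  assumes "e > 0"
  shows "integrable lborel (\<lambda>x::'a::euclidean_space. exp (c * norm x - e * (norm x)\<^sup>2))"
proof (rule Bochner_Integration.integrable_bound)
  show "integrable lborel (\<lambda>x::'a. exp (c\<^sup>2 / (2 * e)) * exp (- (e / 2) * (norm x)\<^sup>2))"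
    using assms integrable_exp_neg_norm_sqr[of "e/2"] by (intro integrable_mult_right) auto
  \<comment> \<open>Half of the quadratic decay is given up to absorb the linear term; the constant
    comes from the square of \<open>e * t - c\<close>.\<close>
  have "c * t - e * t\<^sup>2 \<le> c\<^sup>2 / (2 * e) - e / 2 * t\<^sup>2" for t :: real
  proof -
    have "0 \<le> (e * t - c)\<^sup>2 / (2 * e)" using assms by auto
    then show ?thesis using assms by (simp add: power2_eq_square field_simps)
  qed
  then show "AE x::'a in lborel. norm (exp (c * norm x - e * (norm x)\<^sup>2)) \<le>
       norm (exp (c\<^sup>2 / (2 * e)) * exp (- (e / 2) * (norm x)\<^sup>2))"
    by (simp add: mult_exp_exp)
qed auto

section \<open>Lebesgue measure under translations, reflections and linear isometries\<close>

lemma nn_integral_lborel_translate: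
  fixes c :: "'a::euclidean_space"
  assumes [measurable]: "f \<in> borel_measurable borel"
  shows "(\<integral>\<^sup>+x. f (x + c) \<partial>lborel) = (\<integral>\<^sup>+x. f x \<partial>lborel)"
  by (subst (2) lborel_distr_plus[of c, symmetric]) (simp add: nn_integral_distr add.commute)

lemma lborel_distr_reflect:
  "distr lborel borel (\<lambda>x. c - x) = (lborel :: 'a::euclidean_space measure)"
  using lborel_affine[of "-1" c] by (simp add: density_1)

lemma nn_integral_lborel_reflect:
  fixes c :: "'a::euclidean_space"
  assumes [measurable]: "f \<in> borel_measurable borel"
  shows "(\<integral>\<^sup>+x. f (c - x) \<partial>lborel) = (\<integral>\<^sup>+x. f x \<partial>lborel)"
  by (subst (2) lborel_distr_reflect[of c, symmetric]) (simp add: nn_integral_distr)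

lemma integrable_lborel_translate:
  fixes f :: "'a::euclidean_space \<Rightarrow> 'b::{banach, second_countable_topology}"
  assumes "integrable lborel f"
  shows "integrable lborel (\<lambda>x. f (x + c))"
proof -
  have "integrable (distr lborel borel ((+) c)) f"
    using assms by (simp add: lborel_distr_plus)
  then show ?thesis
    by (subst (asm) integrable_distr_eq) (use assms in \<open>auto simp: add.commute\<close>)
qed

lemma integral_lborel_translate:
  fixes f :: "'a::euclidean_space \<Rightarrow> 'b::{banach, second_countable_topology}"
  assumes [measurable]: "f \<in> borel_measurable borel"
  shows "(\<integral>x. f (x + c) \<partial>lborel) = (\<integral>x. f x \<partial>lborel)"
  by (subst (2) lborel_distr_plus[of c, symmetric]) (simp add: integral_distr add.commute)

text \<open>The image measure is translation invariant because \<open>L\<close> is onto. Comparing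
  it with Lebesgue measure by Tonelli, as in the uniqueness proof for Haar measure, shows that the
  two are proportional, and the unit ball, which \<open>L\<close> preserves, fixes the factor as 1.
  The application is to multiplication by unimodular scalars on \<open>\<complex>^n\<close>.\<close>

lemma lborel_distr_linear_isometry:
  fixes L :: "'a::euclidean_space \<Rightarrow> 'a"
  assumes L: "linear L" and iso: "\<And>x. norm (L x) = norm x"
  shows "distr lborel borel L = lborel"
proof (rule measure_eqI)
  have [measurable]: "L \<in> borel \<rightarrow>\<^sub>M borel"
    using linear_continuous_on[of L UNIV] L
    by (auto intro: borel_measurable_continuous_onI simp: linear_conv_bounded_linear)
  have "inj L"
    using L iso by (auto simp: linear_injective_0) (metis norm_eq_zero)
  then have "surj L"
    using L linear_injective_imp_surjective by blast
  then obtain L' where L': "\<And>y. L (L' y) = y"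
    by (metis surj_def)
  fix A assume "A \<in> sets (distr lborel borel L)"
  then have A[measurable]: "A \<in> sets borel" by simp
  define B :: "'a set" where "B = ball 0 1"
  have [measurable]: "B \<in> sets borel" by (simp add: B_def)
  let ?\<mu> = "distr lborel borel L"
  have mu: "(\<integral>\<^sup>+x. indicator X (L x) \<partial>lborel) = emeasure ?\<mu> X" if [measurable]: "X \<in> sets borel" for X
  proof -
    have "emeasure ?\<mu> X = (\<integral>\<^sup>+x. indicator X x \<partial>?\<mu>)" by simp
    also have "\<dots> = (\<integral>\<^sup>+x. indicator X (L x) \<partial>lborel)" by (rule nn_integral_distr) auto
    finally show ?thesis by simp
  qed
  have "emeasure ?\<mu> A * emeasure lborel B =
      (\<integral>\<^sup>+x. indicator A (L x) * emeasure lborel B \<partial>lborel)"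
    by (simp add: nn_integral_multc mu)
  also have "\<dots> = (\<integral>\<^sup>+x. indicator A (L x) * (\<integral>\<^sup>+y. indicator B (y + L x) \<partial>lborel) \<partial>lborel)"
    by (subst nn_integral_lborel_translate) auto
  also have "\<dots> = (\<integral>\<^sup>+x. (\<integral>\<^sup>+y. indicator A (L x) * indicator B (y + L x) \<partial>lborel) \<partial>lborel)"
    by (simp add: nn_integral_cmult)
  also have "\<dots> = (\<integral>\<^sup>+y. (\<integral>\<^sup>+x. indicator A (L x) * indicator B (y + L x) \<partial>lborel) \<partial>lborel)"
    by (rule lborel_pair.Fubini') measurable
  \<comment> \<open>Since \<open>y = L (L' y)\<close>, the sum \<open>y + L x\<close> equals
    \<open>L (x + L' y)\<close>, so the substitution is a translation of \<open>x\<close> by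
    \<open>L' y\<close>.\<close>
  also have "\<dots> = (\<integral>\<^sup>+y. (\<integral>\<^sup>+x. indicator A (L x - y) * indicator B (L x) \<partial>lborel) \<partial>lborel)"
  proof (rule nn_integral_cong)
    fix y
    have "(\<integral>\<^sup>+x. indicator A (L x) * indicator B (y + L x) \<partial>lborel) =
       (\<integral>\<^sup>+x. (\<lambda>x. indicator A (L x - y) * indicator B (L x)) (x + L' y) \<partial>lborel)"
      by (simp add: linear_add[OF L] L' add.commute)
    then show "(\<integral>\<^sup>+x. indicator A (L x) * indicator B (y + L x) \<partial>lborel) =
       (\<integral>\<^sup>+x. indicator A (L x - y) * indicator B (L x) \<partial>lborel)"
      by (subst (asm) nn_integral_lborel_translate) auto
  qed
  also have "\<dots> = (\<integral>\<^sup>+x. (\<integral>\<^sup>+y. indicator A (L x - y) * indicator B (L x) \<partial>lborel) \<partial>lborel)"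
    by (rule lborel_pair.Fubini'[symmetric]) measurable
  also have "\<dots> = (\<integral>\<^sup>+x. (\<integral>\<^sup>+y. indicator A (L x - y) \<partial>lborel) * indicator B (L x) \<partial>lborel)"
    by (simp add: nn_integral_multc)
  also have "\<dots> = (\<integral>\<^sup>+x. emeasure lborel A * indicator B (L x) \<partial>lborel)"
    by (subst nn_integral_lborel_reflect) auto
  also have "\<dots> = emeasure lborel A * emeasure ?\<mu> B"
    by (simp add: nn_integral_cmult mu)
  also have "emeasure ?\<mu> B = emeasure lborel (L -` B)"
    by (simp add: emeasure_distr)
  also have "L -` B = B"
    by (auto simp: B_def iso)
  finally have eq: "emeasure ?\<mu> A * emeasure lborel B = emeasure lborel A * emeasure lborel B" .
  have "emeasure lborel B \<noteq> \<infinity>"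
    unfolding B_def using emeasure_bounded_finite[OF bounded_ball[of "0::'a" 1]] by auto
  moreover have "emeasure lborel B \<noteq> 0"
    unfolding B_def using content_ball_pos[of 1 "0::'a"] 
    by (metis emeasure_lborel_ball_finite measure_def enn2real_0 less_irrefl measure_completion zero_less_one sets_lborel borel_open open_ball)
  ultimately show "emeasure ?\<mu> A = emeasure lborel A"
    using eq by (metis ennreal_mult_cancel_left infinity_ennreal_def mult.commute)
qed simp

section \<open>Schur's test and exchange of integrals\<close>

lemma abs_mult_le_sum_squares: "\<bar>a * b\<bar> \<le> a\<^sup>2 + b\<^sup>2" for a b :: real
proof -
  have "2 * \<bar>a\<bar> * \<bar>b\<bar> \<le> a\<^sup>2 + b\<^sup>2" "0 \<le> \<bar>a\<bar> * \<bar>b\<bar>"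
    using sum_squares_bound[of "\<bar>a\<bar>" "\<bar>b\<bar>"] by auto
  then show ?thesis unfolding abs_mult by linarith
qed

text \<open>Cauchy-Schwarz for the splitting of \<open>k f\<close> into \<open>sqrt k\<close> and
  \<open>sqrt k * f\<close>: the first factor contributes a row integral, and Tonelli turns the
  second into a column integral.\<close>

lemma schur_test:
  fixes k :: "'a::euclidean_space \<Rightarrow> 'a \<Rightarrow> real" and f :: "'a \<Rightarrow> ennreal"
  assumes k[measurable]: "case_prod k \<in> borel_measurable (borel \<Otimes>\<^sub>M borel)"
    and nonneg: "\<And>x y. 0 \<le> k x y"
    and row: "\<And>x. (\<integral>\<^sup>+y. ennreal (k x y) \<partial>lborel) \<le> C"
    and col: "\<And>y. (\<integral>\<^sup>+x. ennreal (k x y) \<partial>lborel) \<le> C"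
    and f[measurable]: "f \<in> borel_measurable borel"
  shows "(\<integral>\<^sup>+x. (\<integral>\<^sup>+y. ennreal (k x y) * f y \<partial>lborel)\<^sup>2 \<partial>lborel) \<le> C\<^sup>2 * (\<integral>\<^sup>+y. (f y)\<^sup>2 \<partial>lborel)"
proof -
  have "(\<integral>\<^sup>+y. ennreal (k x y) * f y \<partial>lborel)\<^sup>2 \<le> C * (\<integral>\<^sup>+y. ennreal (k x y) * (f y)\<^sup>2 \<partial>lborel)" for x
  proof -
    have sq: "(ennreal (sqrt (k x y)))\<^sup>2 = ennreal (k x y)" for y
      using nonneg[of x y] by (simp add: ennreal_power)
    have "(\<integral>\<^sup>+y. ennreal (k x y) * f y \<partial>lborel)\<^sup>2 =
        (\<integral>\<^sup>+y. ennreal (sqrt (k x y)) * (ennreal (sqrt (k x y)) * f y) \<partial>lborel)\<^sup>2"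
      by (simp add: mult.assoc[symmetric] power2_eq_square[symmetric] sq)
    also have "\<dots> \<le> (\<integral>\<^sup>+y. (ennreal (sqrt (k x y)))\<^sup>2 \<partial>lborel) *
        (\<integral>\<^sup>+y. (ennreal (sqrt (k x y)) * f y)\<^sup>2 \<partial>lborel)"
      by (rule Cauchy_Schwarz_nn_integral) auto
    also have "\<dots> = (\<integral>\<^sup>+y. ennreal (k x y) \<partial>lborel) * (\<integral>\<^sup>+y. ennreal (k x y) * (f y)\<^sup>2 \<partial>lborel)"
      by (simp add: power_mult_distrib sq)
    also have "\<dots> \<le> C * (\<integral>\<^sup>+y. ennreal (k x y) * (f y)\<^sup>2 \<partial>lborel)"
      by (intro mult_right_mono row) auto
    finally show ?thesis .
  qed
  then have "(\<integral>\<^sup>+x. (\<integral>\<^sup>+y. ennreal (k x y) * f y \<partial>lborel)\<^sup>2 \<partial>lborel) \<le>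
      (\<integral>\<^sup>+x. C * (\<integral>\<^sup>+y. ennreal (k x y) * (f y)\<^sup>2 \<partial>lborel) \<partial>lborel)"
    by (intro nn_integral_mono)
  also have "\<dots> = C * (\<integral>\<^sup>+x. (\<integral>\<^sup>+y. ennreal (k x y) * (f y)\<^sup>2 \<partial>lborel) \<partial>lborel)"
    by (rule nn_integral_cmult) measurable
  also have "(\<integral>\<^sup>+x. (\<integral>\<^sup>+y. ennreal (k x y) * (f y)\<^sup>2 \<partial>lborel) \<partial>lborel) =
      (\<integral>\<^sup>+y. (\<integral>\<^sup>+x. ennreal (k x y) * (f y)\<^sup>2 \<partial>lborel) \<partial>lborel)"
    by (rule lborel_pair.Fubini') measurable
  also have "\<dots> = (\<integral>\<^sup>+y. (\<integral>\<^sup>+x. ennreal (k x y) \<partial>lborel) * (f y)\<^sup>2 \<partial>lborel)"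
    by (simp add: nn_integral_multc)
  also have "\<dots> \<le> (\<integral>\<^sup>+y. C * (f y)\<^sup>2 \<partial>lborel)"
    by (intro nn_integral_mono mult_right_mono col) auto
  also have "\<dots> = C * (\<integral>\<^sup>+y. (f y)\<^sup>2 \<partial>lborel)"
    by (rule nn_integral_cmult) measurable
  finally show ?thesis
    by (simp add: power2_eq_square mult.assoc mult_left_mono)
qed

text \<open>Bounding the product \<open>g x * f y\<close> by a sum of squares separates the
  variables, so that one marginal of \<open>k\<close> controls each summand. This justifies Fubini
  in the proof that the projection is symmetric.\<close>

lemma integrable_schur_kernel:
  fixes k :: "'a::euclidean_space \<Rightarrow> 'a \<Rightarrow> real" and f g :: "'a \<Rightarrow> real"
  assumes k[measurable]: "case_prod k \<in> borel_measurable (borel \<Otimes>\<^sub>M borel)"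
    and nonneg: "\<And>x y. 0 \<le> k x y"
    and row: "\<And>x. (\<integral>\<^sup>+y. ennreal (k x y) \<partial>lborel) \<le> ennreal C"
    and col: "\<And>y. (\<integral>\<^sup>+x. ennreal (k x y) \<partial>lborel) \<le> ennreal C"
    and fm[measurable]: "f \<in> borel_measurable borel" and f: "integrable lborel (\<lambda>x. (f x)\<^sup>2)"
    and gm[measurable]: "g \<in> borel_measurable borel" and g: "integrable lborel (\<lambda>x. (g x)\<^sup>2)"
  shows "integrable (lborel \<Otimes>\<^sub>M lborel) (\<lambda>(x, y). k x y * (g x * f y))"
proof (rule Bochner_Integration.integrable_bound)
  show "integrable (lborel \<Otimes>\<^sub>M lborel) (\<lambda>(x, y). k x y * ((g x)\<^sup>2 + (f y)\<^sup>2))"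
  proof (rule integrableI_bounded)
    have "(\<integral>\<^sup>+p. ennreal (norm (case p of (x, y) \<Rightarrow> k x y * ((g x)\<^sup>2 + (f y)\<^sup>2))) \<partial>(lborel \<Otimes>\<^sub>M lborel)) =
      (\<integral>\<^sup>+p. (case p of (x, y) \<Rightarrow> ennreal (k x y) * ennreal ((g x)\<^sup>2)) +
             (case p of (x, y) \<Rightarrow> ennreal (k x y) * ennreal ((f y)\<^sup>2)) \<partial>(lborel \<Otimes>\<^sub>M lborel))"
      by (intro nn_integral_cong)
         (auto simp: nonneg abs_mult ennreal_mult'[symmetric] ennreal_plus[symmetric] ring_distribs simp del: ennreal_plus split: prod.splits)
    also have "\<dots> = (\<integral>\<^sup>+p. (case p of (x, y) \<Rightarrow> ennreal (k x y) * ennreal ((g x)\<^sup>2)) \<partial>(lborel \<Otimes>\<^sub>M lborel)) +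
        (\<integral>\<^sup>+p. (case p of (x, y) \<Rightarrow> ennreal (k x y) * ennreal ((f y)\<^sup>2)) \<partial>(lborel \<Otimes>\<^sub>M lborel))"
      by (rule nn_integral_add) measurable
    also have "(\<integral>\<^sup>+p. (case p of (x, y) \<Rightarrow> ennreal (k x y) * ennreal ((g x)\<^sup>2)) \<partial>(lborel \<Otimes>\<^sub>M lborel)) =
       (\<integral>\<^sup>+x. (\<integral>\<^sup>+y. ennreal (k x y) \<partial>lborel) * ennreal ((g x)\<^sup>2) \<partial>lborel)"
      by (subst lborel.nn_integral_fst[symmetric]) (auto simp: nn_integral_multc)
    also have "(\<integral>\<^sup>+p. (case p of (x, y) \<Rightarrow> ennreal (k x y) * ennreal ((f y)\<^sup>2)) \<partial>(lborel \<Otimes>\<^sub>M lborel)) =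
       (\<integral>\<^sup>+y. (\<integral>\<^sup>+x. ennreal (k x y) \<partial>lborel) * ennreal ((f y)\<^sup>2) \<partial>lborel)"
      by (subst lborel_pair.nn_integral_snd[symmetric]) (auto simp: nn_integral_multc)
    also have "(\<integral>\<^sup>+x. (\<integral>\<^sup>+y. ennreal (k x y) \<partial>lborel) * ennreal ((g x)\<^sup>2) \<partial>lborel) +
        (\<integral>\<^sup>+y. (\<integral>\<^sup>+x. ennreal (k x y) \<partial>lborel) * ennreal ((f y)\<^sup>2) \<partial>lborel) \<le>
        (\<integral>\<^sup>+x. ennreal C * ennreal ((g x)\<^sup>2) \<partial>lborel) + (\<integral>\<^sup>+y. ennreal C * ennreal ((f y)\<^sup>2) \<partial>lborel)"
      by (intro add_mono nn_integral_mono mult_right_mono row col) auto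
    also have "\<dots> < \<infinity>"
      using f g by (simp add: nn_integral_cmult integrable_iff_bounded ennreal_mult_less_top)
    finally show "(\<integral>\<^sup>+p. ennreal (norm (case p of (x, y) \<Rightarrow> k x y * ((g x)\<^sup>2 + (f y)\<^sup>2))) \<partial>(lborel \<Otimes>\<^sub>M lborel)) < \<infinity>" .
  qed measurable
  show "AE p in lborel \<Otimes>\<^sub>M lborel. norm (case p of (x, y) \<Rightarrow> k x y * (g x * f y)) \<le>
      norm (case p of (x, y) \<Rightarrow> k x y * ((g x)\<^sup>2 + (f y)\<^sup>2))"
    by (intro AE_I2) (auto simp: abs_mult[of "k _ _"] nonneg abs_mult_le_sum_squares intro!: mult_left_mono split: prod.splits)
qed measurable

lemma integrable_L2_mult:
  fixes f g :: "'a \<Rightarrow> real"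
  assumes [measurable]: "f \<in> borel_measurable M" "g \<in> borel_measurable M"
    and "integrable M (\<lambda>x. (f x)\<^sup>2)" "integrable M (\<lambda>x. (g x)\<^sup>2)"
  shows "integrable M (\<lambda>x. f x * g x)"
proof (rule Bochner_Integration.integrable_bound)
  show "integrable M (\<lambda>x. (f x)\<^sup>2 + (g x)\<^sup>2)" using assms by auto
  show "AE x in M. norm (f x * g x) \<le> norm ((f x)\<^sup>2 + (g x)\<^sup>2)"
    using abs_mult_le_sum_squares by auto
qed measurable

lemma Fubini_dominated:
  fixes f :: "'a::euclidean_space \<Rightarrow> 'b::euclidean_space \<Rightarrow> complex"
  assumes [measurable]: "case_prod f \<in> borel_measurable (borel \<Otimes>\<^sub>M borel)"
    and g: "integrable lborel (g :: 'a \<Rightarrow> real)" and h: "integrable lborel (h :: 'b \<Rightarrow> real)"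
    and bound: "\<And>x y. norm (f x y) \<le> g x * h y"
  shows "(\<integral>y. (\<integral>x. f x y \<partial>lborel) \<partial>lborel) = (\<integral>x. (\<integral>y. f x y \<partial>lborel) \<partial>lborel)"
proof (rule lborel_pair.Fubini_integral)
  have [measurable]: "g \<in> borel_measurable borel" "h \<in> borel_measurable borel"
    using g h by auto
  have "integrable (lborel \<Otimes>\<^sub>M lborel) (\<lambda>(x, y). g x * h y)"
    by (rule lborel_pair.Fubini_integrable) (use g h in \<open>auto simp: abs_mult\<close>)
  then show "integrable (lborel \<Otimes>\<^sub>M lborel) (case_prod f)"
    by (rule Bochner_Integration.integrable_bound)
      (auto split: prod.splits intro!: order.trans[OF bound])
qed

text \<open>Here \<open>U\<close> and \<open>W\<close> stand for the weighted moduli of a function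
  and of its image. The pointwise hypothesis uses the nonnegative integral and can therefore be
  checked before that integral is known to be finite.\<close>

lemma schur_L2:
  fixes k :: "'a::euclidean_space \<Rightarrow> 'a \<Rightarrow> real" and U :: "'a \<Rightarrow> real" and W :: "'a \<Rightarrow> real"
  assumes k[measurable]: "case_prod k \<in> borel_measurable (borel \<Otimes>\<^sub>M borel)"
    and nonneg: "\<And>x y. 0 \<le> k x y"
    and row: "\<And>x. (\<integral>\<^sup>+y. ennreal (k x y) \<partial>lborel) \<le> ennreal C"
    and col: "\<And>y. (\<integral>\<^sup>+x. ennreal (k x y) \<partial>lborel) \<le> ennreal C"
    and C: "C \<ge> 0"
    and U[measurable]: "U \<in> borel_measurable borel" and U2: "integrable lborel (\<lambda>x. (U x)\<^sup>2)"
    and U0: "\<And>x. U x \<ge> 0"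
    and W[measurable]: "W \<in> borel_measurable borel"
    and le: "\<And>x. ennreal \<bar>W x\<bar> \<le> (\<integral>\<^sup>+y. ennreal (k x y) * ennreal (U y) \<partial>lborel)"
  shows "integrable lborel (\<lambda>x. (W x)\<^sup>2)" "(\<integral>x. (W x)\<^sup>2 \<partial>lborel) \<le> C\<^sup>2 * (\<integral>x. (U x)\<^sup>2 \<partial>lborel)"
proof -
  have "(\<integral>\<^sup>+x. ennreal ((W x)\<^sup>2) \<partial>lborel) \<le> (\<integral>\<^sup>+x. (\<integral>\<^sup>+y. ennreal (k x y) * ennreal (U y) \<partial>lborel)\<^sup>2 \<partial>lborel)"
  proof (rule nn_integral_mono)
    fix x
    have "ennreal ((W x)\<^sup>2) = (ennreal \<bar>W x\<bar>)\<^sup>2"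
      by (simp add: ennreal_power)
    then show "ennreal ((W x)\<^sup>2) \<le> (\<integral>\<^sup>+y. ennreal (k x y) * ennreal (U y) \<partial>lborel)\<^sup>2"
      using le[of x] by (simp add: power_mono)
  qed
  also have "\<dots> \<le> (ennreal C)\<^sup>2 * (\<integral>\<^sup>+y. (ennreal (U y))\<^sup>2 \<partial>lborel)"
    by (rule schur_test) (use assms in auto)
  also have "(\<integral>\<^sup>+y. (ennreal (U y))\<^sup>2 \<partial>lborel) = ennreal (\<integral>y. (U y)\<^sup>2 \<partial>lborel)"
    using U0 by (simp add: ennreal_power nn_integral_eq_integral[OF U2])
  also have "(ennreal C)\<^sup>2 * \<dots> = ennreal (C\<^sup>2 * (\<integral>y. (U y)\<^sup>2 \<partial>lborel))"
    using C by (simp add: ennreal_power ennreal_mult')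
  finally have *: "(\<integral>\<^sup>+x. ennreal ((W x)\<^sup>2) \<partial>lborel) \<le> ennreal (C\<^sup>2 * (\<integral>y. (U y)\<^sup>2 \<partial>lborel))" .
  then show 1: "integrable lborel (\<lambda>x. (W x)\<^sup>2)"
    by (intro integrableI_bounded) (auto simp: less_top[symmetric] top_unique)
  show "(\<integral>x. (W x)\<^sup>2 \<partial>lborel) \<le> C\<^sup>2 * (\<integral>x. (U x)\<^sup>2 \<partial>lborel)"
    using * by (subst (asm) nn_integral_eq_integral[OF 1]) auto
qed

lemma integral_pos_lborel:
  fixes f :: "'a::euclidean_space \<Rightarrow> real"
  assumes "integrable lborel f" "\<And>x. 0 < f x"
  shows "0 < (\<integral>x. f x \<partial>lborel)"
proof (rule ccontr)
  assume "\<not> 0 < (\<integral>x. f x \<partial>lborel)"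
  moreover have "0 \<le> (\<integral>x. f x \<partial>lborel)"
    using assms(2) by (simp add: less_imp_le)
  ultimately have "(\<integral>x. f x \<partial>lborel) = 0"
    by linarith
  then have "AE x in lborel. f x = 0"
    using integral_nonneg_eq_0_iff_AE[OF assms(1)] assms(2) by (simp add: less_imp_le)
  then have "AE x::'a in lborel. False"
  proof eventually_elim
    case (elim x)
    then show False using assms(2)[of x] by simp
  qed
  then show False
    by (simp add: eventually_False ae_filter_eq_bot_iff)
qed

lemma borel_measurable_cnj [measurable (raw)]:
  "f \<in> borel_measurable M \<Longrightarrow> (\<lambda>x. cnj (f x)) \<in> borel_measurable M"
  by (rule borel_measurable_continuous_on[OF linear_continuous_on[OF bounded_linear_cnj]])

text \<open>A non-integrable \<open>f\<close> has integral 0 by convention, and \<open>a\<close> is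
  nonnegative almost everywhere, so the estimate survives in that case. In the application
  \<open>f\<close> is itself a parameter integral.\<close>

lemma norm_integral_le_AE:
  fixes f :: "'a \<Rightarrow> complex"
  assumes a: "integrable M a" and le: "AE z in M. norm (f z) \<le> a z"
  shows "norm (\<integral>z. f z \<partial>M) \<le> (\<integral>z. a z \<partial>M)"
proof (cases "integrable M f")
  case True
  have "norm (\<integral>z. f z \<partial>M) \<le> (\<integral>z. norm (f z) \<partial>M)" by (rule integral_norm_bound)
  also have "\<dots> \<le> (\<integral>z. a z \<partial>M)"
    using True a le by (intro integral_mono_AE) auto
  finally show ?thesis .
next
  case False
  have "AE z in M. 0 \<le> a z"
    using le by eventually_elim (meson norm_ge_zero order_trans)
  then show ?thesis
    using False by (simp add: not_integrable_integral_eq integral_nonneg_AE)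
qed

section \<open>Differentiation under the integral sign\<close>

lemma norm_exp_remainder_le: "norm (exp z - 1 - z) \<le> (norm z)\<^sup>2 * exp (norm z)" for z :: complex
proof -
  let ?f = "\<lambda>n. inverse (fact (n + 2)) *\<^sub>R z ^ (n + 2)"
  let ?g = "\<lambda>n. (norm z)\<^sup>2 * (inverse (fact n) *\<^sub>R norm z ^ n)"
  have le: "norm (?f n) \<le> ?g n" for n
  proof -
    have "inverse (fact (n + 2)) \<le> (inverse (fact n) :: real)"
      by (intro le_imp_inverse_le fact_mono) auto
    then have "inverse (fact (n + 2)) * norm z ^ (n + 2) \<le> inverse (fact n) * norm z ^ (n + 2)"
      by (intro mult_right_mono) auto
    moreover have "norm (?f n) = inverse (fact (n + 2)) * norm z ^ (n + 2)"
      unfolding norm_scaleR norm_power by (subst abs_of_nonneg) auto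
    moreover have "?g n = inverse (fact n) * norm z ^ (n + 2)"
      by (simp add: power_add mult_ac power2_eq_square)
    ultimately show ?thesis by metis
  qed
  have sum: "summable ?g"
    by (intro summable_mult summable_exp_generic)
  have "exp z - 1 - z = (\<Sum>n. ?f n)"
    using exp_first_two_terms[of z] by simp
  also have "norm \<dots> \<le> (\<Sum>n. ?g n)"
    by (rule norm_suminf_le[OF le sum])
  also have "\<dots> = (norm z)\<^sup>2 * exp (norm z)"
    unfolding exp_def by (intro suminf_mult summable_exp_generic)
  finally show ?thesis .
qed

text \<open>The second-order remainder of \<open>exp\<close> costs a factor quadratic in
  \<open>y\<close> and an exponential, and the assumed exponential moments absorb both. With
  \<open>l\<close> complex linear in its first argument the derivative is complex linear, which
  yields holomorphy; with a real parameter the lemma yields the differential equations for Gaussian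
  integrals.\<close>

lemma has_derivative_integral_exp:
  fixes F :: "'v::euclidean_space \<Rightarrow> complex" and l :: "'w::real_normed_vector \<Rightarrow> 'v \<Rightarrow> complex"
  assumes l: "bounded_bilinear l" and Fm[measurable]: "F \<in> borel_measurable borel"
    and int: "\<And>c. integrable lborel (\<lambda>y. exp (c * norm y) * norm (F y))"
  shows "((\<lambda>v. \<integral>y. exp (l v y) * F y \<partial>lborel) has_derivative
    (\<lambda>h. \<integral>y. l h y * exp (l v y) * F y \<partial>lborel)) (at v)"
proof -
  interpret l: bounded_bilinear l by (rule l)
  obtain K where K: "K > 0" "\<And>h y. norm (l h y) \<le> norm h * norm y * K"
    using l.pos_bounded by auto
  have [measurable]: "l h \<in> borel_measurable borel" for h
    by (intro borel_measurable_continuous_onI linear_continuous_on l.bounded_linear_right)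
  have le: "t \<le> exp t" for t :: real using exp_ge_add_one_self[of t] by linarith
  have sq: "t\<^sup>2 \<le> exp (2 * t)" if "t \<ge> 0" for t :: real
    using le[of t] that power_mono[of t "exp t" 2] by (simp add: exp_double)
  have nexp: "norm (exp (l v y)) \<le> exp (K * norm v * norm y)" for v y
    using order.trans[OF complex_Re_le_cmod K(2)[of v y]] by (simp add: norm_exp_eq_Re mult_ac)
  have I0: "integrable lborel (\<lambda>y. exp (l v y) * F y)" for v
    using int[of "K * norm v"]
    by (rule Bochner_Integration.integrable_bound) (auto simp: norm_mult simp del: norm_exp_eq_Re intro!: AE_I2 mult_right_mono nexp)
  have I1: "integrable lborel (\<lambda>y. l h y * exp (l v y) * F y)" for h v
  proof -
    have "norm (l h y * exp (l v y) * F y) \<le> norm (norm h * K * (exp ((1 + K * norm v) * norm y) * norm (F y)))" for y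
    proof -
      have "norm (l h y * exp (l v y) * F y) \<le> (norm h * norm y * K) * exp (K * norm v * norm y) * norm (F y)"
        unfolding norm_mult by (intro mult_mono K nexp order.refl) (auto simp: K less_imp_le[OF K(1)])
      also have "\<dots> \<le> (norm h * exp (norm y) * K) * exp (K * norm v * norm y) * norm (F y)"
        by (intro mult_mono le order.refl) (auto simp: less_imp_le[OF K(1)])
      finally show ?thesis
        using K(1) by (simp add: ring_distribs exp_add abs_mult mult_ac)
    qed
    then show ?thesis
      by (intro Bochner_Integration.integrable_bound[OF integrable_mult_right[OF int]]) (auto intro!: AE_I2)
  qed
  \<comment> \<open>In the exponent, 2 pays for the square of \<open>norm y\<close>,
    \<open>K\<close> for \<open>exp (norm (l h y))\<close> with \<open>norm h < 1\<close>, and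
    \<open>K * norm v\<close> for \<open>exp (l v y)\<close>.\<close>
  define D where "D = (\<integral>y. exp ((2 + K + K * norm v) * norm y) * norm (F y) \<partial>lborel)"
  show ?thesis
  proof (rule has_derivativeI_sandwich[of 1])
    have "linear (\<lambda>h. \<integral>y. l h y * exp (l v y) * F y \<partial>lborel)"
      by (intro linearI) (auto simp: l.add_left l.scaleR_left ring_distribs I1 simp flip: scaleR_conv_of_real)
    moreover have "norm (\<integral>y. l h y * exp (l v y) * F y \<partial>lborel) \<le>
        norm h * (K * (\<integral>y. exp ((1 + K * norm v) * norm y) * norm (F y) \<partial>lborel))" for h
    proof -
      have "norm (\<integral>y. l h y * exp (l v y) * F y \<partial>lborel) \<le>
         (\<integral>y. norm h * K * (exp ((1 + K * norm v) * norm y) * norm (F y)) \<partial>lborel)"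
      proof (rule order.trans[OF integral_norm_bound], rule integral_mono)
        show "integrable lborel (\<lambda>y. norm (l h y * exp (l v y) * F y))"
          by (intro integrable_norm I1)
        show "integrable lborel (\<lambda>y. norm h * K * (exp ((1 + K * norm v) * norm y) * norm (F y)))"
          by (intro integrable_mult_right int)
        fix y
        have "norm (l h y * exp (l v y) * F y) \<le> (norm h * norm y * K) * exp (K * norm v * norm y) * norm (F y)"
          unfolding norm_mult by (intro mult_mono K nexp order.refl) (auto simp: K less_imp_le[OF K(1)])
        also have "\<dots> \<le> (norm h * exp (norm y) * K) * exp (K * norm v * norm y) * norm (F y)"
          by (intro mult_mono le order.refl) (auto simp: less_imp_le[OF K(1)])
        finally show "norm (l h y * exp (l v y) * F y) \<le> norm h * K * (exp ((1 + K * norm v) * norm y) * norm (F y))"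
          by (simp add: ring_distribs exp_add abs_mult mult_ac)
      qed
      then show ?thesis by (simp add: mult_ac)
    qed
    ultimately show "bounded_linear (\<lambda>h. \<integral>y. l h y * exp (l v y) * F y \<partial>lborel)"
      by (auto simp: bounded_linear_def bounded_linear_axioms_def)
    show "((\<lambda>w. norm (w - v) * (K\<^sup>2 * D)) \<longlongrightarrow> 0) (at v within UNIV)"
      by (auto intro!: tendsto_eq_intros)
    fix w assume w: "w \<in> UNIV" "w \<noteq> v" "dist w v < 1"
    define h where "h = w - v"
    have h: "h \<noteq> 0" "norm h < 1" "w = v + h" using w by (auto simp: h_def dist_norm)
    have "(\<integral>y. exp (l w y) * F y \<partial>lborel) - (\<integral>y. exp (l v y) * F y \<partial>lborel) - (\<integral>y. l h y * exp (l v y) * F y \<partial>lborel)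
      = (\<integral>y. (exp (l h y) - 1 - l h y) * exp (l v y) * F y \<partial>lborel)" (is "?lhs = _")
      by (simp add: I0 I1 flip: Bochner_Integration.integral_diff)
         (simp add: h l.add_left exp_add ring_distribs mult_ac)
    also have "norm \<dots> \<le> (\<integral>y. (norm h)\<^sup>2 * K\<^sup>2 * (exp ((2 + K + K * norm v) * norm y) * norm (F y)) \<partial>lborel)"
    proof (rule order.trans[OF integral_norm_bound], rule integral_mono)
      have "integrable lborel (\<lambda>y. exp (l w y) * F y - exp (l v y) * F y - l h y * exp (l v y) * F y)"
        by (intro Bochner_Integration.integrable_diff I0 I1)
      then show "integrable lborel (\<lambda>y. norm ((exp (l h y) - 1 - l h y) * exp (l v y) * F y))"
        by (intro integrable_norm) (simp add: h l.add_left exp_add ring_distribs mult_ac)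
      show "integrable lborel (\<lambda>y. (norm h)\<^sup>2 * K\<^sup>2 * (exp ((2 + K + K * norm v) * norm y) * norm (F y)))"
        by (intro integrable_mult_right int)
      fix y
      have 1: "norm (l h y) \<le> K * norm y"
      proof -
        have "norm h * (norm y * K) \<le> 1 * (norm y * K)"
          using h(2) K(1) by (intro mult_right_mono) auto
        then show ?thesis using K(2)[of h y] by (simp only: mult_ac mult_1_left)
      qed
      have "norm (exp (l h y) - 1 - l h y) \<le> (norm (l h y))\<^sup>2 * exp (norm (l h y))"
        by (rule norm_exp_remainder_le)
      also have "\<dots> \<le> (norm h * norm y * K)\<^sup>2 * exp (K * norm y)"
        using 1 K(2)[of h y] by (intro mult_mono power_mono) auto
      also have "\<dots> \<le> (norm h)\<^sup>2 * exp (2 * norm y) * K\<^sup>2 * exp (K * norm y)"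
        unfolding power_mult_distrib by (intro mult_mono sq) auto
      finally have "norm (exp (l h y) - 1 - l h y) \<le> (norm h)\<^sup>2 * exp (2 * norm y) * K\<^sup>2 * exp (K * norm y)" .
      then have "norm ((exp (l h y) - 1 - l h y) * exp (l v y) * F y) \<le>
         ((norm h)\<^sup>2 * exp (2 * norm y) * K\<^sup>2 * exp (K * norm y)) * exp (K * norm v * norm y) * norm (F y)"
        unfolding norm_mult by (intro mult_mono nexp) auto
      then show "norm ((exp (l h y) - 1 - l h y) * exp (l v y) * F y) \<le>
         (norm h)\<^sup>2 * K\<^sup>2 * (exp ((2 + K + K * norm v) * norm y) * norm (F y))"
        by (simp add: ring_distribs exp_add mult_ac)
    qed
    also have "\<dots> = (norm h)\<^sup>2 * (K\<^sup>2 * D)"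
      unfolding D_def by (subst integral_mult_right_zero) (simp only: mult.assoc)
    finally show "norm ((\<integral>y. exp (l w y) * F y \<partial>lborel) - (\<integral>y. exp (l v y) * F y \<partial>lborel) -
        (\<integral>y. l (w - v) y * exp (l v y) * F y \<partial>lborel)) / norm (w - v) \<le> norm (w - v) * (K\<^sup>2 * D)"
      using h(1) unfolding h_def[symmetric] by (simp add: power2_eq_square field_simps)
  qed auto
qed

section \<open>Entire functions on \<open>\<complex>\<^sup>n\<close>\<close>

lemma entire_Cn_continuous: "entire_Cn f \<Longrightarrow> continuous_on A f"
  unfolding entire_Cn_def
  by (meson continuous_at_imp_continuous_on has_derivative_continuous)

lemma entire_Cn_measurable [measurable_dest]: "entire_Cn f \<Longrightarrow> f \<in> borel_measurable borel"
  by (intro borel_measurable_continuous_onI entire_Cn_continuous)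

lemma entire_Cn_mult: "entire_Cn f \<Longrightarrow> entire_Cn g \<Longrightarrow> entire_Cn (\<lambda>x. f x * g x)"
  unfolding entire_Cn_def
proof
  fix x
  assume "\<forall>x. \<exists>f'. (f has_derivative f') (at x) \<and> (\<forall>c v. f' (c *s v) = c * f' v)"
    and "\<forall>x. \<exists>g'. (g has_derivative g') (at x) \<and> (\<forall>c v. g' (c *s v) = c * g' v)"
  then obtain f' g' where "(f has_derivative f') (at x)" "\<forall>c v. f' (c *s v) = c * f' v"
    "(g has_derivative g') (at x)" "\<forall>c v. g' (c *s v) = c * g' v"
    by meson
  then show "\<exists>h'. ((\<lambda>x. f x * g x) has_derivative h') (at x) \<and> (\<forall>c v. h' (c *s v) = c * h' v)"
    by (intro exI[of _ "\<lambda>h. f x * g' h + f' h * g x"])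
       (auto intro!: has_derivative_mult simp: ring_distribs)
qed

lemma entire_Cn_diff: "entire_Cn f \<Longrightarrow> entire_Cn g \<Longrightarrow> entire_Cn (\<lambda>x. f x - g x)"
  unfolding entire_Cn_def
proof
  fix x
  assume "\<forall>x. \<exists>f'. (f has_derivative f') (at x) \<and> (\<forall>c v. f' (c *s v) = c * f' v)"
    and "\<forall>x. \<exists>g'. (g has_derivative g') (at x) \<and> (\<forall>c v. g' (c *s v) = c * g' v)"
  then obtain f' g' where "(f has_derivative f') (at x)" "\<forall>c v. f' (c *s v) = c * f' v"
    "(g has_derivative g') (at x)" "\<forall>c v. g' (c *s v) = c * g' v"
    by meson
  then show "\<exists>h'. ((\<lambda>x. f x - g x) has_derivative h') (at x) \<and> (\<forall>c v. h' (c *s v) = c * h' v)"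
    by (intro exI[of _ "\<lambda>h. f' h - g' h"])
       (auto intro!: derivative_intros simp: ring_distribs)
qed

lemma entire_Cn_exp: "entire_Cn f \<Longrightarrow> entire_Cn (\<lambda>x. exp (f x))"
  unfolding entire_Cn_def
proof
  fix x
  assume "\<forall>x. \<exists>f'. (f has_derivative f') (at x) \<and> (\<forall>c v. f' (c *s v) = c * f' v)"
  then obtain f' where "(f has_derivative f') (at x)" "\<forall>c v. f' (c *s v) = c * f' v"
    by meson
  then show "\<exists>h'. ((\<lambda>x. exp (f x)) has_derivative h') (at x) \<and> (\<forall>c v. h' (c *s v) = c * h' v)"
    by (intro exI[of _ "\<lambda>h. exp (f x) * f' h"])
       (auto intro: has_derivative_compose DERIV_exp[unfolded has_field_derivative_def])
qed

lemma entire_Cn_const: "entire_Cn (\<lambda>x. c)"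
  unfolding entire_Cn_def by (auto intro!: exI[of _ "\<lambda>_. 0"])

lemma entire_Cn_translate: "entire_Cn f \<Longrightarrow> entire_Cn (\<lambda>x. f (a + x))"
  unfolding entire_Cn_def
proof
  fix x
  assume "\<forall>x. \<exists>f'. (f has_derivative f') (at x) \<and> (\<forall>c v. f' (c *s v) = c * f' v)"
  then obtain f' where f: "(f has_derivative f') (at (a + x))" "\<forall>c v. f' (c *s v) = c * f' v"
    by meson
  have "((\<lambda>x. f (a + x)) has_derivative (\<lambda>h. f' (0 + h))) (at x)"
    by (rule has_derivative_compose[where f = "\<lambda>x. a + x" and g = f]) (auto intro!: derivative_eq_intros f(1))
  then show "\<exists>h'. ((\<lambda>x. f (a + x)) has_derivative h') (at x) \<and> (\<forall>c v. h' (c *s v) = c * h' v)"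
    using f(2) by (intro exI[of _ f']) auto
qed

lemma scaleR_vec_eq: "r *\<^sub>R x = complex_of_real r *s (x :: complex ^ 'n)"
  by (simp only: vec_eq_iff vector_scaleR_component vector_smult_component scaleR_conv_of_real[of _ "_ :: complex"]) simp

lemma norm_vector_scalar_mult: "norm (c *s x) = norm c * norm (x :: complex ^ 'n)"
  by (simp add: norm_vec_def L2_set_def norm_mult power_mult_distrib sum_distrib_left[symmetric] real_sqrt_mult)

lemma linear_vector_scalar_mult: "linear (\<lambda>x. c *s (x :: complex ^ 'n))"
  by (intro linearI) (auto simp: vec_eq_iff algebra_simps)

lemma entire_Cn_linear:
  fixes f :: "complex ^ 'n \<Rightarrow> complex"
  assumes "\<And>x y. f (x + y) = f x + f y" "\<And>c x. f (c *s x) = c * f x"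
  shows "entire_Cn f"
proof -
  have "linear f"
    using assms by (intro linearI) (auto simp: scaleR_vec_eq scaleR_conv_of_real)
  then have "(f has_derivative f) (at x)" for x
    by (simp add: linear_conv_bounded_linear bounded_linear_imp_has_derivative)
  then show ?thesis
    using assms unfolding entire_Cn_def by blast
qed

lemma entire_on_complex_line:
  assumes "entire_Cn f"
  shows "(\<lambda>c. f (c *s z)) holomorphic_on A"
proof -
  have "(\<lambda>c. f (c *s z)) field_differentiable at c" for c
  proof -
    obtain f' where f: "(f has_derivative f') (at (c *s z))" "\<forall>c v. f' (c *s v) = c * f' v"
      using assms unfolding entire_Cn_def by blast
    have "linear (\<lambda>c::complex. c *s z)"
      by (intro linearI) (auto simp: vec_eq_iff algebra_simps)
    then have "((\<lambda>c. c *s z) has_derivative (\<lambda>c. c *s z)) (at c)"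
      by (simp add: linear_conv_bounded_linear bounded_linear_imp_has_derivative)
    from has_derivative_compose[OF this f(1)] have "((\<lambda>c. f (c *s z)) has_derivative (\<lambda>c. c * f' z)) (at c)"
      using f(2) by simp
    then show ?thesis
      unfolding field_differentiable_def has_field_derivative_def by (metis (no_types, lifting) ext mult.commute)
  qed
  then show ?thesis
    by (auto simp: holomorphic_on_def field_differentiable_at_within)
qed

section \<open>Mean values over rotations\<close>

lemma circle_mean_value:
  assumes f: "f holomorphic_on UNIV"
  shows "(\<integral>t. indicator {0..1} t *\<^sub>R f (cis (2 * pi * t)) \<partial>lborel) = f 0"
proof -
  have cont: "continuous_on {0..1} (\<lambda>t. f (cis (2 * pi * t)))"
    by (rule continuous_on_compose2[OF holomorphic_on_imp_continuous_on[OF f]])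
       (auto simp: cis_conv_exp intro!: continuous_intros)
  have "((\<lambda>u. f u / (u - 0)) has_contour_integral (2 * of_real pi * \<i> * f 0)) (circlepath 0 1)"
    by (rule Cauchy_integral_circlepath_simple[OF holomorphic_on_subset[OF f]]) auto
  then have "((\<lambda>t. f (circlepath 0 1 t) / circlepath 0 1 t * vector_derivative (circlepath 0 1) (at t within {0..1}))
      has_integral (2 * of_real pi * \<i> * f 0)) {0..1}"
    by (simp add: has_contour_integral_def)
  then have "((\<lambda>t. (2 * of_real pi * \<i>) * f (cis (2 * pi * t))) has_integral (2 * of_real pi * \<i> * f 0)) {0..1}"
    by (rule has_integral_eq[rotated])
       (simp add: vector_derivative_circlepath01, simp add: circlepath cis_conv_exp mult_ac)
  from has_integral_mult_right[OF this, of "1 / (2 * of_real pi * \<i>)"]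
  have "((\<lambda>t. f (cis (2 * pi * t))) has_integral f 0) {0..1}"
    by simp
  moreover have "(LINT t:{0..1}|lborel. f (cis (2 * pi * t))) = integral {0..1} (\<lambda>t. f (cis (2 * pi * t)))"
    by (rule set_borel_integral_eq_integral(2)[OF borel_integrable_atLeastAtMost'[OF cont]])
  ultimately show ?thesis
    by (simp add: set_lebesgue_integral_def integral_unique)
qed

text \<open>Rotations preserve both Lebesgue measure and \<open>\<rho>\<close>, so the integral
  equals its average over all rotated copies of \<open>F\<close>. After Fubini the average is taken
  along the circle through \<open>z\<close> in its complex line, where the mean value property
  leaves \<open>F 0\<close>.\<close>

lemma integral_entire_rotation_invariant:
  fixes F \<rho> :: "complex ^ 'n \<Rightarrow> complex"
  assumes F: "entire_Cn F" and \<rho>[measurable]: "\<rho> \<in> borel_measurable borel"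
    and inv: "\<And>c z. norm c = 1 \<Longrightarrow> \<rho> (c *s z) = \<rho> z"
    and int: "integrable lborel (\<lambda>z. F z * \<rho> z)"
  shows "(\<integral>z. F z * \<rho> z \<partial>lborel) = F 0 * (\<integral>z. \<rho> z \<partial>lborel)"
proof -
  have [measurable]: "F \<in> borel_measurable borel" by (rule entire_Cn_measurable[OF F])
  define R :: "real \<Rightarrow> complex ^ 'n \<Rightarrow> complex ^ 'n" where "R t z = cis (2 * pi * t) *s z" for t z
  have R: "distr lborel borel (R t) = lborel" for t
    unfolding R_def by (rule lborel_distr_linear_isometry) (auto simp: linear_vector_scalar_mult norm_vector_scalar_mult)
  have Rm[measurable]: "R t \<in> borel \<rightarrow>\<^sub>M borel" for t
    unfolding R_def using linear_vector_scalar_mult[of "cis (2 * pi * t)"]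
    by (intro borel_measurable_continuous_onI linear_continuous_on) (simp add: linear_conv_bounded_linear)
  have \<rho>R: "\<rho> (R t z) = \<rho> z" for t z by (simp add: R_def inv)
  have Fint: "integrable lborel (\<lambda>z. F (R t z) * \<rho> z)" for t
    using int by (subst (asm) R[of t, symmetric], subst (asm) integrable_distr_eq) (auto simp: \<rho>R)
  have eq: "(\<integral>z. F (R t z) * \<rho> z \<partial>lborel) = (\<integral>z. F z * \<rho> z \<partial>lborel)" for t
    by (subst (2) R[of t, symmetric], subst integral_distr) (auto simp: \<rho>R)
  have neq: "(\<integral>z. norm (F (R t z) * \<rho> z) \<partial>lborel) = (\<integral>z. norm (F z * \<rho> z) \<partial>lborel)" for t
    by (subst (2) R[of t, symmetric], subst integral_distr) (auto simp: \<rho>R)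
  have "continuous_on UNIV (\<lambda>p. R (fst p) (snd p))"
    unfolding R_def vector_scalar_mult_def by (intro continuous_intros)
  then have [measurable]: "(\<lambda>p. R (fst p) (snd p)) \<in> borel \<Otimes>\<^sub>M borel \<rightarrow>\<^sub>M borel"
    by (simp add: borel_prod borel_measurable_continuous_onI)
  define f where "f t z = (indicator {0..1} t *\<^sub>R F (R t z)) * \<rho> z" for t :: real and z
  have [measurable]: "(\<lambda>p. f (fst p) (snd p)) \<in> borel_measurable (borel \<Otimes>\<^sub>M borel)"
    unfolding f_def by measurable
  have "integrable (lborel \<Otimes>\<^sub>M lborel) (\<lambda>p. f (fst p) (snd p))"
  proof (rule lborel_pair.Fubini_integrable)
    \<comment> \<open>By invariance the inner integral of the modulus is the same for every
      \<open>t\<close> in the unit interval, hence integrable in \<open>t\<close>.\<close>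
    have "(\<integral>z. norm (f t z) \<partial>lborel) = indicator {0..1} t *\<^sub>R (\<integral>z. norm (F z * \<rho> z) \<partial>lborel)" for t
      unfolding f_def by (simp add: norm_mult[of "_ *\<^sub>R _"] mult.assoc) (simp add: norm_mult[symmetric] neq)
    then show "integrable lborel (\<lambda>t. \<integral>z. norm (f (fst (t, z)) (snd (t, z))) \<partial>lborel)"
      by simp
  qed (use Fint in \<open>auto simp: f_def\<close>)
  then have fub: "integrable (lborel \<Otimes>\<^sub>M lborel) (case_prod f)"
    by (simp add: case_prod_beta')
  have "(\<integral>z. F z * \<rho> z \<partial>lborel) = (\<integral>t. indicator {0..1} t *\<^sub>R (\<integral>z. F z * \<rho> z \<partial>lborel) \<partial>(lborel :: real measure))"
    by simp
  also have "\<dots> = (\<integral>t. (\<integral>z. f t z \<partial>lborel) \<partial>lborel)"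
    by (simp add: f_def eq)
  also have "\<dots> = (\<integral>z. (\<integral>t. f t z \<partial>lborel) \<partial>lborel)"
    by (rule lborel_pair.Fubini_integral[OF fub, symmetric])
  also have "\<dots> = (\<integral>z. F 0 * \<rho> z \<partial>lborel)"
  proof (rule Bochner_Integration.integral_cong[OF refl])
    fix z
    have "(\<integral>t. f t z \<partial>lborel) = (\<integral>t. indicator {0..1} t *\<^sub>R F (cis (2 * pi * t) *s z) \<partial>lborel) * \<rho> z"
      unfolding f_def R_def by (rule integral_mult_left_zero)
    then show "(\<integral>t. f t z \<partial>lborel) = F 0 * \<rho> z"
      using circle_mean_value[OF entire_on_complex_line[OF F, of z]] by simp
  qed
  finally show ?thesis by simp
qed

section \<open>Quadratic forms and Gaussian integrals\<close>

lemma bounded_bilinear_euclideanI: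
  fixes f :: "'a::euclidean_space \<Rightarrow> 'b::euclidean_space \<Rightarrow> 'c::real_normed_vector"
  assumes "\<And>x y z. f (x + y) z = f x z + f y z" "\<And>r x z. f (r *\<^sub>R x) z = r *\<^sub>R f x z"
    and "\<And>x y z. f x (y + z) = f x y + f x z" "\<And>r x z. f x (r *\<^sub>R z) = r *\<^sub>R f x z"
  shows "bounded_bilinear f"
  unfolding bilinear_conv_bounded_bilinear[symmetric] bilinear_def
  by (intro conjI allI linearI) (simp_all add: assms)

text \<open>By homogeneity the minimum over the compact unit sphere serves as the constant.\<close>

lemma pos_quadratic_form_bound:
  fixes B :: "'a::euclidean_space \<Rightarrow> 'a \<Rightarrow> real"
  assumes B: "bounded_bilinear B" and pos: "\<And>x. x \<noteq> 0 \<Longrightarrow> 0 < B x x"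
  obtains e where "e > 0" "\<And>x. e * (norm x)\<^sup>2 \<le> B x x"
proof -
  interpret B: bounded_bilinear B by (rule B)
  have "compact (sphere (0::'a) 1)" "sphere (0::'a) 1 \<noteq> {}" by auto
  moreover have "continuous_on (sphere 0 1) (\<lambda>x. B x x)"
    by (rule B.continuous_on[OF continuous_on_id continuous_on_id])
  ultimately obtain x0 where x0: "x0 \<in> sphere 0 1" "\<And>y. y \<in> sphere 0 1 \<Longrightarrow> B x0 x0 \<le> B y y"
    using continuous_attains_inf[of "sphere 0 1" "\<lambda>x. B x x"] by blast
  have e: "B x0 x0 > 0" using x0(1) by (intro pos) auto
  have "B x0 x0 * (norm x)\<^sup>2 \<le> B x x" for x
  proof (cases "x = 0")
    case False
    have "B x0 x0 \<le> B (x /\<^sub>R norm x) (x /\<^sub>R norm x)"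
      using False by (intro x0) auto
    also have "\<dots> = B x x / (norm x)\<^sup>2"
      by (simp add: B.scaleR_left B.scaleR_right power2_eq_square field_simps)
    finally show ?thesis using False by (simp add: field_simps)
  qed (simp add: B.zero_left)
  with e show ?thesis using that by blast
qed

text \<open>Along the line \<open>t u + v\<close> the form is affine in \<open>t\<close>, because
  its leading coefficient \<open>B u u\<close> is zero; a nonzero slope would make it negative
  somewhere.\<close>

lemma nonneg_form_kernel:
  fixes B :: "'a::real_normed_vector \<Rightarrow> 'a \<Rightarrow> real"
  assumes B: "bounded_bilinear B" and sym: "\<And>u v. B u v = B v u"
    and nonneg: "\<And>u. 0 \<le> B u u" and u: "B u u = 0"
  shows "B u v = 0"
proof (rule ccontr)
  assume *: "B u v \<noteq> 0"
  interpret B: bounded_bilinear B by (rule B)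
  \<comment> \<open>The value of \<open>t\<close> at which the affine function equals -1.\<close>
  define t where "t = - (B v v + 1) / (2 * B u v)"
  have "B (t *\<^sub>R u + v) (t *\<^sub>R u + v) = 2 * t * B u v + B v v"
    using u sym[of u v] by (simp add: B.add_left B.add_right B.scaleR_left B.scaleR_right)
  also have "\<dots> = - 1" using * by (simp add: t_def field_simps)
  finally show False using nonneg[of "t *\<^sub>R u + v"] by simp
qed

text \<open>A near-minimiser \<open>w'\<close> of the form along the fibre over \<open>x\<close> is used as the centre of a
  Gaussian that dominates \<open>exp (- B (x, w) (x, w))\<close>, by the parallelogram law.\<close>

lemma nn_integral_exp_neg_form_bounded:
  fixes B :: "'a::real_normed_vector \<times> 'b::euclidean_space \<Rightarrow> 'a \<times> 'b \<Rightarrow> real"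
  assumes B: "bounded_bilinear B" and sym: "\<And>u v. B u v = B v u"
    and nonneg: "\<And>u. 0 \<le> B u u" and pos: "\<And>w. w \<noteq> 0 \<Longrightarrow> 0 < B (0, w) (0, w)"
  obtains C where "C \<ge> 0" "\<And>x. (\<integral>\<^sup>+w. ennreal (exp (- B (x, w) (x, w))) \<partial>lborel) \<le> ennreal C"
proof -
  interpret B: bounded_bilinear B by (rule B)
  have "bounded_bilinear (\<lambda>v w. B (0, v) (0, w))"
    using bounded_bilinear.comp[OF B] by (auto intro!: bounded_linear_Pair bounded_linear_zero bounded_linear_ident)
  from pos_quadratic_form_bound[OF this pos]
  obtain e where e: "e > 0" "\<And>w. e * (norm w)\<^sup>2 \<le> B (0, w) (0, w)" by metis
  define I where "I = (\<integral>w. exp (- (e / 4) * (norm (w::'b))\<^sup>2) \<partial>lborel)"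
  have I: "(\<integral>\<^sup>+w. ennreal (exp (- (e / 4) * (norm (w::'b))\<^sup>2)) \<partial>lborel) = ennreal I"
    unfolding I_def using e by (intro nn_integral_eq_integral integrable_exp_neg_norm_sqr) auto
  show ?thesis
  proof
    show "exp (1 / 2) * I \<ge> 0" by (simp add: I_def)
    fix x
    define m where "m = (INF w. B (x, w) (x, w))"
    have bdd: "bdd_below (range (\<lambda>w. B (x, w) (x, w)))"
      by (rule bdd_belowI[of _ 0]) (auto simp: nonneg)
    obtain w' where w': "B (x, w') (x, w') < m + 1"
      using cINF_less_iff[OF _ bdd, of "m + 1"] unfolding m_def by auto
    \<comment> \<open>An infimum along the fibre may fail to be attained in this form, so a point
      within 1 of it is used. The parallelogram law then gives
      \<open>e * (norm (w - w'))\<^sup>2 \<le> 4 * B (x, w) (x, w) + 2\<close>; division by 4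
      produces the constants 1/2 and e/4, which are uniform in \<open>x\<close>.\<close>
    have le: "- B (x, w) (x, w) \<le> 1 / 2 + - (e / 4) * (norm (w - w'))\<^sup>2" for w
    proof -
      have "m \<le> B (x, w) (x, w)"
        unfolding m_def by (rule cINF_lower[OF bdd]) auto
      with w' have 1: "B (x, w') (x, w') \<le> B (x, w) (x, w) + 1" by linarith
      have "0 \<le> B ((x, w) + (x, w')) ((x, w) + (x, w'))" by (rule nonneg)
      moreover have "B ((x, w) + (x, w')) ((x, w) + (x, w')) + B (0, w - w') (0, w - w') =
          2 * B (x, w) (x, w) + 2 * B (x, w') (x, w')"
      proof -
        have d: "(0, w - w') = (x, w) - (x, w')" by simp
        show ?thesis unfolding d by (simp only: B.add_left B.add_right B.diff_left B.diff_right)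
      qed
      moreover have "e * (norm (w - w'))\<^sup>2 \<le> B (0, w - w') (0, w - w')" by (rule e)
      ultimately show ?thesis using 1 by linarith
    qed
    have "(\<integral>\<^sup>+w. ennreal (exp (- B (x, w) (x, w))) \<partial>lborel) \<le>
      (\<integral>\<^sup>+w. ennreal (exp (1 / 2)) * ennreal (exp (- (e / 4) * (norm (w - w'))\<^sup>2)) \<partial>lborel)"
      using le by (intro nn_integral_mono) (simp add: ennreal_mult'[symmetric] exp_add[symmetric])
    also have "\<dots> = ennreal (exp (1 / 2)) * (\<integral>\<^sup>+w. ennreal (exp (- (e / 4) * (norm (w + - w'))\<^sup>2)) \<partial>lborel)"
      by (subst nn_integral_cmult) auto
    also have "\<dots> = ennreal (exp (1 / 2)) * ennreal I"
      using nn_integral_lborel_translate[of "\<lambda>w::'b. ennreal (exp (- (e / 4) * (norm w)\<^sup>2))" "- w'"] I by simp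
    also have "\<dots> = ennreal (exp (1 / 2) * I)"
      by (simp add: ennreal_mult')
    finally show "(\<integral>\<^sup>+w. ennreal (exp (- B (x, w) (x, w))) \<partial>lborel) \<le> ennreal (exp (1 / 2) * I)" .
  qed
qed

section \<open>Gaussian integrals with complex exponents\<close>

lemma has_derivative_exp_complex:
  fixes f :: "'a::real_normed_vector \<Rightarrow> complex"
  assumes "(f has_derivative f') (at x within S)"
  shows "((\<lambda>x. exp (f x)) has_derivative (\<lambda>h. exp (f x) * f' h)) (at x within S)"
  using has_derivative_compose[OF assms DERIV_exp[unfolded has_field_derivative_def]] .

text \<open>The form is complex valued but only real bilinear, since the exponents of interest are
  not holomorphic; coercivity of the real part is what makes the integrals converge.\<close>

locale complex_gaussian =
  fixes \<alpha> :: "'v::euclidean_space \<Rightarrow> 'v \<Rightarrow> complex" and \<delta> :: real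
  assumes bilinear: "bounded_bilinear \<alpha>" and sym: "\<alpha> x y = \<alpha> y x"
    and \<delta>: "\<delta> > 0" and coercive: "\<delta> * (norm y)\<^sup>2 \<le> Re (\<alpha> y y)"
begin

interpretation \<alpha>: bounded_bilinear \<alpha> by (rule bilinear)

text \<open>In the complexification, \<open>\<alpha> a a + \<alpha> b b\<close> is the value of the
  form on \<open>a + i b\<close> and its conjugate \<open>a - i b\<close>. Its real part is positive
  unless both \<open>a\<close> and \<open>b\<close> vanish. All nondegeneracy arguments below reduce
  to this.\<close>

lemma kernel_trivial:
  assumes "\<alpha> a a + \<alpha> b b = 0"
  shows "a = 0 \<and> b = 0"
proof -
  have "\<delta> * (norm a)\<^sup>2 + \<delta> * (norm b)\<^sup>2 \<le> Re (\<alpha> a a + \<alpha> b b)"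
    using coercive[of a] coercive[of b] by simp
  then have "(norm a)\<^sup>2 + (norm b)\<^sup>2 \<le> 0"
    using assms \<delta> by (simp flip: ring_distribs add: mult_le_0_iff)
  then show ?thesis by (simp add: sum_power2_le_zero_iff)
qed

text \<open>The pair \<open>(s\<^sub>1, s\<^sub>2)\<close> stands for the vector \<open>s\<^sub>1 + i s\<^sub>2\<close> of the complexification.\<close>

lemma critical_point:
  fixes l :: "'w::real_normed_vector \<Rightarrow> 'v \<Rightarrow> complex"
  assumes l: "bounded_bilinear l"
  obtains s1 s2 where "linear s1" "linear s2"
    "\<And>v y. 2 * (\<alpha> (s1 v) y + \<i> * \<alpha> (s2 v) y) = l v y"
proof -
  interpret l: bounded_bilinear l by (rule l)
  \<comment> \<open>Coordinates of a complex-valued real-linear functional: the real and imaginary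
    parts of its values on the basis. They identify such functionals with pairs of vectors, so that
    injectivity of \<open>R o T\<close> gives its surjectivity by equality of dimensions.\<close>
  define R :: "('v \<Rightarrow> complex) \<Rightarrow> 'v \<times> 'v" where
    "R h = ((\<Sum>b\<in>Basis. Re (h b) *\<^sub>R b), (\<Sum>b\<in>Basis. Im (h b) *\<^sub>R b))" for h
  have R_eq: "h1 y = h2 y" if "R h1 = R h2" "linear h1" "linear h2" for h1 h2 y
  proof -
    have "h1 b = h2 b" if b: "b \<in> Basis" for b
    proof -
      have "fst (R h1) \<bullet> b = fst (R h2) \<bullet> b" "snd (R h1) \<bullet> b = snd (R h2) \<bullet> b"
        using \<open>R h1 = R h2\<close> by auto
      then show ?thesis using b by (simp add: R_def complex_eq_iff)
    qed
    then show ?thesis using linear_eq_stdbasis[OF that(2,3)] by metis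
  qed
  have R_add: "R (\<lambda>y. h1 y + h2 y) = R h1 + R h2" for h1 h2
    by (simp add: R_def sum.distrib scaleR_add_left)
  have R_scale: "R (\<lambda>y. r *\<^sub>R h y) = r *\<^sub>R R h" for r h
    by (simp add: R_def scaleR_sum_right)
  define T where "T s = (\<lambda>y. 2 * (\<alpha> (fst s) y + \<i> * \<alpha> (snd s) y))" for s
  have lin_T: "linear (T s)" for s
    unfolding T_def by (intro linearI) (auto simp: \<alpha>.add_right \<alpha>.scaleR_right algebra_simps scaleR_conv_of_real)
  have lin_l: "linear (l v)" for v
    using l.bounded_linear_right by (simp add: bounded_linear.linear)
  have lin: "linear (\<lambda>s. R (T s))"
  proof (rule linearI)
    show "R (T (a + b)) = R (T a) + R (T b)" for a b
      unfolding R_add[symmetric] T_def by (simp add: \<alpha>.add_left algebra_simps)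
    show "R (T (r *\<^sub>R a)) = r *\<^sub>R R (T a)" for r a
      unfolding R_scale[symmetric] T_def by (simp add: \<alpha>.scaleR_left algebra_simps scaleR_conv_of_real)
  qed
  have "inj (\<lambda>s. R (T s))"
    unfolding linear_injective_0[OF lin]
  proof (intro allI impI)
    fix s assume "R (T s) = 0"
    then have "R (T s) = R (\<lambda>y. 0)" by (simp add: R_def zero_prod_def)
    then have "T s y = 0" for y
      using R_eq[of "T s" "\<lambda>y. 0" y] lin_T[of s] by (simp add: module_hom_zero)
    then have 0: "\<alpha> (fst s) y + \<i> * \<alpha> (snd s) y = 0" for y
      unfolding T_def by (metis mult_eq_0_iff zero_neq_numeral)
    \<comment> \<open>The vanishing functional is evaluated at the conjugate vector
      \<open>s\<^sub>1 - i s\<^sub>2\<close>; symmetry removes the mixed terms.\<close>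
    have "(\<alpha> (fst s) (fst s) + \<i> * \<alpha> (snd s) (fst s)) - \<i> * (\<alpha> (fst s) (snd s) + \<i> * \<alpha> (snd s) (snd s)) =
        \<alpha> (fst s) (fst s) + \<alpha> (snd s) (snd s)"
      by (simp add: algebra_simps sym[of "snd s" "fst s"])
    then show "s = 0"
      using kernel_trivial[of "fst s" "snd s"] by (simp add: 0 prod_eq_iff)
  qed
  then obtain T' where T': "linear T'" "\<And>x. R (T (T' x)) = x"
    using linear_injective_isomorphism[OF lin] by metis
  have lin_s: "linear (\<lambda>v. T' (R (l v)))"
  proof (rule linearI)
    show "T' (R (l (a + b))) = T' (R (l a)) + T' (R (l b))" for a b
      unfolding linear_add[OF T'(1), symmetric] R_add[symmetric] by (subst ext[OF l.add_left]) (rule refl)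
    show "T' (R (l (r *\<^sub>R a))) = r *\<^sub>R T' (R (l a))" for r a
      unfolding linear_scale[OF T'(1), symmetric] R_scale[symmetric] by (subst ext[OF l.scaleR_left]) (rule refl)
  qed
  show ?thesis
  proof
    show "linear (\<lambda>v. fst (T' (R (l v))))" "linear (\<lambda>v. snd (T' (R (l v))))"
      using linear_compose[OF lin_s linear_fst] linear_compose[OF lin_s linear_snd] by (auto simp: o_def)
    fix v y
    show "2 * (\<alpha> (fst (T' (R (l v)))) y + \<i> * \<alpha> (snd (T' (R (l v)))) y) = l v y"
      using R_eq[OF T'(2)[of "R (l v)"] lin_T lin_l] by (simp add: T_def)
  qed
qed

lemma measurable_diag [measurable]: "(\<lambda>y. \<alpha> y y) \<in> borel_measurable borel"
  by (intro borel_measurable_continuous_onI \<alpha>.continuous_on[OF continuous_on_id continuous_on_id])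

lemma integrable_gaussian:
  assumes m: "bounded_linear m"
  shows "integrable lborel (\<lambda>y. exp (c * norm y) * norm (exp (m y - \<alpha> y y)))"
proof -
  interpret m: bounded_linear m by (rule m)
  obtain K where K: "\<And>y. norm (m y) \<le> norm y * K" using m.bounded by auto
  have [measurable]: "m \<in> borel_measurable borel"
    by (intro borel_measurable_continuous_onI linear_continuous_on m)
  show ?thesis
  proof (rule Bochner_Integration.integrable_bound[OF integrable_exp_neg_norm_sqr_linear[OF \<delta>, of "c + K"]])
    have "c * norm y + Re (m y - \<alpha> y y) \<le> (c + K) * norm y - \<delta> * (norm y)\<^sup>2" for y
      using order.trans[OF complex_Re_le_cmod K[of y]] coercive[of y] by (simp add: algebra_simps)
    then show "AE y in lborel. norm (exp (c * norm y) * norm (exp (m y - \<alpha> y y)))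
        \<le> norm (exp ((c + K) * norm y - \<delta> * (norm y)\<^sup>2))"
      by (simp add: norm_exp_eq_Re mult_exp_exp)
  qed measurable
qed

text \<open>Differentiate the translation invariance of Lebesgue measure in the direction \<open>s\<close>.\<close>

lemma integration_by_parts:
  assumes m: "bounded_linear m"
  shows "(\<integral>y. 2 * \<alpha> s y * exp (m y - \<alpha> y y) \<partial>lborel) = m s * (\<integral>y. exp (m y - \<alpha> y y) \<partial>lborel)"
proof -
  interpret m: bounded_linear m by (rule m)
  have [measurable]: "m \<in> borel_measurable borel" "\<alpha> x \<in> borel_measurable borel" for x
    by (auto intro!: borel_measurable_continuous_onI linear_continuous_on m \<alpha>.bounded_linear_right)
  define F where "F y = exp (m y - \<alpha> y y)" for y
  have [measurable]: "F \<in> borel_measurable borel" unfolding F_def by measurable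
  define l where "l = (\<lambda>(r::real) y. r *\<^sub>R (- 2 * \<alpha> s y))"
  have "bounded_linear (\<lambda>y. - 2 * \<alpha> s y)"
    by (rule bounded_linear_compose[OF bounded_linear_mult_right \<alpha>.bounded_linear_right])
  then have l: "bounded_bilinear l"
    unfolding l_def by (rule bounded_bilinear.comp[OF bounded_bilinear_scaleR bounded_linear_ident])
  have d1: "((\<lambda>r. \<integral>y. exp (l r y) * F y \<partial>lborel) has_derivative (\<lambda>h. \<integral>y. l h y * exp (l 0 y) * F y \<partial>lborel)) (at 0)"
    by (rule has_derivative_integral_exp[OF l]) (auto simp: F_def integrable_gaussian[OF m, simplified])
  \<comment> \<open>Translation by \<open>r s\<close> produces the linear term \<open>l r y\<close>
    and a factor independent of \<open>y\<close>; moving the factor across makes the dependence on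
    \<open>r\<close> explicit, so the derivative at 0 can be computed in two ways.\<close>
  have eq: "(\<integral>y. exp (l r y) * F y \<partial>lborel) = exp (r\<^sup>2 *\<^sub>R \<alpha> s s - r *\<^sub>R m s) * (\<integral>y. F y \<partial>lborel)" for r
  proof -
    have "(\<integral>y. F y \<partial>lborel) = (\<integral>y. F (y + r *\<^sub>R s) \<partial>lborel)"
      by (subst integral_lborel_translate) (auto simp: F_def)
    also have "\<dots> = (\<integral>y. exp (r *\<^sub>R m s - r\<^sup>2 *\<^sub>R \<alpha> s s) * (exp (l r y) * F y) \<partial>lborel)"
    proof -
      have "m (y + r *\<^sub>R s) - \<alpha> (y + r *\<^sub>R s) (y + r *\<^sub>R s) =
          (r *\<^sub>R m s - r\<^sup>2 *\<^sub>R \<alpha> s s) + (l r y + (m y - \<alpha> y y))" for y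
        unfolding m.add m.scaleR \<alpha>.add_left \<alpha>.add_right \<alpha>.scaleR_left \<alpha>.scaleR_right l_def
        using sym[of y s] by (simp add: power2_eq_square algebra_simps)
      then show ?thesis unfolding F_def by (simp only: exp_add)
    qed
    also have "\<dots> = exp (r *\<^sub>R m s - r\<^sup>2 *\<^sub>R \<alpha> s s) * (\<integral>y. exp (l r y) * F y \<partial>lborel)"
      by (rule integral_mult_right_zero)
    finally show ?thesis
      by (simp add: mult.assoc[symmetric] mult_exp_exp)
  qed
  have "((\<lambda>r. exp (r\<^sup>2 *\<^sub>R \<alpha> s s - r *\<^sub>R m s) * (\<integral>y. F y \<partial>lborel)) has_derivative
      (\<lambda>h. h *\<^sub>R (- m s * (\<integral>y. F y \<partial>lborel)))) (at 0)"
  proof -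
    have "((\<lambda>r::real. r\<^sup>2 *\<^sub>R \<alpha> s s - r *\<^sub>R m s) has_derivative (\<lambda>h. - (h *\<^sub>R m s))) (at 0)"
      by (auto intro!: derivative_eq_intros)
    from has_derivative_mult_left[OF has_derivative_exp_complex[OF this], of "\<integral>y. F y \<partial>lborel"]
    show ?thesis by simp
  qed
  from has_derivative_unique[OF d1[unfolded eq] this]
  have "(\<integral>y. l 1 y * exp (l 0 y) * F y \<partial>lborel) = 1 *\<^sub>R (- m s * (\<integral>y. F y \<partial>lborel))"
    by (rule fun_cong)
  then show ?thesis
    by (simp add: l_def F_def)
qed

lemma integral_gaussian:
  assumes l: "bounded_linear l" and s: "\<And>y. 2 * (\<alpha> s1 y + \<i> * \<alpha> s2 y) = l y"
  shows "(\<integral>y. exp (l y - \<alpha> y y) \<partial>lborel) = exp ((l s1 + \<i> * l s2) / 2) * (\<integral>y. exp (- \<alpha> y y) \<partial>lborel)"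
proof -
  interpret l: bounded_linear l by (rule l)
  have [measurable]: "l \<in> borel_measurable borel" "\<alpha> x \<in> borel_measurable borel" for x
    by (auto intro!: borel_measurable_continuous_onI linear_continuous_on l \<alpha>.bounded_linear_right)
  define c where "c = l s1 + \<i> * l s2"
  define f where "f t = (\<integral>y. exp (t *\<^sub>R l y) * exp (- \<alpha> y y) \<partial>lborel)" for t
  have f_eq: "f t = (\<integral>y. exp (t *\<^sub>R l y - \<alpha> y y) \<partial>lborel)" for t
    unfolding f_def by (simp add: mult_exp_exp)
  have lt: "bounded_linear (\<lambda>y. t *\<^sub>R l y)" for t
    by (rule bounded_linear_compose[OF bounded_linear_scaleR_right l])
  have int: "integrable lborel (\<lambda>y. 2 * \<alpha> x y * exp (t *\<^sub>R l y - \<alpha> y y))" for x t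
  proof -
    obtain K where K: "\<And>y. norm (\<alpha> x y) \<le> norm y * K" 
      using \<alpha>.bounded_linear_right[of x] by (metis bounded_linear.bounded)
    have le: "norm y \<le> exp (norm y)" for y :: 'v using exp_ge_add_one_self[of "norm y"] by linarith
    have b: "norm (2 * \<alpha> x y * exp (t *\<^sub>R l y - \<alpha> y y)) \<le>
        norm (2 * \<bar>K\<bar> * (exp (1 * norm y) * norm (exp (t *\<^sub>R l y - \<alpha> y y))))" for y
    proof -
      have "norm (\<alpha> x y) \<le> exp (norm y) * \<bar>K\<bar>"
        using K[of y] mult_left_mono[OF abs_ge_self[of K] norm_ge_zero[of y]]
          mult_right_mono[OF le[of y] abs_ge_zero[of K]] by linarith
      then show ?thesis
        unfolding norm_mult by (simp add: mult_right_mono abs_mult mult_ac del: norm_exp_eq_Re)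
    qed
    have "integrable lborel (\<lambda>y. 2 * \<bar>K\<bar> * (exp (1 * norm y) * norm (exp (t *\<^sub>R l y - \<alpha> y y))))"
      by (intro integrable_mult_right integrable_gaussian lt)
    then show ?thesis
      by (rule Bochner_Integration.integrable_bound[OF _ _ AE_I2[OF b]]) measurable
  qed
  have "(f has_derivative (\<lambda>h. h *\<^sub>R (t * c * f t))) (at t)" for t
  proof -
    have "bounded_bilinear (\<lambda>(t::real) y. t *\<^sub>R l y)"
      by (rule bounded_bilinear.comp[OF bounded_bilinear_scaleR bounded_linear_ident l])
    from has_derivative_integral_exp[OF this, of "\<lambda>y. exp (- \<alpha> y y)" t]
    have "(f has_derivative (\<lambda>h. \<integral>y. (h *\<^sub>R l y) * exp (t *\<^sub>R l y) * exp (- \<alpha> y y) \<partial>lborel)) (at t)"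
      unfolding f_def using integrable_gaussian[OF bounded_linear_zero] by simp
    moreover have "(\<integral>y. (h *\<^sub>R l y) * exp (t *\<^sub>R l y) * exp (- \<alpha> y y) \<partial>lborel) = h *\<^sub>R (t * c * f t)" for h
    proof -
      have "(\<integral>y. (h *\<^sub>R l y) * exp (t *\<^sub>R l y) * exp (- \<alpha> y y) \<partial>lborel) =
        (\<integral>y. h *\<^sub>R (2 * \<alpha> s1 y * exp (t *\<^sub>R l y - \<alpha> y y) + \<i> * (2 * \<alpha> s2 y * exp (t *\<^sub>R l y - \<alpha> y y))) \<partial>lborel)"
        by (simp add: s[symmetric] mult.assoc mult_exp_exp scaleR_conv_of_real) (simp add: algebra_simps)
      also have "\<dots> = h *\<^sub>R ((\<integral>y. 2 * \<alpha> s1 y * exp (t *\<^sub>R l y - \<alpha> y y) \<partial>lborel) +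
          \<i> * (\<integral>y. 2 * \<alpha> s2 y * exp (t *\<^sub>R l y - \<alpha> y y) \<partial>lborel))"
        by (subst integral_scaleR_right, subst Bochner_Integration.integral_add)
           (auto intro: int integrable_mult_right simp del: mult.assoc)
      also have "\<dots> = h *\<^sub>R (t * c * f t)"
        unfolding integration_by_parts[OF lt] f_eq[symmetric] c_def
        by (simp add: algebra_simps scaleR_conv_of_real)
      finally show ?thesis .
    qed
    ultimately show ?thesis by (simp only:)
  qed
  note df = this
  \<comment> \<open>The integrating factor of the differential equation makes this product constant,
    so its values at 1 and 0 agree.\<close>
  have "((\<lambda>t. exp (- t\<^sup>2 *\<^sub>R c / 2) * f t) has_derivative (\<lambda>h. 0)) (at t)" for t
  proof -
    have "((\<lambda>t::real. - t\<^sup>2 *\<^sub>R c / 2) has_derivative (\<lambda>h. - (t * h) *\<^sub>R c)) (at t)"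
      by (auto intro!: derivative_eq_intros simp: fun_eq_iff scaleR_conv_of_real)
    from has_derivative_mult[OF has_derivative_exp_complex[OF this] df] show ?thesis
      by (rule has_derivative_eq_rhs) (simp add: fun_eq_iff scaleR_conv_of_real algebra_simps)
  qed
  then have "exp (- 1\<^sup>2 *\<^sub>R c / 2) * f 1 = exp (- 0\<^sup>2 *\<^sub>R c / 2) * f 0"
    using has_derivative_zero_unique_connected[of UNIV "\<lambda>t::real. exp (- t\<^sup>2 *\<^sub>R c / 2) * f t" 1 0]
    by (auto simp: open_UNIV)
  then have "f 1 = exp (c / 2) * f 0"
    by (simp add: exp_minus field_simps)
  then show ?thesis
    unfolding f_eq by (simp add: c_def)
qed

end

section \<open>Bargmann spaces\<close>

locale hermitian_form =
  fixes \<psi> :: "complex ^ 'n \<Rightarrow> complex ^ 'n \<Rightarrow> complex"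
  assumes add_left: "\<psi> (x + y) z = \<psi> x z + \<psi> y z"
    and scale_left: "\<psi> (c *s x) y = c * \<psi> x y"
    and cnj_swap: "cnj (\<psi> x y) = \<psi> y x"
    and pos: "x \<noteq> 0 \<Longrightarrow> 0 < Re (\<psi> x x)"
begin

definition N :: "complex ^ 'n \<Rightarrow> real" where "N x = Re (\<psi> x x)"

lemma add_right: "\<psi> x (y + z) = \<psi> x y + \<psi> x z"
  by (subst (1 2 3) cnj_swap[symmetric]) (simp add: add_left)

lemma scale_right: "\<psi> x (c *s y) = cnj c * \<psi> x y"
  by (subst (1 2) cnj_swap[symmetric]) (simp add: scale_left)

lemma bounded_bilinear: "bounded_bilinear \<psi>"
  unfolding bilinear_conv_bounded_bilinear[symmetric] bilinear_def
  by (auto intro!: linearI simp: add_left add_right scaleR_vec_eq scale_left scale_right scaleR_conv_of_real)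

sublocale bounded_bilinear \<psi> by (rule bounded_bilinear)

lemma diag: "\<psi> x x = complex_of_real (N x)"
  using cnj_swap[of x x] by (simp add: N_def complex_eq_iff)

lemma Re_swap: "Re (\<psi> y x) = Re (\<psi> x y)"
  by (subst cnj_swap[symmetric]) simp

lemma N_nonneg: "N x \<ge> 0"
  using pos[of x] by (cases "x = 0") (auto simp: N_def zero_left)

lemma N_add: "N (x + y) = N x + N y + 2 * Re (\<psi> x y)"
  by (simp add: N_def add_left add_right Re_swap[of y x])

lemma N_diff: "N (x - y) = N x + N y - 2 * Re (\<psi> x y)"
  by (simp add: N_def diff_left diff_right Re_swap[of y x])

lemma N_scale: "N (c *s x) = (norm c)\<^sup>2 * N x"
proof -
  have "\<psi> (c *s x) (c *s x) = (c * cnj c) * \<psi> x x" by (simp add: scale_left scale_right)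
  then show ?thesis by (simp add: N_def complex_norm_square[symmetric] del: complex_norm_square)
qed

lemma N_scaleR: "N (r *\<^sub>R x) = r\<^sup>2 * N x"
  by (simp add: N_def scaleR_left scaleR_right power2_eq_square)

lemma measurable_form:
  "(\<lambda>p. \<psi> (fst p) (snd p)) \<in> borel_measurable (borel \<Otimes>\<^sub>M borel)"
  unfolding borel_prod
  by (intro borel_measurable_continuous_onI continuous_on[OF continuous_on_fst[OF continuous_on_id] continuous_on_snd[OF continuous_on_id]])

lemma measurable_form' [measurable (raw)]:
  assumes [measurable]: "f \<in> borel_measurable M" "h \<in> borel_measurable M"
  shows "(\<lambda>x. \<psi> (f x) (h x)) \<in> borel_measurable M"
proof -
  have "(\<lambda>x. (\<lambda>p. \<psi> (fst p) (snd p)) (f x, h x)) \<in> borel_measurable M"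
    by (rule measurable_compose[OF _ measurable_form]) measurable
  then show ?thesis by simp
qed

lemma measurable_N [measurable]: "N \<in> borel_measurable borel"
  unfolding N_def[abs_def] by measurable

lemma bounded_bilinear_Re: "bounded_bilinear (\<lambda>x y. Re (\<psi> x y))"
  unfolding bilinear_conv_bounded_bilinear[symmetric] bilinear_def
  by (auto intro!: linearI simp: add_left add_right scaleR_left scaleR_right)

lemma bounded_bilinear_double: "bounded_bilinear (\<lambda>x y. 2 * \<psi> x y)"
  unfolding bilinear_conv_bounded_bilinear[symmetric] bilinear_def
  by (auto intro!: linearI simp: add_left add_right scaleR_left scaleR_right ring_distribs)

lemma N_bound: obtains m where "m > 0" "\<And>x. m * (norm x)\<^sup>2 \<le> N x"
proof -
  from pos_quadratic_form_bound[OF bounded_bilinear_Re pos] show ?thesis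
    using that unfolding N_def by metis
qed

lemma integrable_exp_N:
  assumes "r > 0"
  shows "integrable lborel (\<lambda>y. exp (c * norm y - r * N y))"
proof -
  obtain m where m: "m > 0" "\<And>x. m * (norm x)\<^sup>2 \<le> N x" using N_bound by blast
  have "integrable lborel (\<lambda>y::complex ^ 'n. exp (c * norm y - (r * m) * (norm y)\<^sup>2))"
    using m(1) assms by (intro integrable_exp_neg_norm_sqr_linear) auto
  then show ?thesis
    by (rule Bochner_Integration.integrable_bound)
       (use m(2) assms in \<open>auto intro!: AE_I2 simp: mult.assoc mult_left_mono\<close>)
qed

lemma integrable_exp_N_diff:
  assumes "r > 0"
  shows "integrable lborel (\<lambda>y. exp (- r * N (x - y)))"
proof -
  have "N (x - y) = N (y - x)" for y
    using N_scaleR[of "-1" "y - x"] by simp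
  then show ?thesis
    using integrable_lborel_translate[OF integrable_exp_N[OF assms, of 0], of "- x"] by simp
qed

lemma nn_integral_exp_N_diff:
  assumes "r > 0"
  shows "(\<integral>\<^sup>+y. ennreal (exp (- r * N (x - y))) \<partial>lborel) = ennreal (\<integral>y. exp (- r * N y) \<partial>lborel)"
    and "(\<integral>\<^sup>+y. ennreal (exp (- r * N (y - x))) \<partial>lborel) = ennreal (\<integral>y. exp (- r * N y) \<partial>lborel)"
proof -
  have 1: "(\<integral>\<^sup>+y. ennreal (exp (- r * N y)) \<partial>lborel) = ennreal (\<integral>y. exp (- r * N y) \<partial>lborel)"
    using integrable_exp_N[OF assms, of 0] by (intro nn_integral_eq_integral) auto
  show "(\<integral>\<^sup>+y. ennreal (exp (- r * N (x - y))) \<partial>lborel) = ennreal (\<integral>y. exp (- r * N y) \<partial>lborel)"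
    using nn_integral_lborel_reflect[of "\<lambda>y. ennreal (exp (- r * N y))" x] 1 by simp
  show "(\<integral>\<^sup>+y. ennreal (exp (- r * N (y - x))) \<partial>lborel) = ennreal (\<integral>y. exp (- r * N y) \<partial>lborel)"
    using nn_integral_lborel_translate[of "\<lambda>y. ennreal (exp (- r * N y))" "- x"] 1 by simp
qed

lemma integral_exp_N_pos: "r > 0 \<Longrightarrow> 0 < (\<integral>y. exp (- r * N y) \<partial>lborel)"
  using integrable_exp_N[of r 0] by (intro integral_pos_lborel) auto

lemma integral_entire_gaussian:
  assumes F: "entire_Cn F" and r: "r > 0"
    and int: "integrable lborel (\<lambda>z. F z * exp (- r * N z))"
  shows "(\<integral>z. F z * exp (- r * N z) \<partial>lborel) = F 0 * (\<integral>z. exp (- r * N z) \<partial>lborel)"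
proof -
  have "(\<integral>z. F z * exp (- r * N z) \<partial>lborel) = F 0 * (\<integral>z. complex_of_real (exp (- r * N z)) \<partial>lborel)"
    by (rule integral_entire_rotation_invariant[OF F _ _ int]) (auto simp: N_scale)
  then show ?thesis by (simp only: integral_complex_of_real)
qed

lemma entire_form_left: "entire_Cn (\<lambda>x. \<psi> x y)"
  by (rule entire_Cn_linear) (auto simp: add_left scale_left)

end

section \<open>The reproducing kernel and the orthogonal projection\<close>

locale bargmann = hermitian_form \<psi> for \<psi> :: "complex ^ 'n \<Rightarrow> complex ^ 'n \<Rightarrow> complex" +
  fixes \<Phi> :: "complex ^ 'n \<Rightarrow> real" and g :: "complex ^ 'n \<Rightarrow> complex"
  assumes g: "entire_Cn g" and \<Phi>_eq: "\<Phi> x = N x + Re (g x)"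
begin

lemma measurable_g [measurable]: "g \<in> borel_measurable borel"
  by (rule entire_Cn_measurable[OF g])

lemma measurable_\<Phi> [measurable]: "\<Phi> \<in> borel_measurable borel"
  unfolding \<Phi>_eq[abs_def] by measurable

text \<open>Attaching \<open>exp (- \<Phi>)\<close>, half of the weight, to the function itself
  reduces weighted square integrability to the unweighted setting in which Schur's test is
  stated.\<close>

lemma L2_iff: "f \<in> L2_space (weighted_measure \<Phi>) \<longleftrightarrow>
    f \<in> borel_measurable borel \<and> integrable lborel (\<lambda>x. (norm (f x) * exp (- \<Phi> x))\<^sup>2)"
proof -
  have *: "exp (- 2 * \<Phi> x) * (norm (f x))\<^sup>2 = (norm (f x) * exp (- \<Phi> x))\<^sup>2" for x
    by (simp add: power_mult_distrib exp_double[symmetric])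
  have "integrable (weighted_measure \<Phi>) (\<lambda>x. (norm (f x))\<^sup>2) \<longleftrightarrow> integrable lborel (\<lambda>x. (norm (f x) * exp (- \<Phi> x))\<^sup>2)"
    if [measurable]: "f \<in> borel_measurable borel"
    unfolding weighted_measure_def by (subst integrable_density) (auto simp: *[simplified])
  then show ?thesis
    by (auto simp: L2_space_def weighted_measure_def)
qed

lemma L2_norm_eq:
  assumes [measurable]: "f \<in> borel_measurable borel"
  shows "L2_norm (weighted_measure \<Phi>) f = sqrt (\<integral>x. (norm (f x) * exp (- \<Phi> x))\<^sup>2 \<partial>lborel)"
proof -
  have *: "exp (- 2 * \<Phi> x) * (norm (f x))\<^sup>2 = (norm (f x) * exp (- \<Phi> x))\<^sup>2" for x
    by (simp add: power_mult_distrib exp_double[symmetric])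
  show ?thesis
    unfolding L2_norm_def weighted_measure_def by (subst integral_density) (auto simp: *[simplified])
qed

lemma L2_inner_eq:
  assumes [measurable]: "f \<in> borel_measurable borel" "h \<in> borel_measurable borel"
  shows "L2_inner (weighted_measure \<Phi>) f h = (\<integral>x. f x * cnj (h x) * exp (- 2 * \<Phi> x) \<partial>lborel)"
  unfolding L2_inner_def weighted_measure_def
  by (subst integral_density) (auto simp: scaleR_conv_of_real mult_ac exp_of_real)

lemma L2_diff:
  assumes "f \<in> L2_space (weighted_measure \<Phi>)" "h \<in> L2_space (weighted_measure \<Phi>)"
  shows "(\<lambda>x. f x - h x) \<in> L2_space (weighted_measure \<Phi>)"
proof -
  have [measurable]: "f \<in> borel_measurable borel" "h \<in> borel_measurable borel"
    using assms by (auto simp: L2_iff)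
  have "integrable lborel (\<lambda>x. 2 * (norm (f x) * exp (- \<Phi> x))\<^sup>2 + 2 * (norm (h x) * exp (- \<Phi> x))\<^sup>2)"
    using assms by (auto simp: L2_iff)
  then have "integrable lborel (\<lambda>x. (norm (f x - h x) * exp (- \<Phi> x))\<^sup>2)"
  proof (rule Bochner_Integration.integrable_bound)
    have "(norm (a - b))\<^sup>2 \<le> 2 * (norm a)\<^sup>2 + 2 * (norm b)\<^sup>2" for a b :: complex
    proof -
      have "(norm (a - b))\<^sup>2 \<le> (norm a + norm b)\<^sup>2"
        by (intro power_mono norm_triangle_ineq4) auto
      also have "\<dots> \<le> 2 * (norm a)\<^sup>2 + 2 * (norm b)\<^sup>2"
        using sum_squares_bound[of "norm a" "norm b"] by (simp add: power2_sum)
      finally show ?thesis .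
    qed
    then have "(norm (f x - h x))\<^sup>2 * (exp (- \<Phi> x))\<^sup>2 \<le> (2 * (norm (f x))\<^sup>2 + 2 * (norm (h x))\<^sup>2) * (exp (- \<Phi> x))\<^sup>2" for x
      by (intro mult_right_mono) auto
    then show "AE x in lborel. norm ((norm (f x - h x) * exp (- \<Phi> x))\<^sup>2) \<le>
        norm (2 * (norm (f x) * exp (- \<Phi> x))\<^sup>2 + 2 * (norm (h x) * exp (- \<Phi> x))\<^sup>2)"
      by (auto simp: power_mult_distrib ring_distribs mult.assoc)
  qed measurable
  then show ?thesis by (simp add: L2_iff)
qed

lemma integrable_inner:
  assumes "f \<in> L2_space (weighted_measure \<Phi>)" "h \<in> L2_space (weighted_measure \<Phi>)"
  shows "integrable lborel (\<lambda>x. f x * cnj (h x) * exp (- 2 * \<Phi> x))"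
proof -
  have [measurable]: "f \<in> borel_measurable borel" "h \<in> borel_measurable borel"
    using assms by (auto simp: L2_iff)
  have "integrable lborel (\<lambda>x. (norm (f x) * exp (- \<Phi> x)) * (norm (h x) * exp (- \<Phi> x)))"
    using assms by (intro integrable_L2_mult) (auto simp: L2_iff)
  then show ?thesis
    by (rule Bochner_Integration.integrable_bound)
       (auto simp: norm_mult abs_mult mult_exp_exp exp_of_real[symmetric] mult_ac intro!: AE_I2)
qed

definition c\<^sub>0 :: real where "c\<^sub>0 = (\<integral>y. exp (- 2 * N y) \<partial>lborel)"

lemma c\<^sub>0_pos: "c\<^sub>0 > 0"
  unfolding c\<^sub>0_def by (rule integral_exp_N_pos) simp

text \<open>The Bergman kernel of the weighted space: its exponent is the polarization of
  \<open>2 * \<Phi>\<close>, holomorphic in \<open>x\<close> and antiholomorphic in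
  \<open>y\<close>, with value \<open>2 * \<Phi> x\<close> on the diagonal.\<close>

definition K :: "complex ^ 'n \<Rightarrow> complex ^ 'n \<Rightarrow> complex" where
  "K x y = exp (g x + cnj (g y) + 2 * \<psi> x y) / c\<^sub>0"

lemma measurable_K [measurable (raw)]:
  assumes [measurable]: "f \<in> borel_measurable M" "h \<in> borel_measurable M"
  shows "(\<lambda>x. K (f x) (h x)) \<in> borel_measurable M"
  unfolding K_def by measurable

lemma cnj_K: "cnj (K x y) = K y x"
proof -
  have "cnj (g x + cnj (g y) + 2 * \<psi> x y) = g y + cnj (g x) + 2 * \<psi> y x"
    by (simp add: cnj_swap)
  then have "cnj (exp (g x + cnj (g y) + 2 * \<psi> x y)) = exp (g y + cnj (g x) + 2 * \<psi> y x)"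
    by (simp only: exp_cnj)
  then show ?thesis unfolding K_def by simp
qed

text \<open>Because \<open>2 * Re (\<psi> x y)\<close> is \<open>N x + N y - N (x - y)\<close>,
  stripping the weights leaves a Gaussian convolution kernel. Its marginals are constant, which is
  exactly the input of Schur's test.\<close>

lemma norm_K: "norm (K x y) = exp (\<Phi> x + \<Phi> y) * (exp (- N (x - y)) / c\<^sub>0)"
proof -
  have "Re (g x + cnj (g y) + 2 * \<psi> x y) = \<Phi> x + \<Phi> y + - N (x - y)"
    by (simp add: N_diff \<Phi>_eq)
  then have *: "norm (exp (g x + cnj (g y) + 2 * \<psi> x y)) = exp (\<Phi> x + \<Phi> y + - N (x - y))"
    by (simp only: norm_exp_eq_Re)
  show ?thesis
    unfolding K_def norm_divide * exp_add[of "_ + _" "- _"] using c\<^sub>0_pos by simp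
qed

definition P :: "(complex ^ 'n \<Rightarrow> complex) \<Rightarrow> complex ^ 'n \<Rightarrow> complex" where
  "P f x = (\<integral>y. K x y * f y * exp (- 2 * \<Phi> y) \<partial>lborel)"

lemma norm_P_integrand:
  "norm (K x y * f y * exp (- 2 * \<Phi> y)) = exp (\<Phi> x) * ((exp (- N (x - y)) / c\<^sub>0) * (norm (f y) * exp (- \<Phi> y)))"
proof -
  have *: "norm (complex_of_real (exp (- 2 * \<Phi> y))) = exp (- \<Phi> y) * exp (- \<Phi> y)"
    unfolding norm_of_real by (simp add: mult_exp_exp)
  show ?thesis
    unfolding norm_mult norm_K * exp_add by (simp add: exp_minus field_simps)
qed

lemma integrable_P:
  assumes "f \<in> L2_space (weighted_measure \<Phi>)"
  shows "integrable lborel (\<lambda>y. K x y * f y * exp (- 2 * \<Phi> y))"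
proof -
  have [measurable]: "f \<in> borel_measurable borel"
    using assms by (auto simp: L2_iff)
  have "integrable lborel (\<lambda>y. exp (\<Phi> x) * ((exp (- N (x - y)) / c\<^sub>0) * (norm (f y) * exp (- \<Phi> y))))"
  proof (intro integrable_mult_right integrable_L2_mult)
    show "integrable lborel (\<lambda>y. (exp (- N (x - y)) / c\<^sub>0)\<^sup>2)"
      using integrable_exp_N_diff[of 2 x] by (simp add: power_divide exp_double[symmetric])
  qed (use assms in \<open>auto simp: L2_iff\<close>)
  then show ?thesis
    unfolding norm_P_integrand[symmetric] by (rule integrable_norm_cancel) measurable
qed

text \<open>All dependence on \<open>x\<close> sits in the entire factor \<open>exp (g x)\<close>
  and in \<open>exp (2 * \<psi> x y)\<close>. The latter may be differentiated under the integral,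
  and linearity of \<open>\<psi>\<close> in its first slot makes the derivative complex
  linear.\<close>

lemma entire_P:
  assumes "f \<in> L2_space (weighted_measure \<Phi>)"
  shows "entire_Cn (P f)"
proof -
  have [measurable]: "f \<in> borel_measurable borel"
    using assms by (auto simp: L2_iff)
  define F where "F y = exp (cnj (g y)) * f y * exp (- 2 * \<Phi> y)" for y
  have [measurable]: "F \<in> borel_measurable borel"
    unfolding F_def by measurable
  have "entire_Cn (\<lambda>x. \<integral>y. exp (2 * \<psi> x y) * F y \<partial>lborel)"
    unfolding entire_Cn_def
  proof (intro allI exI conjI)
    fix x c v
    show "((\<lambda>x. \<integral>y. exp (2 * \<psi> x y) * F y \<partial>lborel) has_derivative
        (\<lambda>h. \<integral>y. 2 * \<psi> h y * exp (2 * \<psi> x y) * F y \<partial>lborel)) (at x)"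
    proof (rule has_derivative_integral_exp[OF bounded_bilinear_double])
      fix c
      have "integrable lborel (\<lambda>y. exp (c * norm y - N y) * (norm (f y) * exp (- \<Phi> y)))"
      proof (rule integrable_L2_mult)
        show "integrable lborel (\<lambda>y. (exp (c * norm y - N y))\<^sup>2)"
          using integrable_exp_N[of 2 "2 * c"] by (simp add: exp_double[symmetric] right_diff_distrib mult.assoc)
      qed (use assms in \<open>auto simp: L2_iff\<close>)
      moreover have "exp (c * norm y) * norm (F y) = exp (c * norm y - N y) * (norm (f y) * exp (- \<Phi> y))" for y
        unfolding F_def norm_mult norm_exp_eq_Re norm_of_real
        by (simp add: \<Phi>_eq exp_add[symmetric] mult_exp_exp)
      ultimately show "integrable lborel (\<lambda>y. exp (c * norm y) * norm (F y))"
        by simp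
    qed simp
    show "(\<integral>y. 2 * \<psi> (c *s v) y * exp (2 * \<psi> x y) * F y \<partial>lborel) = c * (\<integral>y. 2 * \<psi> v y * exp (2 * \<psi> x y) * F y \<partial>lborel)"
      by (subst integral_mult_right_zero[symmetric]) (simp add: scale_left mult_ac)
  qed
  moreover have "P f = (\<lambda>x. exp (g x) * (1 / c\<^sub>0) * (\<integral>y. exp (2 * \<psi> x y) * F y \<partial>lborel))"
  proof
    fix x
    have "P f x = (\<integral>y. exp (g x) * (1 / c\<^sub>0) * (exp (2 * \<psi> x y) * F y) \<partial>lborel)"
      unfolding P_def K_def F_def by (simp add: exp_add mult_ac)
    then show "P f x = exp (g x) * (1 / c\<^sub>0) * (\<integral>y. exp (2 * \<psi> x y) * F y \<partial>lborel)"
      by (simp only: integral_mult_right_zero)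
  qed
  ultimately show ?thesis
    by (simp only:) (intro entire_Cn_mult entire_Cn_exp g entire_Cn_const)
qed

lemma P_L2:
  assumes "f \<in> L2_space (weighted_measure \<Phi>)"
  shows "P f \<in> L2_space (weighted_measure \<Phi>)"
proof -
  have [measurable]: "f \<in> borel_measurable borel"
    using assms by (auto simp: L2_iff)
  have [measurable]: "P f \<in> borel_measurable borel"
    by (rule entire_Cn_measurable[OF entire_P[OF assms]])
  define k where "k x y = exp (- 1 * N (x - y)) / c\<^sub>0" for x y
  define C where "C = (\<integral>y. exp (- 1 * N y) \<partial>lborel) / c\<^sub>0"
  have C: "C \<ge> 0" using c\<^sub>0_pos by (simp add: C_def)
  have [measurable]: "case_prod k \<in> borel_measurable (borel \<Otimes>\<^sub>M borel)"
    unfolding k_def by measurable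
  have "integrable lborel (\<lambda>x. (norm (P f x) * exp (- \<Phi> x))\<^sup>2)"
  proof (rule schur_L2[where k = k and U = "\<lambda>y. norm (f y) * exp (- \<Phi> y)" and C = C])
    show "(\<integral>\<^sup>+y. ennreal (k x y) \<partial>lborel) \<le> ennreal C" for x
      unfolding k_def C_def using c\<^sub>0_pos nn_integral_exp_N_diff(1)[of 1 x]
      by (simp add: divide_ennreal[symmetric] nn_integral_divide)
    show "(\<integral>\<^sup>+x. ennreal (k x y) \<partial>lborel) \<le> ennreal C" for y
      unfolding k_def C_def using c\<^sub>0_pos nn_integral_exp_N_diff(2)[of 1 y]
      by (simp add: divide_ennreal[symmetric] nn_integral_divide)
    show "ennreal \<bar>norm (P f x) * exp (- \<Phi> x)\<bar> \<le>
        (\<integral>\<^sup>+y. ennreal (k x y) * ennreal (norm (f y) * exp (- \<Phi> y)) \<partial>lborel)" for x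
    proof -
      have "ennreal (norm (P f x)) \<le> (\<integral>\<^sup>+y. ennreal (norm (K x y * f y * exp (- 2 * \<Phi> y))) \<partial>lborel)"
        unfolding P_def by (rule integral_norm_bound_ennreal[OF integrable_P[OF assms]])
      also have "\<dots> = (\<integral>\<^sup>+y. ennreal (exp (\<Phi> x)) * (ennreal (k x y) * ennreal (norm (f y) * exp (- \<Phi> y))) \<partial>lborel)"
        unfolding norm_P_integrand using c\<^sub>0_pos by (simp add: k_def ennreal_mult'[symmetric])
      also have "\<dots> = ennreal (exp (\<Phi> x)) * (\<integral>\<^sup>+y. ennreal (k x y) * ennreal (norm (f y) * exp (- \<Phi> y)) \<partial>lborel)"
        by (rule nn_integral_cmult) (simp add: k_def)
      finally have "ennreal (norm (P f x)) * ennreal (exp (- \<Phi> x)) \<le> 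
         (ennreal (exp (- \<Phi> x)) * ennreal (exp (\<Phi> x))) * (\<integral>\<^sup>+y. ennreal (k x y) * ennreal (norm (f y) * exp (- \<Phi> y)) \<partial>lborel)"
        by (simp add: mult.assoc mult.commute[of "ennreal (norm (P f x))"] mult_left_mono)
      then show ?thesis
        by (simp add: ennreal_mult'[symmetric] mult_exp_exp)
    qed
  qed (use assms C c\<^sub>0_pos in \<open>auto simp: L2_iff k_def\<close>)
  then show ?thesis by (simp add: L2_iff)
qed

text \<open>Centring the integral at \<open>x\<close> turns the integrand into an entire function of
  \<open>z\<close> times \<open>exp (- 2 * N z)\<close>, and the rotation average picks out the
  value at \<open>z = 0\<close>.\<close>

lemma P_reproducing:
  assumes "u \<in> bargmann_space \<Phi>"
  shows "P u x = u x"
proof -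
  have u: "entire_Cn u" and u2: "u \<in> L2_space (weighted_measure \<Phi>)"
    using assms by (auto simp: bargmann_space_def)
  have [measurable]: "u \<in> borel_measurable borel"
    by (rule entire_Cn_measurable[OF u])
  \<comment> \<open>What remains once the weight has cancelled the antiholomorphic factors:
    \<open>cnj (g y)\<close> disappears entirely, and
    \<open>2 * \<psi> x (x + z) - 2 * N (x + z)\<close> equals
    \<open>- 2 * \<psi> z x - 2 * N z\<close>.\<close>
  define F where "F z = u (x + z) * exp (- 1 * g (x + z)) * exp (- 2 * \<psi> z x)" for z
  have F: "entire_Cn F"
    unfolding F_def by (intro entire_Cn_mult entire_Cn_exp entire_Cn_const entire_form_left
        entire_Cn_translate[of "\<lambda>z. u z * exp (- 1 * g z)"] u g)
  have eq: "K x (z + x) * u (z + x) * exp (- 2 * \<Phi> (z + x)) = exp (g x) / c\<^sub>0 * (F z * exp (- 2 * N z))" for z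
  proof -

    have "complex_of_real (- 2 * \<Phi> (z + x)) = - 2 * \<psi> (z + x) (z + x) - g (z + x) - cnj (g (z + x))"
      unfolding diag by (simp add: \<Phi>_eq complex_eq_iff)
    then have "g x + cnj (g (z + x)) + 2 * \<psi> x (z + x) + complex_of_real (- 2 * \<Phi> (z + x)) =
        g x + (- 1 * g (x + z)) + (- 2 * \<psi> z x) + complex_of_real (- 2 * N z)"
      by (simp add: add_left add_right diag[of x] diag[of z] add.commute[of x z])
    then have "exp (g x + cnj (g (z + x)) + 2 * \<psi> x (z + x)) * exp (complex_of_real (- 2 * \<Phi> (z + x))) =
        exp (g x) * exp (- 1 * g (x + z)) * exp (- 2 * \<psi> z x) * exp (complex_of_real (- 2 * N z))"
      by (simp only: exp_add[symmetric])
    then show ?thesis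
      unfolding K_def F_def by (simp add: exp_of_real[symmetric] mult_ac add.commute[of x z])
  qed
  have int: "integrable lborel (\<lambda>z. F z * exp (- 2 * N z))"
  proof -
    have "integrable lborel (\<lambda>z. exp (g x) / c\<^sub>0 * (F z * exp (- 2 * N z)))"
      using integrable_lborel_translate[OF integrable_P[OF u2, of x], of x] unfolding eq .
    from integrable_mult_right[OF this, of "c\<^sub>0 / exp (g x)"] show ?thesis
      using c\<^sub>0_pos by (simp add: mult.assoc[symmetric])
  qed
  have "P u x = (\<integral>z. K x (z + x) * u (z + x) * exp (- 2 * \<Phi> (z + x)) \<partial>lborel)"
    unfolding P_def by (subst integral_lborel_translate) auto
  also have "\<dots> = exp (g x) / c\<^sub>0 * (\<integral>z. F z * exp (- 2 * N z) \<partial>lborel)"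
    unfolding eq by (rule integral_mult_right_zero)
  also have "\<dots> = exp (g x) / c\<^sub>0 * (F 0 * c\<^sub>0)"
    unfolding c\<^sub>0_def by (subst integral_entire_gaussian[OF F _ int]) auto
  also have "\<dots> = u x"
    using c\<^sub>0_pos by (simp add: F_def zero_left exp_minus)
  finally show ?thesis .
qed

text \<open>Fubini and the hermitian symmetry of \<open>K\<close> move the integral operator onto
  \<open>h\<close>, where it acts as the identity by the reproducing formula.\<close>

lemma P_inner:
  assumes f: "f \<in> L2_space (weighted_measure \<Phi>)" and h: "h \<in> bargmann_space \<Phi>"
  shows "L2_inner (weighted_measure \<Phi>) (P f) h = L2_inner (weighted_measure \<Phi>) f h"
proof -
  have h2: "h \<in> L2_space (weighted_measure \<Phi>)" using h by (simp add: bargmann_space_def)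
  have [measurable]: "f \<in> borel_measurable borel" "h \<in> borel_measurable borel"
    using f h2 by (auto simp: L2_iff)
  have [measurable]: "P f \<in> borel_measurable borel"
    by (rule entire_Cn_measurable[OF entire_P[OF f]])
  define J where "J x y = K x y * f y * exp (- 2 * \<Phi> y) * (cnj (h x) * exp (- 2 * \<Phi> x))" for x y
  define k where "k x y = exp (- 1 * N (x - y)) / c\<^sub>0" for x y
  have [measurable]: "case_prod k \<in> borel_measurable (borel \<Otimes>\<^sub>M borel)"
    unfolding k_def by measurable
  have "integrable (lborel \<Otimes>\<^sub>M lborel) (\<lambda>(x, y). k x y * ((norm (h x) * exp (- \<Phi> x)) * (norm (f y) * exp (- \<Phi> y))))"
  proof (rule integrable_schur_kernel)
    show "(\<integral>\<^sup>+y. ennreal (k x y) \<partial>lborel) \<le> ennreal ((\<integral>y. exp (- 1 * N y) \<partial>lborel) / c\<^sub>0)" for x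
      unfolding k_def using c\<^sub>0_pos nn_integral_exp_N_diff(1)[of 1 x]
      by (simp add: divide_ennreal[symmetric] nn_integral_divide)
    show "(\<integral>\<^sup>+x. ennreal (k x y) \<partial>lborel) \<le> ennreal ((\<integral>y. exp (- 1 * N y) \<partial>lborel) / c\<^sub>0)" for y
      unfolding k_def using c\<^sub>0_pos nn_integral_exp_N_diff(2)[of 1 y]
      by (simp add: divide_ennreal[symmetric] nn_integral_divide)
  qed (use f h2 c\<^sub>0_pos in \<open>auto simp: L2_iff k_def\<close>)
  moreover have "norm (J x y) = k x y * ((norm (h x) * exp (- \<Phi> x)) * (norm (f y) * exp (- \<Phi> y)))" for x y
  proof -
    have *: "norm (complex_of_real (exp (- 2 * \<Phi> x))) = exp (- \<Phi> x) * exp (- \<Phi> x)"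
      unfolding norm_of_real by (simp add: mult_exp_exp)
    have "norm (J x y) = norm (K x y * f y * exp (- 2 * \<Phi> y)) *
        (norm (h x) * norm (complex_of_real (exp (- 2 * \<Phi> x))))"
      unfolding J_def by (simp only: norm_mult complex_mod_cnj mult.assoc)
    then show ?thesis
      unfolding norm_P_integrand k_def * by (simp add: exp_minus field_simps)
  qed
  moreover have [measurable]: "case_prod J \<in> borel_measurable (borel \<Otimes>\<^sub>M borel)"
    unfolding J_def by measurable
  ultimately have int: "integrable (lborel \<Otimes>\<^sub>M lborel) (case_prod J)"
    by (elim Bochner_Integration.integrable_bound) (auto intro!: AE_I2)
  have "L2_inner (weighted_measure \<Phi>) (P f) h = (\<integral>x. (\<integral>y. J x y \<partial>lborel) \<partial>lborel)"
  proof -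
    have "(\<integral>y. J x y \<partial>lborel) = P f x * (cnj (h x) * exp (- 2 * \<Phi> x))" for x
      unfolding J_def P_def by (rule integral_mult_left_zero)
    then show ?thesis
      by (subst L2_inner_eq) (auto simp: mult.assoc)
  qed
  also have "\<dots> = (\<integral>y. (\<integral>x. J x y \<partial>lborel) \<partial>lborel)"
    by (rule lborel_pair.Fubini_integral[OF int, symmetric])
  also have "\<dots> = (\<integral>y. f y * cnj (h y) * exp (- 2 * \<Phi> y) \<partial>lborel)"
  proof (rule Bochner_Integration.integral_cong[OF refl])
    fix y
    have "J x y = (f y * exp (- 2 * \<Phi> y)) * cnj (K y x * h x * exp (- 2 * \<Phi> x))" for x
      by (simp add: J_def cnj_K mult_ac)
    then have "(\<integral>x. J x y \<partial>lborel) = (f y * exp (- 2 * \<Phi> y)) * (\<integral>x. cnj (K y x * h x * exp (- 2 * \<Phi> x)) \<partial>lborel)"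
      by (simp only: integral_mult_right_zero)
    also have "(\<integral>x. cnj (K y x * h x * exp (- 2 * \<Phi> x)) \<partial>lborel) = cnj (P h y)"
      unfolding P_def by (rule Bochner_Integration.integral_cnj)
    finally show "(\<integral>x. J x y \<partial>lborel) = f y * cnj (h y) * exp (- 2 * \<Phi> y)"
      by (simp add: P_reproducing[OF h] mult_ac)
  qed
  also have "\<dots> = L2_inner (weighted_measure \<Phi>) f h"
    by (subst L2_inner_eq) auto
  finally show ?thesis .
qed

lemma P_bargmann: "f \<in> L2_space (weighted_measure \<Phi>) \<Longrightarrow> P f \<in> bargmann_space \<Phi>"
  using P_L2 entire_P unfolding bargmann_space_def by blast

lemma L2_inner_diff:
  assumes "f \<in> L2_space (weighted_measure \<Phi>)" "f' \<in> L2_space (weighted_measure \<Phi>)"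
    "h \<in> L2_space (weighted_measure \<Phi>)"
  shows "L2_inner (weighted_measure \<Phi>) (\<lambda>x. f x - f' x) h =
    L2_inner (weighted_measure \<Phi>) f h - L2_inner (weighted_measure \<Phi>) f' h"
proof -
  have m[measurable]: "f \<in> borel_measurable borel" "f' \<in> borel_measurable borel" "h \<in> borel_measurable borel"
    using assms by (auto simp: L2_iff)
  have "L2_inner (weighted_measure \<Phi>) (\<lambda>x. f x - f' x) h =
      (\<integral>x. f x * cnj (h x) * exp (- 2 * \<Phi> x) - f' x * cnj (h x) * exp (- 2 * \<Phi> x) \<partial>lborel)"
    by (subst L2_inner_eq) (auto simp: left_diff_distrib)
  also have "\<dots> = L2_inner (weighted_measure \<Phi>) f h - L2_inner (weighted_measure \<Phi>) f' h"
    unfolding L2_inner_eq[OF m(1,3)] L2_inner_eq[OF m(2,3)]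
    by (rule Bochner_Integration.integral_diff[OF integrable_inner[OF assms(1,3)] integrable_inner[OF assms(2,3)]])
  finally show ?thesis .
qed

text \<open>Zero norm gives vanishing almost everywhere only; the reproducing formula upgrades this
  to every point, since it recovers each value from an integral.\<close>

lemma bargmann_null:
  assumes d: "d \<in> bargmann_space \<Phi>" and 0: "L2_inner (weighted_measure \<Phi>) d d = 0"
  shows "d x = 0"
proof -
  have d2: "d \<in> L2_space (weighted_measure \<Phi>)" using d by (simp add: bargmann_space_def)
  then have dm[measurable]: "d \<in> borel_measurable borel" and int: "integrable lborel (\<lambda>x. (norm (d x) * exp (- \<Phi> x))\<^sup>2)"
    by (auto simp: L2_iff)
  have *: "d x * cnj (d x) * exp (- 2 * \<Phi> x) = complex_of_real ((norm (d x) * exp (- \<Phi> x))\<^sup>2)" for x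
    by (simp add: complex_norm_square power_mult_distrib exp_double[symmetric] flip: of_real_power)
  have "complex_of_real (\<integral>x. (norm (d x) * exp (- \<Phi> x))\<^sup>2 \<partial>lborel) = 0"
    using 0 unfolding L2_inner_eq[OF dm dm] * integral_complex_of_real .
  then have "AE x in lborel. d x = 0"
    using integral_nonneg_eq_0_iff_AE[OF int] by simp
  then have "AE y in lborel. K x y * d y * exp (- 2 * \<Phi> y) = 0"
    by eventually_elim simp
  then have "P d x = 0"
    unfolding P_def by (rule integral_eq_zero_AE)
  then show ?thesis by (simp add: P_reproducing[OF d])
qed

text \<open>The definite description requires existence, which is the symmetry of \<open>P\<close>,
  and uniqueness: the difference of two candidates lies in the Bargmann space and is orthogonal to
  itself.\<close>

lemma bargmann_proj_eq:
  assumes f: "f \<in> L2_space (weighted_measure \<Phi>)"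
  shows "bargmann_proj \<Phi> f = P f"
  unfolding bargmann_proj_def
proof (rule the_equality)
  show "P f \<in> bargmann_space \<Phi> \<and> (\<forall>h\<in>bargmann_space \<Phi>. L2_inner (weighted_measure \<Phi>) (\<lambda>x. f x - P f x) h = 0)"
  proof (intro conjI ballI P_bargmann[OF f])
    fix h assume h: "h \<in> bargmann_space \<Phi>"
    then have "h \<in> L2_space (weighted_measure \<Phi>)" by (simp add: bargmann_space_def)
    from L2_inner_diff[OF f P_L2[OF f] this] P_inner[OF f h]
    show "L2_inner (weighted_measure \<Phi>) (\<lambda>x. f x - P f x) h = 0" by simp
  qed
next
  fix u assume u': "u \<in> bargmann_space \<Phi> \<and> (\<forall>h\<in>bargmann_space \<Phi>. L2_inner (weighted_measure \<Phi>) (\<lambda>x. f x - u x) h = 0)"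
  then have u: "u \<in> bargmann_space \<Phi>" by blast
  then have u2: "u \<in> L2_space (weighted_measure \<Phi>)" by (simp add: bargmann_space_def)
  define d where "d = (\<lambda>x. P f x - u x)"
  have d: "d \<in> bargmann_space \<Phi>"
    using u P_bargmann[OF f] L2_diff[of "P f" u] entire_Cn_diff[of "P f" u] unfolding d_def bargmann_space_def by auto
  then have d2: "d \<in> L2_space (weighted_measure \<Phi>)" by (simp add: bargmann_space_def)
  have "L2_inner (weighted_measure \<Phi>) d d = L2_inner (weighted_measure \<Phi>) f d - L2_inner (weighted_measure \<Phi>) u d"
    using L2_inner_diff[OF P_L2[OF f] u2 d2] P_inner[OF f d] by (simp only: d_def[symmetric])
  also have "\<dots> = 0"
    using L2_inner_diff[OF f u2 d2] bspec[OF conjunct2[OF u'] d] by simp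
  finally have "d x = 0" for x by (rule bargmann_null[OF d])
  then show "u = P f" by (auto simp: d_def fun_eq_iff)
qed

end

section \<open>Toeplitz operators with Gaussian symbols\<close>

locale toeplitz_gaussian = bargmann \<psi> \<Phi> g
  for \<psi> :: "complex ^ 'n \<Rightarrow> complex ^ 'n \<Rightarrow> complex" and \<Phi> g +
  fixes \<beta> :: "complex ^ 'n \<Rightarrow> complex ^ 'n \<Rightarrow> complex"
  assumes \<beta>: "Real_Vector_Spaces.bounded_bilinear \<beta>" and \<beta>_sym: "\<beta> x y = \<beta> y x"
    and \<beta>_less: "x \<noteq> 0 \<Longrightarrow> 2 * Re (\<beta> x x) < N x"
begin

interpretation \<beta>: Real_Vector_Spaces.bounded_bilinear \<beta> by (rule \<beta>)

lemma measurable_\<beta> [measurable (raw)]: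
  assumes "f \<in> borel_measurable M"
  shows "(\<lambda>x. \<beta> (f x) (f x)) \<in> borel_measurable M"
proof -
  have "(\<lambda>y. \<beta> y y) \<in> borel_measurable borel"
    by (intro borel_measurable_continuous_onI \<beta>.continuous_on[OF continuous_on_id continuous_on_id])
  from measurable_compose[OF assms this] show ?thesis .
qed

text \<open>Compactness turns the strict pointwise inequality into a uniform quadratic margin; this
  margin supplies the decay in \<open>y\<close> for every Fubini exchange below.\<close>

lemma symbol_gap:
  obtains d where "d > 0" "\<And>y. d * (norm y)\<^sup>2 \<le> N y - 2 * Re (\<beta> y y)"
proof -
  have 1: "Real_Vector_Spaces.bounded_bilinear (\<lambda>x y. Re (\<psi> x y) - 2 * Re (\<beta> x y))"
    by (rule bounded_bilinear_euclideanI) (simp_all add: add_left add_right scaleR_left scaleR_right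
        \<beta>.add_left \<beta>.add_right \<beta>.scaleR_left \<beta>.scaleR_right algebra_simps)
  have 2: "0 < Re (\<psi> x x) - 2 * Re (\<beta> x x)" if "x \<noteq> 0" for x
    using \<beta>_less[OF that] by (simp add: N_def)
  show ?thesis
    by (rule pos_quadratic_form_bound[OF 1 2]) (auto simp: N_def intro: that)
qed

text \<open>The symmetric form whose diagonal is the exponent of the weight
  \<open>exp (- 2 * N y)\<close> together with the symbol; \<open>\<psi>\<close> is symmetrized
  because it is only hermitian.\<close>

definition \<alpha> :: "complex ^ 'n \<Rightarrow> complex ^ 'n \<Rightarrow> complex" where
  "\<alpha> x y = \<psi> x y + \<psi> y x - 2 * \<beta> x y"

lemma \<alpha>_diag: "\<alpha> y y = 2 * N y - 2 * \<beta> y y"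
  by (simp add: \<alpha>_def diag)

lemma complex_gaussian_\<alpha>: obtains \<delta> where "complex_gaussian \<alpha> \<delta>"
proof -
  obtain d where d: "d > 0" "\<And>y. d * (norm y)\<^sup>2 \<le> N y - 2 * Re (\<beta> y y)"
    using symbol_gap by blast
  have "complex_gaussian \<alpha> d"
  proof (rule complex_gaussian.intro)
    show "Real_Vector_Spaces.bounded_bilinear \<alpha>"
      unfolding bilinear_conv_bounded_bilinear[symmetric] bilinear_def \<alpha>_def
      by (auto intro!: linearI simp: add_left add_right scaleR_left scaleR_right
          \<beta>.add_left \<beta>.add_right \<beta>.scaleR_left \<beta>.scaleR_right algebra_simps)
    show "\<alpha> x y = \<alpha> y x" for x y by (simp add: \<alpha>_def \<beta>_sym[of x y])
    show "d * (norm y)\<^sup>2 \<le> Re (\<alpha> y y)" for y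
      using d(2)[of y] N_nonneg[of y] by (simp add: \<alpha>_diag)
  qed (rule d)
  then show ?thesis using that by blast
qed

text \<open>The terms linear in \<open>y\<close> in the exponent of \<open>K x y * K y w\<close>:
  the pair \<open>v\<close> collects the outer points of the composed kernel.\<close>

definition l :: "(complex ^ 'n) \<times> (complex ^ 'n) \<Rightarrow> complex ^ 'n \<Rightarrow> complex" where
  "l v y = 2 * \<psi> (fst v) y + 2 * \<psi> y (snd v)"

lemma bounded_bilinear_l: "Real_Vector_Spaces.bounded_bilinear l"
  unfolding l_def
  by (rule bounded_bilinear_euclideanI) (simp_all add: add_left add_right scaleR_left scaleR_right algebra_simps)

definition G :: "(complex ^ 'n) \<times> (complex ^ 'n) \<Rightarrow> complex" where
  "G v = (\<integral>y. exp (l v y - \<alpha> y y) \<partial>lborel)"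

text \<open>If \<open>E\<close> were degenerate along an axis, the critical point would be a purely holomorphic or
  antiholomorphic vector, \<open>s\<^sub>1 = \<plusminus> i s\<^sub>2\<close>, on which the linear form vanishes.\<close>

lemma G_exponent:
  obtains E where "Real_Vector_Spaces.bounded_bilinear E" "\<And>u v. E u v = E v u"
    "\<And>v. G v = exp (E v v) * G 0"
    "\<And>w. (\<And>x. Re (E (0, w) (x, 0)) = 0) \<Longrightarrow> w = 0"
    "\<And>x. (\<And>w. Re (E (x, 0) (0, w)) = 0) \<Longrightarrow> x = 0"
proof -
  obtain \<delta> where "complex_gaussian \<alpha> \<delta>" by (rule complex_gaussian_\<alpha>)
  then interpret A: complex_gaussian \<alpha> \<delta> .
  interpret \<alpha>: Real_Vector_Spaces.bounded_bilinear \<alpha> by (rule A.bilinear)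
  interpret l: Real_Vector_Spaces.bounded_bilinear l by (rule bounded_bilinear_l)
  obtain s1 s2 where s: "linear s1" "linear s2"
    and crit: "\<And>v y. 2 * (\<alpha> (s1 v) y + \<i> * \<alpha> (s2 v) y) = l v y"
    using A.critical_point[OF bounded_bilinear_l] by blast
  \<comment> \<open>Half the linear form at the complex critical point, polarized in the
    parameter.\<close>
  define E where "E u v = (l v (s1 u) + \<i> * l v (s2 u)) / 2" for u v
  have E1: "Real_Vector_Spaces.bounded_bilinear E"
    unfolding E_def
    by (rule bounded_bilinear_euclideanI) (simp_all add: l.add_left l.add_right l.scaleR_left l.scaleR_right
        linear_add[OF s(1)] linear_add[OF s(2)] linear_scale[OF s(1)] linear_scale[OF s(2)]
        algebra_simps add_divide_distrib scaleR_conv_of_real[of _ "_ :: complex"])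
  have E2: "E u v = E v u" for u v
    unfolding E_def crit[symmetric]
    by (simp add: A.sym[of "s1 v" "s1 u"] A.sym[of "s2 v" "s1 u"] A.sym[of "s1 v" "s2 u"] A.sym[of "s2 v" "s2 u"] algebra_simps)
  have E3: "G v = exp (E v v) * G 0" for v
    unfolding G_def E_def
    by (subst A.integral_gaussian[OF l.bounded_linear_right crit]) (simp add: l.zero_left)
  have E4: "w = 0" if "\<And>x. Re (E (0, w) (x, 0)) = 0" for w
  proof -
    define a b where "a = s1 (0, w)" and "b = s2 (0, w)"
    have ab: "\<alpha> a y + \<i> * \<alpha> b y = \<psi> y w" for y
    proof -
      have "2 * (\<alpha> a y + \<i> * \<alpha> b y) = 2 * \<psi> y w"
        unfolding a_def b_def crit by (simp add: l_def zero_left)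
      then show ?thesis by (subst (asm) mult_left_cancel) auto
    qed
    \<comment> \<open>Conjugate linearity in the second slot turns the factor \<open>i\<close> into
      \<open>- i\<close>. Testing with \<open>x = a - i b\<close> then makes this vector
      zero.\<close>
    have "E (0, w) (x, 0) = \<psi> x (a + (- \<i>) *s b)" for x
      unfolding E_def a_def[symmetric] b_def[symmetric] l_def
      by (simp only: add_right scale_right) (simp add: zero_right)
    then have "Re (\<psi> (a + (- \<i>) *s b) (a + (- \<i>) *s b)) = 0"
      using that[of "a + (- \<i>) *s b"] by metis
    then have "a + (- \<i>) *s b = 0"
      using pos by (metis less_irrefl)
    then have a: "a = \<i> *s b" by (simp add: vec_eq_iff)
    \<comment> \<open>The functional \<open>\<psi> _ w\<close> is complex linear and
      \<open>a = i b\<close>, so it vanishes at the conjugate vector \<open>a - i a / i\<close>,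
      that is, \<open>a - i b\<close>; pairing there gives
      \<open>\<alpha> a a + \<alpha> b b = 0\<close>.\<close>
    have 1: "\<alpha> a a + \<i> * \<alpha> b a = \<i> * \<psi> b w"
      using ab[of a] by (simp add: a scale_left)
    have 2: "\<alpha> a b + \<i> * \<alpha> b b = \<psi> b w" by (rule ab)
    have "\<alpha> a a + \<alpha> b b = (\<alpha> a a + \<i> * \<alpha> b a) - \<i> * (\<alpha> a b + \<i> * \<alpha> b b)"
      by (simp add: algebra_simps A.sym[of b a])
    also have "\<dots> = 0" unfolding 1 2 by simp
    finally have "a = 0 \<and> b = 0" by (rule A.kernel_trivial)
    then have "\<psi> w w = 0" using ab[of w] by (simp add: \<alpha>.zero_left)
    then show "w = 0" using pos[of w] by (cases "w = 0") auto
  qed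
  have E5: "x = 0" if "\<And>w. Re (E (x, 0) (0, w)) = 0" for x
  proof -
    define a b where "a = s1 (x, 0)" and "b = s2 (x, 0)"
    have ab: "\<alpha> a y + \<i> * \<alpha> b y = \<psi> x y" for y
    proof -
      have "2 * (\<alpha> a y + \<i> * \<alpha> b y) = 2 * \<psi> x y"
        unfolding a_def b_def crit by (simp add: l_def zero_right)
      then show ?thesis by (subst (asm) mult_left_cancel) auto
    qed
    have "E (x, 0) (0, w) = \<psi> (a + \<i> *s b) w" for w
      unfolding E_def a_def[symmetric] b_def[symmetric] l_def
      by (simp only: add_left scale_left) (simp add: zero_left)
    then have "Re (\<psi> (a + \<i> *s b) (a + \<i> *s b)) = 0"
      using that[of "a + \<i> *s b"] by metis
    then have "a + \<i> *s b = 0"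
      using pos by (metis less_irrefl)
    then have a: "a = (- \<i>) *s b" by (simp add: vec_eq_iff add_eq_0_iff2)
    have 1: "\<alpha> a a + \<i> * \<alpha> b a = \<i> * \<psi> x b"
      unfolding ab by (simp only: a scale_right) simp
    have 2: "\<alpha> a b + \<i> * \<alpha> b b = \<psi> x b" by (rule ab)
    have "\<alpha> a a + \<alpha> b b = (\<alpha> a a + \<i> * \<alpha> b a) - \<i> * (\<alpha> a b + \<i> * \<alpha> b b)"
      by (simp add: algebra_simps A.sym[of b a])
    also have "\<dots> = 0" unfolding 1 2 by simp
    finally have "a = 0 \<and> b = 0" by (rule A.kernel_trivial)
    then have "\<psi> x x = 0" using ab[of x] by (simp add: \<alpha>.zero_left)
    then show "x = 0" using pos[of x] by (cases "x = 0") auto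
  qed
  show ?thesis by (rule that[OF E1 E2 E3 E4 E5])
qed

text \<open>Up to the factor \<open>c\<^sub>0\<^sup>2\<close>, the modulus of the kernel of the
  Toeplitz operator after the weights have been attached to the two functions; \<open>g\<close>
  drops out because the modulus of \<open>exp (g x)\<close> times \<open>exp (- \<Phi> x)\<close> is
  \<open>exp (- N x)\<close>.\<close>

definition k :: "complex ^ 'n \<Rightarrow> complex ^ 'n \<Rightarrow> real" where
  "k x w = norm (G (x, w)) * exp (- N x - N w)"

lemma measurable_G: "G \<in> borel_measurable borel"
proof (rule G_exponent)
  fix E assume E: "Real_Vector_Spaces.bounded_bilinear E" "\<And>v. G v = exp (E v v) * G 0"
  have "continuous_on UNIV (\<lambda>v. E v v)"
    by (rule bounded_bilinear.continuous_on[OF E(1) continuous_on_id continuous_on_id])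
  then have [measurable]: "(\<lambda>v. E v v) \<in> borel_measurable borel"
    by (rule borel_measurable_continuous_onI)
  have "(\<lambda>v. exp (E v v) * G 0) \<in> borel_measurable borel" by measurable
  then show ?thesis by (simp only: E(2)[symmetric])
qed

lemma measurable_k [measurable]: "case_prod k \<in> borel_measurable (borel \<Otimes>\<^sub>M borel)"
proof -
  have [measurable]: "(\<lambda>v. G v) \<in> borel_measurable (borel \<Otimes>\<^sub>M borel)"
    unfolding borel_prod by (rule measurable_G)
  show ?thesis
    unfolding k_def by measurable
qed

text \<open>A Gaussian bounded above along every ray has a semidefinite exponent; definiteness on
  the two coordinate axes then bounds the fibre integrals uniformly. If \<open>G 0\<close> is zero,
  the kernel vanishes identically.\<close>

lemma k_marginals:
  assumes bound: "\<And>x w. norm (G (x, w)) \<le> M * exp (N x + N w)"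
  obtains C where "C \<ge> 0" "\<And>x. (\<integral>\<^sup>+w. ennreal (k x w) \<partial>lborel) \<le> ennreal C"
    "\<And>w. (\<integral>\<^sup>+x. ennreal (k x w) \<partial>lborel) \<le> ennreal C"
proof (cases "G 0 = 0")
  case True
  have "G v = 0" for v
  proof (rule G_exponent)
    fix E assume "\<And>v. G v = exp (E v v) * G 0"
    then show "G v = 0" using True by simp
  qed
  then have "k x w = 0" for x w by (simp add: k_def)
  then show ?thesis using that[of 0] by simp
next
  case False
  show ?thesis
  proof (rule G_exponent)
    fix E
    assume E: "Real_Vector_Spaces.bounded_bilinear E" "\<And>u v. E u v = E v u"
      and G: "\<And>v. G v = exp (E v v) * G 0"
      and E0: "\<And>w. (\<And>x. Re (E (0, w) (x, 0)) = 0) \<Longrightarrow> w = 0" "\<And>x. (\<And>w. Re (E (x, 0) (0, w)) = 0) \<Longrightarrow> x = 0"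
    interpret E: Real_Vector_Spaces.bounded_bilinear E by (rule E)
    define B where "B u v = Re (\<psi> (fst u) (fst v)) + Re (\<psi> (snd u) (snd v)) - Re (E u v)" for u v
    have B: "Real_Vector_Spaces.bounded_bilinear B"
      unfolding B_def
      by (rule bounded_bilinear_euclideanI) (simp_all add: add_left add_right scaleR_left scaleR_right
          E.add_left E.add_right E.scaleR_left E.scaleR_right algebra_simps)
    interpret B: Real_Vector_Spaces.bounded_bilinear B by (rule B)
    have Bsym: "B u v = B v u" for u v
      by (simp add: B_def Re_swap[of "fst u"] Re_swap[of "snd u"] E(2)[of u])
    have kB: "k x w = norm (G 0) * exp (- B (x, w) (x, w))" for x w
      unfolding k_def B_def by (subst G) (simp add: norm_mult N_def mult_exp_exp algebra_simps)
    have B0: "0 \<le> B v v" for v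
    proof (rule ccontr)
      assume neg: "\<not> 0 \<le> B v v"
      have k_le: "k x w \<le> M" for x w
      proof -
        have "k x w \<le> (M * exp (N x + N w)) * exp (- N x - N w)"
          unfolding k_def by (intro mult_right_mono bound) auto
        then show ?thesis by (simp add: mult.assoc mult_exp_exp)
      qed
      define r where "r = M / norm (G 0)"
      have r: "exp (- t\<^sup>2 * B v v) \<le> r" for t
      proof -
        have "B (t *\<^sub>R v) (t *\<^sub>R v) = t\<^sup>2 * B v v"
          by (simp add: B.scaleR_left B.scaleR_right power2_eq_square)
        then have "norm (G 0) * exp (- t\<^sup>2 * B v v) \<le> M"
          using k_le[of "fst (t *\<^sub>R v)" "snd (t *\<^sub>R v)"] unfolding kB prod.collapse by simp
        then show ?thesis using False by (simp add: r_def field_simps)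
      qed
      \<comment> \<open>Chosen so that \<open>- t\<^sup>2 * B v v = r\<close>; the bound then reads
        \<open>exp r \<le> r\<close>, which is impossible.\<close>
      define t where "t = sqrt (r / (- B v v))"
      have "0 < r" using r[of 0] by simp
      then have "t\<^sup>2 = r / (- B v v)"
        unfolding t_def using neg by (intro real_sqrt_pow2 divide_nonneg_pos) auto
      then have "exp r \<le> r" using r[of t] neg by simp
      then show False using exp_ge_add_one_self[of r] by linarith
    qed
    have "0 < B (0, w) (0, w)" if "w \<noteq> 0" for w
    proof (rule ccontr)
      assume "\<not> 0 < B (0, w) (0, w)"
      then have "B (0, w) (0, w) = 0" using B0[of "(0, w)"] by simp
      then have "B (0, w) v = 0" for v by (rule nonneg_form_kernel[OF B Bsym B0])
      \<comment> \<open>The vectors \<open>(0, w)\<close> and \<open>(x, 0)\<close> lie on different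
        axes, so both hermitian terms of \<open>B\<close> vanish and only the cross term of
        \<open>E\<close> is left.\<close>
      from this[of "(x, 0)" for x] have "Re (E (0, w) (x, 0)) = 0" for x
        by (simp add: B_def zero_left zero_right)
      then show False using E0(1) that by blast
    qed
    from nn_integral_exp_neg_form_bounded[OF B Bsym B0 this]
    obtain C1 where C1: "C1 \<ge> 0" "\<And>x. (\<integral>\<^sup>+w. ennreal (exp (- B (x, w) (x, w))) \<partial>lborel) \<le> ennreal C1"
      by blast
    \<comment> \<open>The form with its two variables exchanged, so that the bound on fibre
      integrals also covers the other marginal.\<close>
    define B' where "B' u v = B (snd u, fst u) (snd v, fst v)" for u v
    have B_scale: "B (r *\<^sub>R x, r *\<^sub>R w) z = r * B (x, w) z" "B z (r *\<^sub>R x, r *\<^sub>R w) = r * B z (x, w)" for r x w z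
      using B.scaleR_left[of r "(x, w)" z] B.scaleR_right[of z r "(x, w)"] by simp_all
    have B': "Real_Vector_Spaces.bounded_bilinear B'"
      unfolding B'_def
      by (rule bounded_bilinear_euclideanI) (simp_all add: B.add_left[symmetric] B.add_right[symmetric] B_scale)
    have "0 < B' (0, x) (0, x)" if "x \<noteq> 0" for x
    proof (rule ccontr)
      assume "\<not> 0 < B' (0, x) (0, x)"
      then have "B (x, 0) (x, 0) = 0" using B0[of "(x, 0)"] by (simp add: B'_def)
      then have "B (x, 0) v = 0" for v by (rule nonneg_form_kernel[OF B Bsym B0])
      from this[of "(0, w)" for w] have "Re (E (x, 0) (0, w)) = 0" for w
        by (simp add: B_def zero_left zero_right)
      then show False using E0(2) that by blast
    qed
    note B'_pos = this
    have B'sym: "B' u v = B' v u" for u v unfolding B'_def by (rule Bsym)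
    have B'0: "0 \<le> B' v v" for v unfolding B'_def by (rule B0)
    from nn_integral_exp_neg_form_bounded[OF B' B'sym B'0 B'_pos]
    obtain C2 where C2: "C2 \<ge> 0" "\<And>x. (\<integral>\<^sup>+w. ennreal (exp (- B' (x, w) (x, w))) \<partial>lborel) \<le> ennreal C2"
      by blast
      have [measurable]: "(\<lambda>w. B (x, w) (x, w)) \<in> borel_measurable borel"
        "(\<lambda>w. B (w, x) (w, x)) \<in> borel_measurable borel" for x
        by (intro borel_measurable_continuous_onI B.continuous_on continuous_on_Pair
            continuous_on_id continuous_on_const)+
    show ?thesis
    proof
      show "norm (G 0) * max C1 C2 \<ge> 0" using C1 by simp
      fix x
      have "(\<integral>\<^sup>+w. ennreal (k x w) \<partial>lborel) = ennreal (norm (G 0)) * (\<integral>\<^sup>+w. ennreal (exp (- B (x, w) (x, w))) \<partial>lborel)"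
        unfolding kB by (simp add: ennreal_mult' nn_integral_cmult)
      also have "\<dots> \<le> ennreal (norm (G 0)) * ennreal (max C1 C2)"
        by (intro mult_left_mono order.trans[OF C1(2)] ennreal_leI) auto
      finally show "(\<integral>\<^sup>+w. ennreal (k x w) \<partial>lborel) \<le> ennreal (norm (G 0) * max C1 C2)"
        by (simp add: ennreal_mult')
    next
      fix w
      have "(\<integral>\<^sup>+x. ennreal (k x w) \<partial>lborel) = ennreal (norm (G 0)) * (\<integral>\<^sup>+x. ennreal (exp (- B' (w, x) (w, x))) \<partial>lborel)"
        unfolding kB B'_def by (simp add: ennreal_mult' nn_integral_cmult)
      also have "\<dots> \<le> ennreal (norm (G 0)) * ennreal (max C1 C2)"
        by (intro mult_left_mono order.trans[OF C2(2)] ennreal_leI) auto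
      finally show "(\<integral>\<^sup>+x. ennreal (k x w) \<partial>lborel) \<le> ennreal (norm (G 0) * max C1 C2)"
        by (simp add: ennreal_mult')
    qed
  qed
qed

text \<open>The heat kernel turns the coherent-state integrand into its own Gaussian average: this is the
  Wigner function of a pair of coherent states.\<close>

lemma heat_identity:
  "(\<integral>z. exp (- 4 * N (z - y) - 4 * N z + 4 * \<psi> x z + 4 * \<psi> z w) \<partial>lborel) =
    exp (2 * \<psi> x w + l (x, w) y - 2 * N y) * (\<integral>z. exp (- 8 * N z) \<partial>lborel)"
proof -
  \<comment> \<open>In these variables the exponent is
    \<open>- 8 * \<psi> z z + 4 * \<psi> z v + 4 * \<psi> u z - 4 * N y\<close>. Shifting
    \<open>z\<close> by \<open>u / 2\<close> cancels the antiholomorphic term, so the remaining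
    factor \<open>F\<close> is entire with \<open>F 0 = 1\<close>.\<close>
  define u v where "u = x + y" and "v = y + w"
  define F where "F z = exp (- 4 * \<psi> z (u - v))" for z
  have F: "entire_Cn F"
    unfolding F_def by (intro entire_Cn_exp entire_Cn_mult entire_Cn_const entire_form_left)
  obtain C where C: "\<And>z. norm (\<psi> z (u - v)) \<le> norm z * C"
    using bounded_linear.bounded[OF bounded_linear_left] by blast
  have int: "integrable lborel (\<lambda>z. F z * exp (- 8 * N z))"
  proof (rule Bochner_Integration.integrable_bound[OF integrable_exp_N[of 8 "4 * C"]])
    have "Re (- 4 * \<psi> z (u - v)) \<le> 4 * C * norm z" for z
    proof -
      have "- Re (\<psi> z (u - v)) \<le> C * norm z"
        using order.trans[OF abs_Re_le_cmod C[of z]] by (metis abs_le_iff mult.commute)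
      then show ?thesis by simp
    qed
    then show "AE z in lborel. norm (F z * complex_of_real (exp (- 8 * N z))) \<le> norm (exp (4 * C * norm z - 8 * N z))"
      by (simp add: F_def norm_mult mult_exp_exp)
  qed (simp_all add: F_def)
  define h where "h z = exp (- 4 * N (z - y) - 4 * N z + 4 * \<psi> x z + 4 * \<psi> z w)" for z
  have shift: "h (z + (1/2) *\<^sub>R u) = exp (2 * \<psi> u v - 4 * N y) * (F z * exp (- 8 * N z))" for z
  proof -
    have e1: "- 4 * complex_of_real (N (t - y)) - 4 * N t + 4 * \<psi> x t + 4 * \<psi> t w =
        - 8 * \<psi> t t + 4 * \<psi> t v + 4 * \<psi> u t - 4 * N y" for t
      by (simp add: u_def v_def diag[symmetric] diff_left diff_right add_left add_right)
    have e2: "- 4 * complex_of_real (N (z + (1/2) *\<^sub>R u - y)) - 4 * N (z + (1/2) *\<^sub>R u)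
        + 4 * \<psi> x (z + (1/2) *\<^sub>R u) + 4 * \<psi> (z + (1/2) *\<^sub>R u) w =
        (2 * \<psi> u v - 4 * N y) + (- 4 * \<psi> z (u - v) + complex_of_real (- 8 * N z))"
      unfolding e1
      by (simp add: add_left add_right diff_right scaleR_left scaleR_right diag[of z] scaleR_conv_of_real[of _ "_ :: complex"] add_divide_distrib)
    show ?thesis
      unfolding h_def F_def exp_of_real[symmetric] exp_add[symmetric] e2[symmetric] by simp
  qed
  have "(\<integral>z. h z \<partial>lborel) = (\<integral>z. h (z + (1/2) *\<^sub>R u) \<partial>lborel)"
  proof -
    have "h \<in> borel_measurable borel" unfolding h_def by measurable
    from integral_lborel_translate[OF this] show ?thesis by (rule sym)
  qed
  also have "\<dots> = exp (2 * \<psi> u v - 4 * N y) * (\<integral>z. F z * exp (- 8 * N z) \<partial>lborel)"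
    unfolding shift by (rule integral_mult_right_zero)
  also have "(\<integral>z. F z * exp (- 8 * N z) \<partial>lborel) = (\<integral>z. exp (- 8 * N z) \<partial>lborel)"
    by (subst integral_entire_gaussian[OF F _ int]) (simp_all add: F_def zero_left)
  also have "2 * \<psi> u v - 4 * N y = 2 * \<psi> x w + l (x, w) y - 2 * N y"
    by (simp add: u_def v_def l_def add_left add_right diag)
  finally show ?thesis by (simp add: h_def)
qed

text \<open>Integrating the heat identity against the symbol and exchanging integrals writes
  \<open>G (x, w) * exp (2 * \<psi> x w)\<close>, up to a constant, as an integral of the
  heat-averaged symbol against a factor of modulus
  \<open>exp (N (x + w) - 4 * N (z - (x + w) / 2))\<close>. The cross term of
  \<open>N (x + w)\<close> is the logarithm of the modulus of \<open>exp (2 * \<psi> x w)\<close>,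
  so only \<open>N x + N w\<close> survives.\<close>

lemma G_bound:
  assumes heat: "AE z in lborel. norm (\<integral>y. exp (- 4 * N (z - y)) * exp (2 * \<beta> y y) \<partial>lborel) \<le> M"
  obtains M' where "\<And>x w. norm (G (x, w)) \<le> M' * exp (N x + N w)"
proof -
  obtain d where d: "d > 0" "\<And>y. d * (norm y)\<^sup>2 \<le> N y - 2 * Re (\<beta> y y)"
    using symbol_gap by blast
  define c1 c2 where "c1 = (\<integral>z. exp (- 8 * N z) \<partial>lborel)" and "c2 = (\<integral>z. exp (- 4 * N z) \<partial>lborel)"
  have c1: "c1 > 0" unfolding c1_def by (rule integral_exp_N_pos) simp
  have "norm (G (x, w)) \<le> M * c2 / c1 * exp (N x + N w)" for x w
  proof -
    define J where "J z y = exp (- 4 * N (z - y) - 4 * N z + 4 * \<psi> x z + 4 * \<psi> z w) * exp (2 * \<beta> y y)" for z y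
    obtain C where C: "\<And>z. norm (\<psi> (x + w) z) \<le> norm z * C"
      using bounded_linear.bounded[OF bounded_linear_right] by blast
    have Jm: "case_prod J \<in> borel_measurable (borel \<Otimes>\<^sub>M borel)"
      unfolding J_def by measurable
    have lin: "Re (\<psi> x z) + Re (\<psi> z w) = Re (\<psi> (x + w) z)" for z
      by (simp add: add_left Re_swap[of z w])
    \<comment> \<open>The symbol may grow almost like \<open>exp (N y)\<close>; the estimate
      \<open>N y \<le> 2 * N (z - y) + 2 * N z\<close> pays for this with half of the available
      decay and keeps \<open>- 2 * N z\<close>, while the margin \<open>d\<close> supplies decay in
      \<open>y\<close>.\<close>
    have Jnorm: "norm (J z y) \<le> exp (4 * C * norm z - 2 * N z) * exp (0 * norm y - d * (norm y)\<^sup>2)" for z y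
    proof -
      have "N y \<le> 2 * N (z - y) + 2 * N z"
        using N_nonneg[of "(z - y) + z"] N_add[of "z - y" z] N_diff[of z "z - y"] Re_swap[of z "z - y"] by simp
      moreover have "Re (\<psi> (x + w) z) \<le> C * norm z"
        using order.trans[OF complex_Re_le_cmod C[of z]] by (simp add: mult_ac)
      ultimately have "(- 4 * N (z - y) - 4 * N z + 4 * Re (\<psi> x z) + 4 * Re (\<psi> z w)) + 2 * Re (\<beta> y y)
          \<le> (4 * C * norm z - 2 * N z) + (0 * norm y - d * (norm y)\<^sup>2)"
        using d(2)[of y] lin[of z] N_nonneg[of "z - y"] by simp
      then show ?thesis
        unfolding J_def by (simp add: norm_mult mult_exp_exp)
    qed
    have "G (x, w) * (exp (2 * \<psi> x w) * c1) = (\<integral>y. exp (l (x, w) y - \<alpha> y y) * (exp (2 * \<psi> x w) * c1) \<partial>lborel)"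
      unfolding G_def by (rule integral_mult_left_zero[symmetric])
    also have "\<dots> = (\<integral>y. (\<integral>z. J z y \<partial>lborel) \<partial>lborel)"
    proof (rule Bochner_Integration.integral_cong[OF refl])
      fix y
      have "(\<integral>z. J z y \<partial>lborel) = exp (2 * \<psi> x w + l (x, w) y - 2 * N y) * c1 * exp (2 * \<beta> y y)"
        unfolding J_def c1_def heat_identity[symmetric] by (rule integral_mult_left_zero)
      then show "exp (l (x, w) y - \<alpha> y y) * (exp (2 * \<psi> x w) * c1) = (\<integral>z. J z y \<partial>lborel)"
        by (simp add: \<alpha>_diag mult_ac mult_exp_exp) (simp add: exp_add[symmetric] exp_diff[symmetric] algebra_simps mult_exp_exp)
    qed
    also have "\<dots> = (\<integral>z. (\<integral>y. J z y \<partial>lborel) \<partial>lborel)"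
    proof (rule Fubini_dominated[OF Jm _ _ Jnorm])
      show "integrable lborel (\<lambda>z. exp (4 * C * norm z - 2 * N z))"
        by (rule integrable_exp_N) simp
      show "integrable lborel (\<lambda>y::complex ^ 'n. exp (0 * norm y - d * (norm y)\<^sup>2))"
        by (rule integrable_exp_neg_norm_sqr_linear[OF d(1)])
    qed
    also have "norm \<dots> \<le> (\<integral>z. exp (N (x + w)) * (exp (- 4 * N (z - (1/2) *\<^sub>R (x + w))) * M) \<partial>lborel)"
    proof (rule norm_integral_le_AE)
      have "integrable lborel (\<lambda>z. exp (- 4 * N (z + - ((1/2) *\<^sub>R (x + w)))))"
        using integrable_lborel_translate[OF integrable_exp_N[of 4 0], of "- ((1/2) *\<^sub>R (x + w))"] by simp
      then show "integrable lborel (\<lambda>z. exp (N (x + w)) * (exp (- 4 * N (z - (1/2) *\<^sub>R (x + w))) * M))"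
        by (intro integrable_mult_right integrable_mult_left) simp
      show "AE z in lborel. norm (\<integral>y. J z y \<partial>lborel) \<le> exp (N (x + w)) * (exp (- 4 * N (z - (1/2) *\<^sub>R (x + w))) * M)"
        using heat
      proof eventually_elim
        case (elim z)
        have "J z y = exp (- 4 * N z + 4 * \<psi> x z + 4 * \<psi> z w) * (exp (- 4 * N (z - y)) * exp (2 * \<beta> y y))" for y
          unfolding J_def exp_of_real[symmetric] by (simp add: exp_add[symmetric] exp_diff[symmetric] algebra_simps mult_exp_exp)
        then have "(\<integral>y. J z y \<partial>lborel) = exp (- 4 * N z + 4 * \<psi> x z + 4 * \<psi> z w) *
            (\<integral>y. exp (- 4 * N (z - y)) * exp (2 * \<beta> y y) \<partial>lborel)"
          by (simp only: integral_mult_right_zero)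
        then have "norm (\<integral>y. J z y \<partial>lborel) \<le> norm (exp (- 4 * N z + 4 * \<psi> x z + 4 * \<psi> z w)) * M"
          unfolding norm_mult using elim by (simp add: norm_mult mult_left_mono)
        also have "norm (exp (- 4 * N z + 4 * \<psi> x z + 4 * \<psi> z w)) = exp (N (x + w) + - 4 * N (z - (1/2) *\<^sub>R (x + w)))"
          using lin[of z] unfolding norm_exp_eq_Re N_diff[of z] N_scaleR
          by (simp add: scaleR_right Re_swap[of z] power2_eq_square)
        finally show ?case unfolding exp_add by (simp add: mult.assoc)
      qed
    qed
    also have "\<dots> = exp (N (x + w)) * ((\<integral>z. exp (- 4 * N (z - (1/2) *\<^sub>R (x + w))) \<partial>lborel) * M)"
      by (simp only: integral_mult_right_zero integral_mult_left_zero)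
    also have "(\<integral>z. exp (- 4 * N (z - (1/2) *\<^sub>R (x + w))) \<partial>lborel) = c2"
      using integral_lborel_translate[of "\<lambda>z. exp (- 4 * N z)" "- ((1/2) *\<^sub>R (x + w))"] by (simp add: c2_def)
    finally have "norm (G (x, w)) * (exp (2 * Re (\<psi> x w)) * c1) \<le> exp (N (x + w)) * (c2 * M)"
      using c1 by (simp add: norm_mult)
    then have "norm (G (x, w)) \<le> exp (N (x + w)) * (c2 * M) / (exp (2 * Re (\<psi> x w)) * c1)"
      using c1 by (simp add: pos_le_divide_eq)
    also have "\<dots> = M * c2 / c1 * exp (N x + N w)"
      unfolding N_add exp_add by (simp add: field_simps)
    finally show ?thesis .
  qed
  then show ?thesis by (rule that)
qed

section \<open>The kernel of the Toeplitz operator and its boundedness\<close>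

text \<open>Replacing \<open>u y\<close> by its reproducing integral produces a double integral
  whose inner part, after exchange, is \<open>G\<close>; the two kernels account for the square of
  \<open>c\<^sub>0\<close>.\<close>

lemma P_toeplitz_kernel:
  assumes u: "u \<in> bargmann_space \<Phi>"
  shows "P (\<lambda>y. exp (2 * \<beta> y y) * u y) x =
    (\<integral>w. exp (g x) / c\<^sub>0\<^sup>2 * G (x, w) * (exp (cnj (g w)) * u w * exp (- 2 * \<Phi> w)) \<partial>lborel)"
proof -
  have u2: "u \<in> L2_space (weighted_measure \<Phi>)" using u by (simp add: bargmann_space_def)
  have [measurable]: "u \<in> borel_measurable borel" and U2: "integrable lborel (\<lambda>x. (norm (u x) * exp (- \<Phi> x))\<^sup>2)"
    using u2 by (auto simp: L2_iff)
  obtain d where d: "d > 0" "\<And>y. d * (norm y)\<^sup>2 \<le> N y - 2 * Re (\<beta> y y)"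
    using symbol_gap by blast
  obtain m where m: "m > 0" "\<And>y. m * (norm y)\<^sup>2 \<le> N y"
    using N_bound by blast
  obtain C where C: "\<And>y. norm (\<psi> x y) \<le> norm y * C"
    using bounded_linear.bounded[OF bounded_linear_right] by blast
  \<comment> \<open>Only square integrability of the weighted \<open>u\<close> is known, so
    domination needs Gaussian decay in \<open>w\<close>. It is borrowed from
    \<open>N (y - w)\<close> and from half of the margin in \<open>y\<close>: the estimate uses
    \<open>2 * e \<le> m\<close> and \<open>2 * e \<le> d / 2\<close>.\<close>
  define e where "e = min (d / 4) (m / 2)"
  have e: "e > 0" "e \<le> d / 4" "e \<le> m / 2" using d m by (auto simp: e_def)
  define J where "J w y = K x y * (exp (2 * \<beta> y y)) * exp (- 2 * \<Phi> y) * (K y w * u w * exp (- 2 * \<Phi> w))" for w y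
  have Jm: "case_prod J \<in> borel_measurable (borel \<Otimes>\<^sub>M borel)"
    unfolding J_def by measurable
  have Jnorm: "norm (J w y) \<le> (exp (0 * norm w - e * (norm w)\<^sup>2) * (norm (u w) * exp (- \<Phi> w))) *
      (exp (\<Phi> x) / c\<^sub>0\<^sup>2 * exp (2 * C * norm y - d / 2 * (norm y)\<^sup>2))" for w y
  proof -
    have "N y - 2 * (C * norm y) \<le> N (x - y)"
      using order.trans[OF complex_Re_le_cmod C[of y]] N_nonneg[of x] by (simp add: N_diff mult_ac)
    moreover have "e * (norm w)\<^sup>2 \<le> d / 2 * (norm y)\<^sup>2 + N (y - w)"
    proof -
      have "(norm w)\<^sup>2 \<le> 2 * (norm y)\<^sup>2 + 2 * (norm (y - w))\<^sup>2"
      proof -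
        have "norm w \<le> norm y + norm (y - w)" using norm_triangle_ineq4[of y "y - w"] by simp
        then have "(norm w)\<^sup>2 \<le> (norm y + norm (y - w))\<^sup>2" by (intro power_mono) auto
        also have "\<dots> \<le> 2 * (norm y)\<^sup>2 + 2 * (norm (y - w))\<^sup>2"
          using sum_squares_bound[of "norm y" "norm (y - w)"] by (simp add: power2_sum)
        finally show ?thesis .
      qed
      then have "e * (norm w)\<^sup>2 \<le> (2 * e) * (norm y)\<^sup>2 + (2 * e) * (norm (y - w))\<^sup>2"
        using mult_left_mono[of _ _ e] e(1) by (fastforce simp: algebra_simps)
      also have "\<dots> \<le> d / 2 * (norm y)\<^sup>2 + m * (norm (y - w))\<^sup>2"
        using e by (intro add_mono mult_right_mono) auto
      also have "\<dots> \<le> d / 2 * (norm y)\<^sup>2 + N (y - w)" using m by simp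
      finally show ?thesis .
    qed
    ultimately have le: "- N (x - y) + 2 * Re (\<beta> y y) - N (y - w) \<le>
        (0 * norm w - e * (norm w)\<^sup>2) + (2 * C * norm y - d / 2 * (norm y)\<^sup>2)"
      using d(2)[of y] by simp
    have *: "norm (complex_of_real (exp (- 2 * \<Phi> t))) = exp (- \<Phi> t) * exp (- \<Phi> t)" for t
      unfolding norm_of_real by (simp add: mult_exp_exp)
    have "norm (J w y) = exp (\<Phi> x) / c\<^sub>0\<^sup>2 * (exp (- N (x - y)) * norm (exp (2 * \<beta> y y)) * exp (- N (y - w))) *
        (norm (u w) * exp (- \<Phi> w))"
      unfolding J_def norm_mult norm_K * exp_add by (simp add: exp_minus power2_eq_square field_simps)
    also have "exp (- N (x - y)) * norm (exp (2 * \<beta> y y)) * exp (- N (y - w)) =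
        exp (- N (x - y) + 2 * Re (\<beta> y y) - N (y - w))"
      by (simp add: mult_exp_exp)
    also have "exp (\<Phi> x) / c\<^sub>0\<^sup>2 * exp (- N (x - y) + 2 * Re (\<beta> y y) - N (y - w)) * (norm (u w) * exp (- \<Phi> w)) \<le>
        exp (\<Phi> x) / c\<^sub>0\<^sup>2 * exp ((0 * norm w - e * (norm w)\<^sup>2) + (2 * C * norm y - d / 2 * (norm y)\<^sup>2)) * (norm (u w) * exp (- \<Phi> w))"
      using le by (intro mult_right_mono mult_left_mono) auto
    finally show ?thesis unfolding exp_add by (simp add: mult_ac)
  qed
  have "P (\<lambda>y. exp (2 * \<beta> y y) * u y) x = (\<integral>y. (\<integral>w. J w y \<partial>lborel) \<partial>lborel)"
    unfolding P_def
  proof (rule Bochner_Integration.integral_cong[OF refl])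
    fix y
    have "(\<integral>w. J w y \<partial>lborel) = K x y * (exp (2 * \<beta> y y)) * exp (- 2 * \<Phi> y) * P u y"
      unfolding J_def P_def by (rule integral_mult_right_zero)
    then show "K x y * (exp (2 * \<beta> y y) * u y) * exp (- 2 * \<Phi> y) = (\<integral>w. J w y \<partial>lborel)"
      by (simp add: P_reproducing[OF u] mult_ac)
  qed
  also have "\<dots> = (\<integral>w. (\<integral>y. J w y \<partial>lborel) \<partial>lborel)"
  proof (rule Fubini_dominated[OF Jm _ _ Jnorm])
    show "integrable lborel (\<lambda>w. exp (0 * norm w - e * (norm w)\<^sup>2) * (norm (u w) * exp (- \<Phi> w)))"
    proof (rule integrable_L2_mult)
      show "integrable lborel (\<lambda>w::complex ^ 'n. (exp (0 * norm w - e * (norm w)\<^sup>2))\<^sup>2)"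
        using integrable_exp_neg_norm_sqr[of "2 * e", where 'a = "complex ^ 'n"] e(1) by (simp add: exp_double[symmetric] mult.assoc)
    qed (use U2 in auto)
    show "integrable lborel (\<lambda>y::complex ^ 'n. exp (\<Phi> x) / c\<^sub>0\<^sup>2 * exp (2 * C * norm y - d / 2 * (norm y)\<^sup>2))"
      using d by (intro integrable_mult_right integrable_exp_neg_norm_sqr_linear) auto
  qed
  also have "\<dots> = (\<integral>w. exp (g x) / c\<^sub>0\<^sup>2 * G (x, w) * (exp (cnj (g w)) * u w * exp (- 2 * \<Phi> w)) \<partial>lborel)"
  proof (rule Bochner_Integration.integral_cong[OF refl])
    fix w
    have "J w y = (exp (g x) / c\<^sub>0\<^sup>2 * (exp (cnj (g w)) * u w * exp (- 2 * \<Phi> w))) * exp (l (x, w) y - \<alpha> y y)" for y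
    proof -
      have "complex_of_real (- 2 * \<Phi> y) = - 2 * N y - g y - cnj (g y)"
        by (simp add: \<Phi>_eq complex_eq_iff)
      then have "(g x + cnj (g y) + 2 * \<psi> x y) + 2 * \<beta> y y + complex_of_real (- 2 * \<Phi> y) + (g y + cnj (g w) + 2 * \<psi> y w)
          = g x + cnj (g w) + (l (x, w) y - \<alpha> y y)"
        by (simp add: l_def \<alpha>_diag)
      then have "exp (g x + cnj (g y) + 2 * \<psi> x y) * exp (2 * \<beta> y y) * exp (complex_of_real (- 2 * \<Phi> y)) *
          exp (g y + cnj (g w) + 2 * \<psi> y w) = exp (g x) * exp (cnj (g w)) * exp (l (x, w) y - \<alpha> y y)"
        by (simp only: exp_add[symmetric])
      then have kk: "K x y * exp (2 * \<beta> y y) * exp (- 2 * \<Phi> y) * K y w = exp (g x) / c\<^sub>0\<^sup>2 * exp (cnj (g w)) * exp (l (x, w) y - \<alpha> y y)"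
        unfolding K_def exp_of_real by (simp add: power2_eq_square)
      have "J w y = (K x y * exp (2 * \<beta> y y) * exp (- 2 * \<Phi> y) * K y w) * (u w * exp (- 2 * \<Phi> w))"
        unfolding J_def by (simp only: mult_ac)
      then show ?thesis
        unfolding kk by (simp add: mult_ac)
    qed
    then have "(\<integral>y. J w y \<partial>lborel) = (exp (g x) / c\<^sub>0\<^sup>2 * (exp (cnj (g w)) * u w * exp (- 2 * \<Phi> w))) * G (x, w)"
      unfolding G_def by (simp only: integral_mult_right_zero)
    then show "(\<integral>y. J w y \<partial>lborel) = exp (g x) / c\<^sub>0\<^sup>2 * G (x, w) * (exp (cnj (g w)) * u w * exp (- 2 * \<Phi> w))"
      by (simp only: mult_ac)
  qed
  finally show ?thesis .
qed

text \<open>Membership in the Toeplitz domain makes the product with the symbol square integrable,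
  so the projection is given by \<open>P\<close> and has the kernel computed above; the norm bound
  is then Schur's test for \<open>k\<close>.\<close>

theorem toeplitz_bounded_if_heat_bounded:
  assumes heat: "AE z in lborel. norm (\<integral>y. exp (- 4 * N (z - y)) * exp (2 * \<beta> y y) \<partial>lborel) \<le> M"
  shows "toeplitz_bounded \<Phi> (\<lambda>x. exp (2 * \<beta> x x))"
proof -
  obtain M' where M': "\<And>x w. norm (G (x, w)) \<le> M' * exp (N x + N w)"
    using G_bound[OF heat] by blast
  obtain C where C: "C \<ge> 0" "\<And>x. (\<integral>\<^sup>+w. ennreal (k x w) \<partial>lborel) \<le> ennreal C"
    "\<And>w. (\<integral>\<^sup>+x. ennreal (k x w) \<partial>lborel) \<le> ennreal C"
    using k_marginals[OF M'] by blast
  define C' where "C' = C / c\<^sub>0\<^sup>2"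
  have C': "C' \<ge> 0" using C by (simp add: C'_def)
  have k_nonneg: "0 \<le> k x w" for x w by (simp add: k_def)
  \<comment> \<open>The added 1 keeps the constant strictly positive, since \<open>C'\<close> may be
    zero.\<close>
  have "L2_norm (weighted_measure \<Phi>) (toeplitz \<Phi> (\<lambda>x. exp (2 * \<beta> x x)) u) \<le> (C' + 1) * L2_norm (weighted_measure \<Phi>) u"
    if "u \<in> toeplitz_domain \<Phi> (\<lambda>x. exp (2 * \<beta> x x))" for u
  proof -
    have u: "u \<in> bargmann_space \<Phi>" and pu: "(\<lambda>x. exp (2 * \<beta> x x) * u x) \<in> L2_space (weighted_measure \<Phi>)"
      using that by (auto simp: toeplitz_domain_def)
    have [measurable]: "u \<in> borel_measurable borel" and U2: "integrable lborel (\<lambda>x. (norm (u x) * exp (- \<Phi> x))\<^sup>2)"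
      using u by (auto simp: bargmann_space_def L2_iff)
    define T where "T = P (\<lambda>x. exp (2 * \<beta> x x) * u x)"
    have T: "toeplitz \<Phi> (\<lambda>x. exp (2 * \<beta> x x)) u = T"
      unfolding toeplitz_def T_def by (rule bargmann_proj_eq[OF pu])
    have [measurable]: "T \<in> borel_measurable borel"
      unfolding T_def by (rule entire_Cn_measurable[OF entire_P[OF pu]])
    have "(\<integral>x. (norm (T x) * exp (- \<Phi> x))\<^sup>2 \<partial>lborel) \<le> C'\<^sup>2 * (\<integral>x. (norm (u x) * exp (- \<Phi> x))\<^sup>2 \<partial>lborel)"
    proof (rule schur_L2(2)[where k = "\<lambda>x w. k x w / c\<^sub>0\<^sup>2"])
      show "(\<integral>\<^sup>+w. ennreal (k x w / c\<^sub>0\<^sup>2) \<partial>lborel) \<le> ennreal C'" for x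
      proof -
        have "(\<integral>\<^sup>+w. ennreal (k x w / c\<^sub>0\<^sup>2) \<partial>lborel) = (\<integral>\<^sup>+w. ennreal (k x w) \<partial>lborel) / ennreal (c\<^sub>0\<^sup>2)"
          using c\<^sub>0_pos k_nonneg by (simp add: divide_ennreal[symmetric] nn_integral_divide)
        also have "\<dots> \<le> ennreal C / ennreal (c\<^sub>0\<^sup>2)"
          by (intro divide_right_mono_ennreal C)
        finally show ?thesis using C(1) c\<^sub>0_pos by (simp add: C'_def divide_ennreal)
      qed
      show "(\<integral>\<^sup>+x. ennreal (k x w / c\<^sub>0\<^sup>2) \<partial>lborel) \<le> ennreal C'" for w
      proof -
        have "(\<integral>\<^sup>+x. ennreal (k x w / c\<^sub>0\<^sup>2) \<partial>lborel) = (\<integral>\<^sup>+x. ennreal (k x w) \<partial>lborel) / ennreal (c\<^sub>0\<^sup>2)"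
          using c\<^sub>0_pos k_nonneg by (simp add: divide_ennreal[symmetric] nn_integral_divide)
        also have "\<dots> \<le> ennreal C / ennreal (c\<^sub>0\<^sup>2)"
          by (intro divide_right_mono_ennreal C)
        finally show ?thesis using C(1) c\<^sub>0_pos by (simp add: C'_def divide_ennreal)
      qed
      show "ennreal \<bar>norm (T x) * exp (- \<Phi> x)\<bar> \<le>
          (\<integral>\<^sup>+w. ennreal (k x w / c\<^sub>0\<^sup>2) * ennreal (norm (u w) * exp (- \<Phi> w)) \<partial>lborel)" for x
      proof -
        define f where "f w = exp (g x) / c\<^sub>0\<^sup>2 * G (x, w) * (exp (cnj (g w)) * u w * exp (- 2 * \<Phi> w))" for w
        have f: "norm (f w) * exp (- \<Phi> x) = k x w / c\<^sub>0\<^sup>2 * (norm (u w) * exp (- \<Phi> w))" for w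
        proof -
          have *: "norm (complex_of_real (exp (- 2 * \<Phi> w))) = exp (- \<Phi> w) * exp (- \<Phi> w)"
            unfolding norm_of_real by (simp add: mult_exp_exp)
          have n: "norm (exp (g x)) = exp (\<Phi> x) * exp (- N x)" "norm (exp (cnj (g w))) = exp (\<Phi> w) * exp (- N w)"
            by (simp_all add: \<Phi>_eq mult_exp_exp)
          have kk: "k x w = norm (G (x, w)) * (exp (- N x) * exp (- N w))"
            by (simp add: k_def mult_exp_exp)
          show ?thesis
            unfolding f_def norm_mult norm_divide * n kk
            by (simp add: exp_minus norm_power field_simps)
        qed
        have "ennreal (norm (T x)) \<le> (\<integral>\<^sup>+w. ennreal (norm (f w)) \<partial>lborel)"
        \<comment> \<open>For a non-integrable \<open>f\<close> the integral defining
          \<open>T x\<close> is 0 by convention, and the inequality is trivial.\<close>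
        proof (cases "integrable lborel f")
          case True
          then show ?thesis
            unfolding T_def P_toeplitz_kernel[OF u] f_def[symmetric] by (rule integral_norm_bound_ennreal)
        next
          case False
          then show ?thesis
            unfolding T_def P_toeplitz_kernel[OF u] f_def[symmetric] by (simp add: not_integrable_integral_eq)
        qed
        then have "ennreal (norm (T x)) * ennreal (exp (- \<Phi> x)) \<le> (\<integral>\<^sup>+w. ennreal (norm (f w)) \<partial>lborel) * ennreal (exp (- \<Phi> x))"
          by (rule mult_right_mono) simp
        also have "\<dots> = (\<integral>\<^sup>+w. ennreal (norm (f w)) * ennreal (exp (- \<Phi> x)) \<partial>lborel)"
        proof (rule nn_integral_multc[symmetric])
          have [measurable]: "(\<lambda>w. G (x, w)) \<in> borel_measurable borel"
            using measurable_compose[OF _ measurable_G, of "\<lambda>w. (x, w)" borel] by (simp add: borel_prod[symmetric])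
          show "(\<lambda>w. ennreal (norm (f w))) \<in> borel_measurable lborel"
            unfolding f_def by measurable
        qed
        finally show ?thesis
          using k_nonneg by (simp add: ennreal_mult'[symmetric] f)
      qed
    qed (use C' U2 k_nonneg in auto)
    then have "L2_norm (weighted_measure \<Phi>) T \<le> C' * L2_norm (weighted_measure \<Phi>) u"
      unfolding L2_norm_eq[OF \<open>T \<in> _\<close>] L2_norm_eq[OF \<open>u \<in> borel_measurable borel\<close>]
      using C' real_sqrt_le_mono by (fastforce simp: real_sqrt_mult)
    also have "\<dots> \<le> (C' + 1) * L2_norm (weighted_measure \<Phi>) u"
      by (intro mult_right_mono) (auto simp: L2_norm_def)
    finally show ?thesis by (simp add: T)
  qed
  moreover have "C' + 1 > 0" using C' by simp
  ultimately show ?thesis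
    unfolding toeplitz_bounded_def by blast
qed

end

section \<open>Wirtinger calculus of quadratic forms\<close>

lemma quadratic_form_polarization:
  fixes f :: "'a::euclidean_space \<Rightarrow> 'b::euclidean_space"
  assumes "quadratic_form f"
  obtains b where "bounded_bilinear b" "\<And>x y. b x y = b y x" "\<And>x. f x = b x x"
proof -
  obtain c where c: "\<And>x. f x = (\<Sum>i\<in>Basis. \<Sum>j\<in>Basis. ((x \<bullet> i) * (x \<bullet> j)) *\<^sub>R c i j)"
    using assms unfolding quadratic_form_def by blast
  define b where "b x y = (\<Sum>i\<in>Basis. \<Sum>j\<in>Basis. (((x \<bullet> i) * (y \<bullet> j) + (y \<bullet> i) * (x \<bullet> j)) / 2) *\<^sub>R c i j)" for x y
  have "bounded_bilinear b"
    unfolding b_def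
    by (rule bounded_bilinear_euclideanI)
       (simp_all add: sum.distrib[symmetric] scaleR_add_left[symmetric] scaleR_sum_right inner_add_left
         add_divide_distrib ring_distribs mult_ac add_ac)
  moreover have "b x y = b y x" for x y
    by (simp add: b_def add.commute)
  moreover have "f x = b x x" for x
    by (simp add: b_def c)
  ultimately show ?thesis by (rule that)
qed

lemma directional_deriv_linear:
  assumes "bounded_linear f"
  shows "directional_deriv v f x = f v"
proof -
  interpret bounded_linear f by (rule assms)
  have "((\<lambda>t. f (x + t *\<^sub>R v)) has_vector_derivative f v) (at 0)"
    unfolding add scaleR by (auto intro!: derivative_eq_intros)
  then show ?thesis
    unfolding directional_deriv_def by (rule vector_derivative_at)
qed

lemma directional_deriv_quadratic:
  assumes B: "bounded_bilinear B" and sym: "\<And>x y. B x y = B y x"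
  shows "directional_deriv v (\<lambda>x. B x x) x = 2 *\<^sub>R B x v"
proof -
  interpret bounded_bilinear B by (rule B)
  have "B (x + t *\<^sub>R v) (x + t *\<^sub>R v) = B x x + t *\<^sub>R (2 *\<^sub>R B x v) + t\<^sup>2 *\<^sub>R B v v" for t
    by (simp add: add_left add_right scaleR_left scaleR_right sym[of v x] power2_eq_square scaleR_2 scaleR_add_right)
  moreover have "((\<lambda>t::real. B x x + t *\<^sub>R (2 *\<^sub>R B x v) + t\<^sup>2 *\<^sub>R B v v) has_vector_derivative 2 *\<^sub>R B x v) (at 0)"
    by (auto intro!: derivative_eq_intros)
  ultimately show ?thesis
    unfolding directional_deriv_def by (intro vector_derivative_at) simp
qed

lemma levi_matrix_quadratic:
  fixes B :: "complex ^ 'n \<Rightarrow> complex ^ 'n \<Rightarrow> complex"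
  assumes B: "bounded_bilinear B" and sym: "\<And>x y. B x y = B y x"
  shows "levi_matrix (\<lambda>x. B x x) x $ j $ k =
    (B (axis j 1) (axis k 1) + B (axis j \<i>) (axis k \<i>)) / 2 +
    \<i> * (B (axis j 1) (axis k \<i>) - B (axis j \<i>) (axis k 1)) / 2"
proof -
  interpret bounded_bilinear B by (rule B)
  have bar: "wirtinger_bar k (\<lambda>x. B x x) = (\<lambda>x. B x (axis k 1) + \<i> * B x (axis k \<i>))" for k
    unfolding wirtinger_bar_def directional_deriv_quadratic[OF B sym]
    by (simp add: fun_eq_iff scaleR_conv_of_real)
  have "bounded_linear (\<lambda>x. B x (axis k 1) + \<i> * B x (axis k \<i>))" for k
    by (intro bounded_linear_add bounded_linear_left bounded_linear_compose[OF bounded_linear_mult_right bounded_linear_left])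
  from directional_deriv_linear[OF this] show ?thesis
    unfolding levi_matrix_def bar wirtinger_def by (simp add: algebra_simps add_divide_distrib diff_divide_distrib)
qed

lemma bounded_bilinear_of_real:
  fixes b :: "'a::euclidean_space \<Rightarrow> 'b::euclidean_space \<Rightarrow> real"
  assumes "bounded_bilinear b"
  shows "bounded_bilinear (\<lambda>x y. complex_of_real (b x y))"
proof -
  interpret bounded_bilinear b by (rule assms)
  show ?thesis
    by (rule bounded_bilinear_euclideanI)
       (simp_all add: add_left add_right scaleR_left scaleR_right scaleR_conv_of_real)
qed

text \<open>Continuity makes the coordinate map measurable, which is needed to pull almost
  everywhere statements on \<open>\<Lambda>\<close> back to Lebesgue measure.\<close>

lemma continuous_Lambda_point:
  fixes \<Phi> :: "complex ^ 'n \<Rightarrow> real"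
  assumes b: "bounded_bilinear b" and sym: "\<And>x y. b x y = b y x" and \<Phi>: "\<And>x. \<Phi> x = b x x"
  shows "continuous_on UNIV (Lambda_point \<Phi>)"
proof -
  interpret b: bounded_bilinear b by (rule b)
  have "wirtinger j (\<lambda>y. complex_of_real (\<Phi> y)) x = complex_of_real (b x (axis j 1)) - \<i> * complex_of_real (b x (axis j \<i>))" for j x
    unfolding wirtinger_def \<Phi>
    by (subst (1 2) directional_deriv_quadratic[OF bounded_bilinear_of_real[OF b]])
       (simp_all add: sym scaleR_conv_of_real)
  then have "Lambda_point \<Phi> = (\<lambda>x. (x, \<chi> j. (2 / \<i>) * (complex_of_real (b x (axis j 1)) - \<i> * complex_of_real (b x (axis j \<i>)))))"
    by (simp add: Lambda_point_def fun_eq_iff vec_eq_iff)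
  moreover have "continuous_on UNIV (\<lambda>x. b x y)" for y
    by (rule linear_continuous_on[OF b.bounded_linear_left])
  ultimately show ?thesis
    by (auto intro!: continuous_on_Pair continuous_on_vec_lambda continuous_on_mult continuous_on_diff
        continuous_on_of_real continuous_on_const continuous_on_id continuous_on_minus)
qed

lemma entire_Cn_bilinear:
  assumes \<gamma>: "bounded_bilinear \<gamma>"
    and "\<And>c x y. \<gamma> (c *s x) y = c * \<gamma> x y" "\<And>c x y. \<gamma> x (c *s y) = c * \<gamma> x y"
  shows "entire_Cn (\<lambda>x. \<gamma> x x)"
  unfolding entire_Cn_def
proof (intro allI exI conjI)
  fix x c v
  show "((\<lambda>x. \<gamma> x x) has_derivative (\<lambda>h. \<gamma> x h + \<gamma> h x)) (at x)"
    using bounded_bilinear.FDERIV[OF \<gamma> has_derivative_ident has_derivative_ident] .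
  show "\<gamma> x (c *s v) + \<gamma> (c *s v) x = c * (\<gamma> x v + \<gamma> v x)"
    by (simp add: assms ring_distribs)
qed

lemma vector_scalar_mult_Complex: "c *s (x :: complex ^ 'n) = Re c *\<^sub>R x + Im c *\<^sub>R (\<i> *s x)"
proof -
  have "c * z = Re c *\<^sub>R z + Im c *\<^sub>R (\<i> * z)" for z
    by (simp add: complex_eq_iff)
  then show ?thesis by (simp add: vec_eq_iff)
qed

section \<open>Splitting a real quadratic form into hermitian and holomorphic parts\<close>

locale psh_form =
  fixes b :: "complex ^ 'n \<Rightarrow> complex ^ 'n \<Rightarrow> real"
  assumes b: "bounded_bilinear b" and sym: "b x y = b y x"
begin

interpretation b: bounded_bilinear b by (rule b)

text \<open>The real form \<open>b\<close> splits as \<open>Re \<psi> + Re \<gamma>\<close> with \<open>\<psi>\<close> sesquilinear and \<open>\<gamma>\<close> complex bilinear.\<close>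

definition \<psi> :: "complex ^ 'n \<Rightarrow> complex ^ 'n \<Rightarrow> complex" where
  "\<psi> x y = Complex ((b x y + b (\<i> *s x) (\<i> *s y)) / 2) ((b x (\<i> *s y) - b (\<i> *s x) y) / 2)"

definition \<gamma> :: "complex ^ 'n \<Rightarrow> complex ^ 'n \<Rightarrow> complex" where
  "\<gamma> x y = Complex ((b x y - b (\<i> *s x) (\<i> *s y)) / 2) (- (b x (\<i> *s y) + b (\<i> *s x) y) / 2)"

lemma ii: "\<i> *s (\<i> *s x) = - (x :: complex ^ 'n)"
  by (simp add: vec_eq_iff)

lemma i_add: "\<i> *s (x + y) = \<i> *s x + \<i> *s (y :: complex ^ 'n)"
  by (rule vector_add_ldistrib)

lemma i_scaleR: "\<i> *s (r *\<^sub>R x) = r *\<^sub>R (\<i> *s (x :: complex ^ 'n))"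
  by (simp add: vec_eq_iff)

lemma bilinear_\<psi>: "bounded_bilinear \<psi>"
  unfolding \<psi>_def
  by (rule bounded_bilinear_euclideanI)
     (simp_all add: complex_eq_iff i_add i_scaleR b.add_left b.add_right b.scaleR_left b.scaleR_right
       add_divide_distrib diff_divide_distrib algebra_simps)

lemma bilinear_\<gamma>: "bounded_bilinear \<gamma>"
  unfolding \<gamma>_def
  by (rule bounded_bilinear_euclideanI)
     (simp_all add: complex_eq_iff i_add i_scaleR b.add_left b.add_right b.scaleR_left b.scaleR_right
       add_divide_distrib diff_divide_distrib algebra_simps)

interpretation \<psi>: bounded_bilinear \<psi> by (rule bilinear_\<psi>)
interpretation \<gamma>: bounded_bilinear \<gamma> by (rule bilinear_\<gamma>)

lemma \<psi>_scale_left: "\<psi> (c *s x) y = c * \<psi> x y"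
proof -
  have "\<psi> (\<i> *s x) y = \<i> * \<psi> x y"
    by (simp add: \<psi>_def complex_eq_iff ii b.minus_left b.minus_right add_divide_distrib diff_divide_distrib)
  then have "\<psi> (c *s x) y = (of_real (Re c) + \<i> * of_real (Im c)) * \<psi> x y"
    unfolding vector_scalar_mult_Complex[of c x]
    by (simp add: \<psi>.add_left \<psi>.scaleR_left scaleR_conv_of_real[of _ "_ :: complex"] algebra_simps)
  then show ?thesis by (simp add: complex_eq[symmetric])
qed

lemma \<psi>_swap: "cnj (\<psi> x y) = \<psi> y x"
  by (simp add: \<psi>_def complex_eq_iff sym[of y] sym[of "\<i> *s y"] add_divide_distrib diff_divide_distrib)

lemma \<psi>_scale_right: "\<psi> x (c *s y) = cnj c * \<psi> x y"
  by (subst (1 2) \<psi>_swap[symmetric]) (simp add: \<psi>_scale_left)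

lemma \<gamma>_sym: "\<gamma> x y = \<gamma> y x"
  by (simp add: \<gamma>_def complex_eq_iff sym[of y] sym[of "\<i> *s y"] add.commute)

lemma \<gamma>_scale_left: "\<gamma> (c *s x) y = c * \<gamma> x y"
proof -
  have "\<gamma> (\<i> *s x) y = \<i> * \<gamma> x y"
    by (simp add: \<gamma>_def complex_eq_iff ii b.minus_left b.minus_right add_divide_distrib diff_divide_distrib)
  then have "\<gamma> (c *s x) y = (of_real (Re c) + \<i> * of_real (Im c)) * \<gamma> x y"
    unfolding vector_scalar_mult_Complex[of c x]
    by (simp add: \<gamma>.add_left \<gamma>.scaleR_left scaleR_conv_of_real[of _ "_ :: complex"] algebra_simps)
  then show ?thesis by (simp add: complex_eq[symmetric])
qed

lemma entire_\<gamma>: "entire_Cn (\<lambda>x. \<gamma> x x)"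
  using \<gamma>_scale_left \<gamma>_sym by (intro entire_Cn_bilinear[OF bilinear_\<gamma>]) metis+

lemma split: "b x x = Re (\<psi> x x) + Re (\<gamma> x x)"
  by (simp add: \<psi>_def \<gamma>_def add_divide_distrib diff_divide_distrib)

lemma herm_part_eq: "herm_part (\<lambda>x. b x x) x = Re (\<psi> x x)"
  by (simp add: herm_part_def \<psi>_def)

text \<open>The holomorphic part does not contribute to mixed derivatives, so the Levi matrix is the
  Gram matrix of \<open>\<psi>\<close>; with the expansion of \<open>\<psi> v v\<close> below, its
  positive definiteness becomes that of \<open>\<psi>\<close>.\<close>

lemma levi_matrix_eq: "levi_matrix (\<lambda>x. complex_of_real (b x x)) x $ j $ k = \<psi> (axis j 1) (axis k 1)"
proof -
  have "\<i> *s axis j 1 = (axis j \<i> :: complex ^ 'n)" for j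
    by (simp add: vec_eq_iff axis_def)
  then show ?thesis
    by (subst levi_matrix_quadratic[OF bounded_bilinear_of_real[OF b]])
       (simp_all add: sym \<psi>_def complex_eq_iff)
qed

lemma \<psi>_expand: "\<psi> v v = (\<Sum>j\<in>UNIV. \<Sum>k\<in>UNIV. \<psi> (axis j 1) (axis k 1) * v $ j * cnj (v $ k))"
proof -
  have "\<psi> v v = \<psi> (\<Sum>j\<in>UNIV. v $ j *s axis j 1) (\<Sum>k\<in>UNIV. v $ k *s axis k 1)"
    by (simp add: basis_expansion)
  also have "\<dots> = (\<Sum>j\<in>UNIV. \<Sum>k\<in>UNIV. \<psi> (axis j 1) (axis k 1) * v $ j * cnj (v $ k))"
    by (simp only: \<psi>.sum_left, simp only: \<psi>.sum_right, simp add: \<psi>_scale_left \<psi>_scale_right mult_ac)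
  finally show ?thesis .
qed

end

theorem theorem1p2:
  fixes \<Phi>\<^sub>0 :: "complex ^ 'n \<Rightarrow> real"
    and q :: "complex ^ 'n \<Rightarrow> complex"
    and a :: "(complex ^ 'n) \<times> (complex ^ 'n) \<Rightarrow> complex"
  assumes "strictly_psh_quadratic_form \<Phi>\<^sub>0"
    and "quadratic_form q"
    and "\<And>x. x \<noteq> 0 \<Longrightarrow> 2 * Re (q x) < herm_part \<Phi>\<^sub>0 x"
    and "\<And>x. det (levi_matrix (\<lambda>y. complex_of_real (\<Phi>\<^sub>0 y) - q y) x) \<noteq> 0"
    and "is_weyl_symbol \<Phi>\<^sub>0 (\<lambda>x. exp (2 * q x)) a"
    and "a \<in> Linfty_space (Lambda_measure \<Phi>\<^sub>0)"
  shows "toeplitz_bounded \<Phi>\<^sub>0 (\<lambda>x. exp (2 * q x))"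
proof -
  have psh: "quadratic_form \<Phi>\<^sub>0" "\<And>x. pos_def_matrix (levi_matrix (\<lambda>y. complex_of_real (\<Phi>\<^sub>0 y)) x)"
    using assms(1) by (auto simp: strictly_psh_quadratic_form_def)
  obtain b where \<Phi>_form: "bounded_bilinear b" "\<And>x y. b x y = b y x" "\<And>x. \<Phi>\<^sub>0 x = b x x"
    using quadratic_form_polarization[OF psh(1)] by blast
  obtain \<beta> where \<beta>: "bounded_bilinear \<beta>" "\<And>x y. \<beta> x y = \<beta> y x" "\<And>x. q x = \<beta> x x"
    using quadratic_form_polarization[OF assms(2)] by blast
  have \<Phi>: "\<Phi>\<^sub>0 = (\<lambda>x. b x x)" and q: "q = (\<lambda>x. \<beta> x x)"
    using \<Phi>_form(3) \<beta>(3) by auto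
  interpret psh_form b
    by (rule psh_form.intro[OF \<Phi>_form(1,2)])
  interpret hermitian_form \<psi>
  proof (rule hermitian_form.intro)
    fix x :: "complex ^ 'n" assume "x \<noteq> 0"
    then show "0 < Re (\<psi> x x)"
      using psh(2)[of 0] unfolding pos_def_matrix_def \<Phi> levi_matrix_eq \<psi>_expand[of x] by blast
  qed (simp_all add: bounded_bilinear.add_left[OF bilinear_\<psi>] \<psi>_scale_left \<psi>_swap)
  have herm: "herm_part \<Phi>\<^sub>0 = N"
    by (simp add: \<Phi> herm_part_eq N_def fun_eq_iff)
  interpret toeplitz_gaussian \<psi> \<Phi>\<^sub>0 "\<lambda>x. \<gamma> x x" \<beta>
  proof (intro toeplitz_gaussian.intro bargmann.intro bargmann_axioms.intro toeplitz_gaussian_axioms.intro)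
    show "hermitian_form \<psi>" by (rule hermitian_form_axioms)
    show "entire_Cn (\<lambda>x. \<gamma> x x)" by (rule entire_\<gamma>)
    show "\<Phi>\<^sub>0 x = N x + Re (\<gamma> x x)" for x by (simp add: \<Phi>_form(3) split N_def)
    show "2 * Re (\<beta> x x) < N x" if "x \<noteq> 0" for x
      using assms(3)[OF that] by (simp add: q herm)
  qed (fact \<beta>)+
  obtain C where "AE p in Lambda_measure \<Phi>\<^sub>0. norm (a p) \<le> C"
    using assms(6) by (auto simp: Linfty_space_def)
  moreover have "Lambda_point \<Phi>\<^sub>0 \<in> lborel \<rightarrow>\<^sub>M restrict_space borel (Lambda_set \<Phi>\<^sub>0)"
    using borel_measurable_continuous_onI[OF continuous_Lambda_point[OF \<Phi>_form]]
    by (intro measurable_restrict_space2) (auto simp: Lambda_set_def)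
  \<comment> \<open>The measure on \<open>\<Lambda>\<close> is an image of Lebesgue measure under
    the coordinate map, so the essential bound transfers to the point \<open>z\<close>.\<close>
  ultimately have "AE z in lborel. norm (a (Lambda_point \<Phi>\<^sub>0 z)) \<le> C"
    unfolding Lambda_measure_def by (rule AE_distrD[rotated])
  \<comment> \<open>The heat operator divides by the total mass of its Gaussian; undoing this
    normalization multiplies the essential bound \<open>C\<close> by that mass.\<close>
  then have "AE z in lborel. norm (\<integral>y. exp (- 4 * N (z - y)) * exp (2 * \<beta> y y) \<partial>lborel) \<le> C * (\<integral>y. exp (- 4 * N y) \<partial>lborel)"
  proof eventually_elim
    case (elim z)
    have "0 < (\<integral>y. exp (- 4 * N y) \<partial>lborel)"
      by (rule integral_exp_N_pos) simp
    then show ?case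
      using elim assms(5) by (simp add: is_weyl_symbol_def heat_operator_def herm q norm_divide divide_le_eq)
  qed
  from toeplitz_bounded_if_heat_bounded[OF this] show ?thesis
    unfolding q .
qed

end
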